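(* There exists an absolute constant $N$, and for each integer $k\ge 2$ and each prime power $q$ a positive real number $b=b(q,k)$, with the following property. Fix $k \ge 2$, let $G = Cl_n(q)$ with $n \ge N$, and let $S$ be a sequence of $k$ independently chosen (uniformly) random elements of $G$. Then, as $|G|\to\infty$, the girth of the undirected Cayley graph $\Gamma(G,S)$ exceeds $b(q,k)\sqrt{\log |G|}$ almost surely, i.e. with probability tending to $1$ as $|G|\to\infty$.
   Context: $Cl_n(q)$ denotes a finite simple classical group over $\mathbb{F}_q$ with natural module of dimension $n$ (that is, one of the simple groups $PSL_n(q)$, $PSU_n(q)$, $PSp_n(q)$, $P\Omega_n^{(\pm)}(q)$; in the unitary case the natural module is over $\mathbb{F}_{q^2}$). For a finite group $G$ and a sequence $S=(g_1,\dots,g_k)$ of elements of $G$, $\Gamma(G,S)$ is the associated undirected Cayley graph: the vertex set is $G$, and $x$ is joined to $xg_i^{\pm 1}$ for each $x\in G$ and $1\le i\le k$. The girth of a graph is the minimal length of a cycle in it. *)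

theory Defs
  imports
    "HOL-Probability.Probability"
    "HOL-Algebra.Algebra"
    "HOL-Number_Theory.Prime_Powers"
    "HOL-Combinatorics.Permutations"
begin

section \<open>The natural module and linear groups\<close>

text \<open>
  Vectors are extensional functions on the coordinate set \<open>{..<n}\<close>, and linear groups are subgroups
  of the permutation group \<open>BijGroup (nat_module F n)\<close>, with composition as multiplication.
\<close>

definition nat_module :: "('a, 'b) ring_scheme \<Rightarrow> nat \<Rightarrow> (nat \<Rightarrow> 'a) set" where
  "nat_module F n = {..<n} \<rightarrow>\<^sub>E carrier F"

definition vadd :: "('a, 'b) ring_scheme \<Rightarrow> nat \<Rightarrow> (nat \<Rightarrow> 'a) \<Rightarrow> (nat \<Rightarrow> 'a) \<Rightarrow> nat \<Rightarrow> 'a" where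
  "vadd F n v w = (\<lambda>i\<in>{..<n}. v i \<oplus>\<^bsub>F\<^esub> w i)"

definition vsmult :: "('a, 'b) ring_scheme \<Rightarrow> nat \<Rightarrow> 'a \<Rightarrow> (nat \<Rightarrow> 'a) \<Rightarrow> nat \<Rightarrow> 'a" where
  "vsmult F n a v = (\<lambda>i\<in>{..<n}. a \<otimes>\<^bsub>F\<^esub> v i)"

definition unit_vec :: "('a, 'b) ring_scheme \<Rightarrow> nat \<Rightarrow> nat \<Rightarrow> nat \<Rightarrow> 'a" where
  "unit_vec F n j = (\<lambda>i\<in>{..<n}. if i = j then \<one>\<^bsub>F\<^esub> else \<zero>\<^bsub>F\<^esub>)"

definition GL :: "('a, 'b) ring_scheme \<Rightarrow> nat \<Rightarrow> ((nat \<Rightarrow> 'a) \<Rightarrow> (nat \<Rightarrow> 'a)) set" where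
  "GL F n = {f \<in> Bij (nat_module F n).
     (\<forall>v\<in>nat_module F n. \<forall>w\<in>nat_module F n. f (vadd F n v w) = vadd F n (f v) (f w)) \<and>
     (\<forall>a\<in>carrier F. \<forall>v\<in>nat_module F n. f (vsmult F n a v) = vsmult F n a (f v))}"

text \<open>Leibniz formula for the matrix whose \<open>(i, j)\<close> entry is \<open>f (unit_vec F n j) i\<close>.\<close>

definition op_det :: "('a, 'b) ring_scheme \<Rightarrow> nat \<Rightarrow> ((nat \<Rightarrow> 'a) \<Rightarrow> (nat \<Rightarrow> 'a)) \<Rightarrow> 'a" where
  "op_det F n f =
     (\<Oplus>\<^bsub>F\<^esub>p\<in>{p. p permutes {..<n}}.
        (if evenperm p then \<one>\<^bsub>F\<^esub> else \<ominus>\<^bsub>F\<^esub> \<one>\<^bsub>F\<^esub>) \<otimes>\<^bsub>F\<^esub>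
        (\<Otimes>\<^bsub>F\<^esub>j\<in>{..<n}. f (unit_vec F n j) (p j)))"

definition SL :: "('a, 'b) ring_scheme \<Rightarrow> nat \<Rightarrow> ((nat \<Rightarrow> 'a) \<Rightarrow> (nat \<Rightarrow> 'a)) set" where
  "SL F n = {f \<in> GL F n. op_det F n f = \<one>\<^bsub>F\<^esub>}"


section \<open>Forms and their isometry groups\<close>

text \<open>The hermitian form over the field with \<open>q\<^sup>2\<close> elements, whose involution is \<open>x \<mapsto> x\<^sup>q\<close>.\<close>

definition hermitian_form ::
    "('a, 'b) ring_scheme \<Rightarrow> nat \<Rightarrow> nat \<Rightarrow> (nat \<Rightarrow> 'a) \<Rightarrow> (nat \<Rightarrow> 'a) \<Rightarrow> 'a" where
  "hermitian_form F q n v w = (\<Oplus>\<^bsub>F\<^esub>i\<in>{..<n}. v i \<otimes>\<^bsub>F\<^esub> (w i [^]\<^bsub>F\<^esub> q))"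

definition SU :: "('a, 'b) ring_scheme \<Rightarrow> nat \<Rightarrow> nat \<Rightarrow> ((nat \<Rightarrow> 'a) \<Rightarrow> (nat \<Rightarrow> 'a)) set" where
  "SU F q n = {f \<in> SL F n. \<forall>v\<in>nat_module F n. \<forall>w\<in>nat_module F n.
     hermitian_form F q n (f v) (f w) = hermitian_form F q n v w}"

text \<open>The hyperbolic pairs of coordinates are \<open>(2 * i, 2 * i + 1)\<close>; here \<open>n\<close> is meant to be even.\<close>

definition symplectic_form ::
    "('a, 'b) ring_scheme \<Rightarrow> nat \<Rightarrow> (nat \<Rightarrow> 'a) \<Rightarrow> (nat \<Rightarrow> 'a) \<Rightarrow> 'a" where
  "symplectic_form F n v w =
     (\<Oplus>\<^bsub>F\<^esub>i\<in>{..<n div 2}.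
        v (2 * i) \<otimes>\<^bsub>F\<^esub> w (2 * i + 1) \<ominus>\<^bsub>F\<^esub> v (2 * i + 1) \<otimes>\<^bsub>F\<^esub> w (2 * i))"

definition Sp :: "('a, 'b) ring_scheme \<Rightarrow> nat \<Rightarrow> ((nat \<Rightarrow> 'a) \<Rightarrow> (nat \<Rightarrow> 'a)) set" where
  "Sp F n = {f \<in> GL F n. \<forall>v\<in>nat_module F n. \<forall>w\<in>nat_module F n.
     symplectic_form F n (f v) (f w) = symplectic_form F n v w}"

definition hyperbolic_sum :: "('a, 'b) ring_scheme \<Rightarrow> nat \<Rightarrow> (nat \<Rightarrow> 'a) \<Rightarrow> 'a" where
  "hyperbolic_sum F m v = (\<Oplus>\<^bsub>F\<^esub>i\<in>{..<m}. v (2 * i) \<otimes>\<^bsub>F\<^esub> v (2 * i + 1))"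

text \<open>
  Nondegenerate quadratic forms, up to isometry and (for odd \<open>n\<close>) scaling: \<open>quad_odd\<close> for odd \<open>n\<close>
  (and odd characteristic), and for even \<open>n\<close> the forms \<open>quad_plus\<close> and \<open>quad_minus\<close> of Witt index
  \<open>n div 2\<close> and \<open>n div 2 - 1\<close>. The latter needs a parameter \<open>z\<close> making \<open>a\<^sup>2 + a b + z b\<^sup>2\<close>
  anisotropic.
\<close>

definition quad_odd :: "('a, 'b) ring_scheme \<Rightarrow> nat \<Rightarrow> (nat \<Rightarrow> 'a) \<Rightarrow> 'a" where
  "quad_odd F n v = hyperbolic_sum F (n div 2) v \<oplus>\<^bsub>F\<^esub> v (n - 1) \<otimes>\<^bsub>F\<^esub> v (n - 1)"

definition quad_plus :: "('a, 'b) ring_scheme \<Rightarrow> nat \<Rightarrow> (nat \<Rightarrow> 'a) \<Rightarrow> 'a" where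
  "quad_plus F n v = hyperbolic_sum F (n div 2) v"

definition binary_quad :: "('a, 'b) ring_scheme \<Rightarrow> 'a \<Rightarrow> 'a \<Rightarrow> 'a \<Rightarrow> 'a" where
  "binary_quad F z a b =
     (a \<otimes>\<^bsub>F\<^esub> a \<oplus>\<^bsub>F\<^esub> a \<otimes>\<^bsub>F\<^esub> b) \<oplus>\<^bsub>F\<^esub> z \<otimes>\<^bsub>F\<^esub> (b \<otimes>\<^bsub>F\<^esub> b)"

definition anisotropic_param :: "('a, 'b) ring_scheme \<Rightarrow> 'a \<Rightarrow> bool" where
  "anisotropic_param F z \<longleftrightarrow> z \<in> carrier F \<and>
     (\<forall>a\<in>carrier F. \<forall>b\<in>carrier F.
        binary_quad F z a b = \<zero>\<^bsub>F\<^esub> \<longrightarrow> a = \<zero>\<^bsub>F\<^esub> \<and> b = \<zero>\<^bsub>F\<^esub>)"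

definition quad_minus :: "('a, 'b) ring_scheme \<Rightarrow> 'a \<Rightarrow> nat \<Rightarrow> (nat \<Rightarrow> 'a) \<Rightarrow> 'a" where
  "quad_minus F z n v =
     hyperbolic_sum F (n div 2 - 1) v \<oplus>\<^bsub>F\<^esub> binary_quad F z (v (n - 2)) (v (n - 1))"

definition GO ::
    "('a, 'b) ring_scheme \<Rightarrow> nat \<Rightarrow> ((nat \<Rightarrow> 'a) \<Rightarrow> 'a) \<Rightarrow> ((nat \<Rightarrow> 'a) \<Rightarrow> (nat \<Rightarrow> 'a)) set" where
  "GO F n Q = {f \<in> GL F n. \<forall>v\<in>nat_module F n. Q (f v) = Q v}"

text \<open>
  The derived subgroup of the full isometry group of \<open>Q\<close>. It is the usual \<open>\<Omega>(Q)\<close> (the kernel of the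
  spinor norm on \<open>SO(Q)\<close>, resp. of the Dickson invariant in characteristic 2) whenever \<open>n \<ge> 5\<close>.
\<close>

definition Omega ::
    "('a, 'b) ring_scheme \<Rightarrow> nat \<Rightarrow> ((nat \<Rightarrow> 'a) \<Rightarrow> 'a) \<Rightarrow> ((nat \<Rightarrow> 'a) \<Rightarrow> (nat \<Rightarrow> 'a)) set" where
  "Omega F n Q = derived (BijGroup (nat_module F n)) (GO F n Q)"


section \<open>Finite simple classical groups\<close>

definition center :: "('g, 'm) monoid_scheme \<Rightarrow> 'g set" where
  "center G = {z \<in> carrier G. \<forall>g\<in>carrier G. z \<otimes>\<^bsub>G\<^esub> g = g \<otimes>\<^bsub>G\<^esub> z}"

definition proj_group ::
    "('a, 'b) ring_scheme \<Rightarrow> nat \<Rightarrow> ((nat \<Rightarrow> 'a) \<Rightarrow> (nat \<Rightarrow> 'a)) set \<Rightarrow>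
     ((nat \<Rightarrow> 'a) \<Rightarrow> (nat \<Rightarrow> 'a)) set monoid" where
  "proj_group F n H =
     (let G = (BijGroup (nat_module F n))\<lparr>carrier := H\<rparr> in G Mod center G)"

definition PSL where "PSL F n = proj_group F n (SL F n)"
definition PSU where "PSU F q n = proj_group F n (SU F q n)"
definition PSp where "PSp F n = proj_group F n (Sp F n)"
definition POmega_odd where "POmega_odd F n = proj_group F n (Omega F n (quad_odd F n))"
definition POmega_plus where "POmega_plus F n = proj_group F n (Omega F n (quad_plus F n))"
definition POmega_minus where
  "POmega_minus F z n = proj_group F n (Omega F n (quad_minus F z n))"

text \<open>
  Taking the field to be a ring on a set of naturals is no restriction up to isomorphism, and lets
  one formula range over all finite fields. For \<open>n\<close> odd and \<open>q\<close> even the orthogonal group is excluded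
  as usual: the polar form is then degenerate, and the group is \<open>PSp\<close> in dimension \<open>n - 1\<close>.
\<close>

definition Cl :: "nat \<Rightarrow> nat \<Rightarrow> ((nat \<Rightarrow> nat) \<Rightarrow> (nat \<Rightarrow> nat)) set monoid set" where
  "Cl n q = {G. simple_group G \<and> (\<exists>F :: nat ring. field F \<and> finite (carrier F) \<and>
     (order F = q \<and>
        (G = PSL F n \<or>
         even n \<and> G = PSp F n \<or>
         odd n \<and> odd q \<and> G = POmega_odd F n \<or>
         even n \<and> G = POmega_plus F n \<or>
         even n \<and> (\<exists>z. anisotropic_param F z \<and> G = POmega_minus F z n)) \<or>
      order F = q\<^sup>2 \<and> G = PSU F q n))}"


section \<open>Cayley graphs and girth\<close>

definition cayley_adj :: "('g, 'm) monoid_scheme \<Rightarrow> 'g list \<Rightarrow> 'g \<Rightarrow> 'g \<Rightarrow> bool" where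
  "cayley_adj G S x y \<longleftrightarrow> x \<in> carrier G \<and>
     (\<exists>g\<in>set S. y = x \<otimes>\<^bsub>G\<^esub> g \<or> y = x \<otimes>\<^bsub>G\<^esub> inv\<^bsub>G\<^esub> g)"

text \<open>
  Cycles in an undirected graph given by a symmetric adjacency relation. A loop is a cycle of
  length 1; traversing one edge back and forth (length 2) is not a cycle.
\<close>

definition is_cycle :: "('v \<Rightarrow> 'v \<Rightarrow> bool) \<Rightarrow> 'v list \<Rightarrow> bool" where
  "is_cycle E c \<longleftrightarrow> distinct c \<and> length c \<noteq> 0 \<and> length c \<noteq> 2 \<and>
     (\<forall>i<length c. E (c ! i) (c ! (Suc i mod length c)))"

text \<open>The girth of an acyclic graph is \<open>\<infinity>\<close>.\<close>

definition girth :: "('v \<Rightarrow> 'v \<Rightarrow> bool) \<Rightarrow> enat" where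
  "girth E = (INF c\<in>{c. is_cycle E c}. enat (length c))"

end

theory Submission
  imports Defs "HOL-Library.Sublist"
begin

text \<open>
  If \<open>b q k\<close> is taken of order \<open>1 / (k q\<^sup>3)\<close>, the bound in the theorem is below 1, hence
  trivially true, unless \<open>n\<close> is at least of order \<open>k q\<^sup>2\<close>. So the dimension may be assumed large
  compared with \<open>q\<close> and \<open>k\<close>, and the claim is that with high probability no cycle has length at most \<open>l\<close>, where
  \<open>l\<close> is at most a small multiple of \<open>n / (k q\<^sup>2)\<close>.

  Let \<open>H\<close> be the linear group with \<open>G = H / Z(H)\<close>. A cycle of length \<open>c \<le> l\<close> gives a nonempty reduced
  word \<open>w\<close> of length \<open>c\<close> whose value at the chosen tuple lies in \<open>Z(H)\<close>. Since there are at least two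
  generators, some letter \<open>y\<close> makes \<open>w y w\<inverse> y\<inverse>\<close> reduced, and this word of length
  \<open>2 c + 2\<close> has value 1 in \<open>H\<close> (\<open>ex_reduced_commutator\<close>, \<open>central_commutator_word\<close>). It remains to bound,
  for one nonempty reduced word \<open>w\<close> of length at most \<open>L = 2 l + 2\<close>, the probability that \<open>w\<close> vanishes
  at a uniformly random tuple of \<open>H\<close>, and to sum over at most \<open>(l + 1) (2 k)\<^sup>l\<close> words.

  For this follow a nonzero vector \<open>x\<close> along the suffixes of \<open>w\<close>. As long as every point of the walk
  lies outside the span of the earlier ones, the generator applied next is known only on a set \<open>A\<close>
  of at most \<open>L\<close> vectors whose span does not contain the present point \<open>v\<close>: this is where reducedness
  enters. Given these values, the generator is uniform on a coset of the pointwise stabilizer of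
  \<open>A\<close>, so the next point is uniform on a translate of the orbit of \<open>v\<close> under this stabilizer. If such
  orbits have at least \<open>R\<close> elements, the next point falls into the span of the at most \<open>L\<close> earlier ones
  with probability at most \<open>|F|\<^sup>L / R\<close>. Hence \<open>w\<close> vanishes with probability at most
  \<open>L |F|\<^sup>L / R\<close> (\<open>card_trapped_le\<close>).

  The orbits are large because the groups contain many elements supported on few directions. Let
  \<open>\<langle>,\<rangle>\<close> be the form preserved by the group. As \<open>v\<close> is not in the double orthogonal of \<open>A\<close>, some
  vector in the orthogonal \<open>A\<^sup>\<bottom>\<close> is not orthogonal to \<open>v\<close>; if a totally singular subspace \<open>T\<close> of
  large dimension exists, this vector can be chosen singular, and in many ways (\<open>many_singular\<close>). The
  transvections \<open>y \<mapsto> y + c \<langle>y, e\<rangle> e\<close> along such vectors \<open>e\<close> fix \<open>A\<close> pointwise and move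
  \<open>v\<close> to many places; this settles the symplectic and unitary groups, and for the special linear
  group one uses \<open>y \<mapsto> y + \<langle>y, x\<rangle> a\<close> with the standard scalar product. Transvections have
  determinant 1 because \<open>t\<^bsup>|F|\<^esup> = 1\<close> and \<open>det(t)\<^bsup>|F|\<^esup> = det(t)\<close>. In the orthogonal case the same role
  is played by Eichler transformations, which are commutators of a reflection with another Eichler
  transformation and hence lie in the derived group (\<open>eichler_is_commutator\<close>). In all cases the
  orbits have at least \<open>|F|\<^bsup>n div q - L - 4\<^esup>\<close> elements, which beats \<open>(2 k)\<^sup>l |F|\<^sup>L\<close>.
\<close>

section \<open>Words and the walk of a point\<close>

text \<open>
  A resampling principle. Pick \<open>a\<close> in \<open>A\<close> uniformly, then \<open>u\<close> in \<open>K a\<close> uniformly: because each move is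
  undone by a move of the same kind and \<open>K\<close> is constant along moves, the map
  \<open>(a, u) \<mapsto> (m a u, i u)\<close> preserves this distribution, so \<open>m a u\<close> is again uniform on \<open>A\<close>. A bound on the
  proportion of bad moves at every point therefore bounds the proportion of bad points. This is how
  conditioning on partial information about a random tuple is expressed.
\<close>

lemma card_bad_le_of_involution:
  fixes m :: "'a \<Rightarrow> 'u \<Rightarrow> 'a" and c :: real and K :: "'a \<Rightarrow> 'u set" and i :: "'u \<Rightarrow> 'u"
  assumes fin: "finite A" and K: "\<And>a. a \<in> A \<Longrightarrow> finite (K a) \<and> K a \<noteq> {}"
    and m: "\<And>a u. a \<in> A \<Longrightarrow> u \<in> K a \<Longrightarrow> m a u \<in> A \<and> K (m a u) = K a \<and> i u \<in> K a \<and> m (m a u) (i u) = a \<and> i (i u) = u"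
    and bad: "\<And>a. a \<in> A \<Longrightarrow> real (card {u \<in> K a. bad (m a u)}) \<le> c * card (K a)"
  shows "real (card {a \<in> A. bad a}) \<le> c * card A"
proof -
  have pos: "real (card (K a)) > 0" if "a \<in> A" for a
    using K[OF that] by (simp add: card_gt_0_iff)
  have "real (card {a \<in> A. bad a}) = (\<Sum>a\<in>A. of_bool (bad a))"
    using fin by (simp add: Collect_conj_eq)
  also have "\<dots> = (\<Sum>a\<in>A. \<Sum>u\<in>K a. of_bool (bad a) / card (K a))"
    using pos by (intro sum.cong) auto
  also have "\<dots> = (\<Sum>(a, u)\<in>Sigma A K. of_bool (bad a) / card (K a))"
    using fin K by (intro sum.Sigma) auto
  also have "\<dots> = (\<Sum>(a, u)\<in>Sigma A K. of_bool (bad (m a u)) / card (K a))"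
    by (rule sum.reindex_bij_witness[of _ "\<lambda>(a, u). (m a u, i u)" "\<lambda>(a, u). (m a u, i u)"])
      (auto simp: m)
  also have "\<dots> = (\<Sum>a\<in>A. \<Sum>u\<in>K a. of_bool (bad (m a u)) / card (K a))"
    using fin K by (intro sum.Sigma[symmetric]) auto
  also have "\<dots> = (\<Sum>a\<in>A. real (card {u \<in> K a. bad (m a u)}) / card (K a))"
    using K by (intro sum.cong) (auto simp: sum_divide_distrib[symmetric] Collect_conj_eq)
  also have "\<dots> \<le> (\<Sum>a\<in>A. c)"
    using bad pos by (intro sum_mono) (auto simp: divide_le_eq)
  finally show ?thesis by (simp add: mult.commute)
qed

type_synonym letter = "nat \<times> bool"

fun inv_letter :: "letter \<Rightarrow> letter" where
  "inv_letter (j, b) = (j, \<not> b)"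

abbreviation reduced :: "letter list \<Rightarrow> bool" where
  "reduced \<equiv> successively (\<lambda>s t. t \<noteq> inv_letter s)"

fun letter_val :: "('g, 'm) monoid_scheme \<Rightarrow> 'g list \<Rightarrow> letter \<Rightarrow> 'g" where
  "letter_val G h (j, b) = (if b then h ! j else inv\<^bsub>G\<^esub> (h ! j))"

fun word_val :: "('g, 'm) monoid_scheme \<Rightarrow> 'g list \<Rightarrow> letter list \<Rightarrow> 'g" where
  "word_val G h [] = \<one>\<^bsub>G\<^esub>"
| "word_val G h (s # w) = letter_val G h s \<otimes>\<^bsub>G\<^esub> word_val G h w"

definition tuples :: "nat \<Rightarrow> 'g set \<Rightarrow> 'g list set" where
  "tuples k A = {h. set h \<subseteq> A \<and> length h = k}"

abbreviation letters :: "nat \<Rightarrow> letter set" where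
  "letters k \<equiv> {..<k} \<times> UNIV"

lemma finite_tuples: "finite A \<Longrightarrow> finite (tuples k A)"
  unfolding tuples_def by (rule finite_lists_length_eq)

lemma inv_letter_inv_letter [simp]: "inv_letter (inv_letter s) = s"
  by (cases s) auto

lemma tuples_nth: "h \<in> tuples k A \<Longrightarrow> j < k \<Longrightarrow> h ! j \<in> A"
  by (auto simp: tuples_def)

lemma (in group) letter_val_closed:
  "h \<in> tuples k (carrier G) \<Longrightarrow> s \<in> letters k \<Longrightarrow> letter_val G h s \<in> carrier G"
  by (cases s) (auto dest: tuples_nth)

lemma (in group) letter_val_inv_letter:
  "h \<in> tuples k (carrier G) \<Longrightarrow> s \<in> letters k \<Longrightarrow> letter_val G h (inv_letter s) = inv (letter_val G h s)"
  by (cases s) (auto dest: tuples_nth)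

lemma (in group) word_val_closed:
  "h \<in> tuples k (carrier G) \<Longrightarrow> set w \<subseteq> letters k \<Longrightarrow> word_val G h w \<in> carrier G"
  by (induction w) (auto simp: letter_val_closed simp del: letter_val.simps)

context group_action
begin

sublocale G: group G by (rule group_hom.axioms(1)[OF group_hom])

text \<open>
  Words act from the right end, so the walk of \<open>x\<close> under \<open>w\<close> runs through the suffixes of \<open>w\<close>.
\<close>

definition visited :: "'a list \<Rightarrow> 'c \<Rightarrow> letter list \<Rightarrow> 'c set" where
  "visited h x w = {\<phi> (word_val G h u) x | u. suffix u w}"

text \<open>
  The operator \<open>cl\<close> stands for the linear span: \<open>x\<close> and its successive images are required to be
  linearly independent.
\<close>

fun escaping :: "('c set \<Rightarrow> 'c set) \<Rightarrow> 'a list \<Rightarrow> 'c \<Rightarrow> letter list \<Rightarrow> bool" where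
  "escaping cl h x [] \<longleftrightarrow> x \<notin> cl {}"
| "escaping cl h x (s # w) \<longleftrightarrow>
     escaping cl h x w \<and> \<phi> (word_val G h (s # w)) x \<notin> cl (visited h x w)"

text \<open>
  The right factor for \<open>(j, True)\<close> and the inverse left factor for \<open>(j, False)\<close> are chosen such that
  in both cases the value of the letter itself is multiplied by \<open>u\<close> from the right.
\<close>

definition modify :: "letter \<Rightarrow> 'a list \<Rightarrow> 'a \<Rightarrow> 'a list" where
  "modify s h u = (case s of (j, b) \<Rightarrow>
     h[j := if b then h ! j \<otimes>\<^bsub>G\<^esub> u else inv\<^bsub>G\<^esub> u \<otimes>\<^bsub>G\<^esub> h ! j])"

text \<open>
  The points on which the value of the letter \<open>s\<close> is determined by the walk: those to which \<open>s\<close> was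
  applied, and those that arose by applying its inverse.
\<close>

definition sources :: "letter \<Rightarrow> 'a list \<Rightarrow> 'c \<Rightarrow> letter list \<Rightarrow> 'c set" where
  "sources s h x w =
     {\<phi> (word_val G h u) x | u. suffix (s # u) w} \<union>
     {\<phi> (word_val G h (inv_letter s # u)) x | u. suffix (inv_letter s # u) w}"

definition fixer :: "'c set \<Rightarrow> 'a set" where
  "fixer A = {u \<in> carrier G. \<forall>a\<in>A. \<phi> u a = a}"

lemma act_mult: "g \<in> carrier G \<Longrightarrow> h \<in> carrier G \<Longrightarrow> x \<in> E \<Longrightarrow> \<phi> (g \<otimes>\<^bsub>G\<^esub> h) x = \<phi> g (\<phi> h x)"
  by (rule composition_rule)

lemma act_one: "x \<in> E \<Longrightarrow> \<phi> \<one>\<^bsub>G\<^esub> x = x"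
  using id_eq_one by (metis restrict_apply')

lemma act_closed: "g \<in> carrier G \<Longrightarrow> x \<in> E \<Longrightarrow> \<phi> g x \<in> E"
  using element_image by blast

lemma act_inv: "g \<in> carrier G \<Longrightarrow> x \<in> E \<Longrightarrow> \<phi> (inv\<^bsub>G\<^esub> g) (\<phi> g x) = x"
  by (metis act_mult act_one G.inv_closed G.l_inv)

lemma subgroup_fixer: "A \<subseteq> E \<Longrightarrow> subgroup (fixer A) G"
  by (rule subgroup.intro)
    (use act_mult act_one act_inv in \<open>auto simp: fixer_def subset_iff\<close>, metis act_inv)

text \<open>
  The image of \<open>x\<close> under a uniform element of a stabilizer is uniform on the orbit of \<open>x\<close>, hence falls
  into \<open>C\<close> with probability at most \<open>|C|\<close> divided by the size of the orbit.
\<close>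

lemma card_fixer_into_le:
  assumes fin: "finite (carrier G)" and A: "A \<subseteq> E" and x: "x \<in> E" and C: "finite C"
  shows "card {u \<in> fixer A. \<phi> u x \<in> C} * card {\<phi> u x | u. u \<in> fixer A} \<le> card C * card (fixer A)"
proof -
  let ?K = "fixer A" let ?S = "{u \<in> ?K. \<phi> u x = x}" let ?O = "{\<phi> u x | u. u \<in> ?K}"
  interpret K: subgroup ?K G by (rule subgroup_fixer[OF A])
  have finK: "finite ?K" by (rule finite_subset[OF K.subset fin])
  have fibre: "card {u \<in> ?K. \<phi> u x = y} = card ?S" if y: "y \<in> ?O" for y
  proof -
    obtain t where t: "t \<in> ?K" "y = \<phi> t x" using y by auto
    have tc: "t \<in> carrier G" using t K.subset by auto
    have "bij_betw (\<lambda>u. t \<otimes>\<^bsub>G\<^esub> u) ?S {u \<in> ?K. \<phi> u x = y}"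
    proof (rule bij_betwI[where g = "\<lambda>u. inv\<^bsub>G\<^esub> t \<otimes>\<^bsub>G\<^esub> u"])
      show "(\<lambda>u. t \<otimes>\<^bsub>G\<^esub> u) \<in> ?S \<rightarrow> {u \<in> ?K. \<phi> u x = y}"
        using t tc x K.subset by (auto simp: act_mult subset_iff)
      show "(\<lambda>u. inv\<^bsub>G\<^esub> t \<otimes>\<^bsub>G\<^esub> u) \<in> {u \<in> ?K. \<phi> u x = y} \<rightarrow> ?S"
        using t tc x K.subset act_inv[OF tc x] by (auto simp: act_mult subset_iff)
    qed (use tc K.subset in \<open>auto simp: G.m_assoc[symmetric] subset_iff\<close>)
    then show ?thesis by (simp add: bij_betw_same_card)
  qed
  have finO: "finite ?O" using finK by simp
  have "card ?K = card (\<Union>y\<in>?O. {u \<in> ?K. \<phi> u x = y})"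
    by (rule arg_cong[where f = card]) auto
  also have "\<dots> = (\<Sum>y\<in>?O. card {u \<in> ?K. \<phi> u x = y})"
    using finO finK by (intro card_UN_disjoint) auto
  also have "\<dots> = card ?O * card ?S" using fibre by simp
  finally have 1: "card ?K = card ?O * card ?S" .
  have "{u \<in> ?K. \<phi> u x \<in> C} = (\<Union>y\<in>C \<inter> ?O. {u \<in> ?K. \<phi> u x = y})" by auto
  then have "card {u \<in> ?K. \<phi> u x \<in> C} \<le> (\<Sum>y\<in>C \<inter> ?O. card {u \<in> ?K. \<phi> u x = y})"
    using C by (simp add: card_UN_le)
  also have "\<dots> = card (C \<inter> ?O) * card ?S" using fibre by simp
  also have "\<dots> \<le> card C * card ?S" using C by (simp add: card_mono)
  finally show ?thesis unfolding 1 by (simp add: mult.assoc mult.left_commute)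
qed

lemma modify_closed:
  assumes "h \<in> tuples k (carrier G)" "s \<in> letters k" "u \<in> carrier G"
  shows "modify s h u \<in> tuples k (carrier G)"
  using assms tuples_nth[of h k "carrier G" "fst s"]
  by (auto simp: tuples_def modify_def split: prod.splits dest!: set_update_subset_insert[THEN subsetD])

lemma modify_modify_inv:
  assumes "h \<in> tuples k (carrier G)" "s \<in> letters k" "u \<in> carrier G"
  shows "modify s (modify s h u) (inv\<^bsub>G\<^esub> u) = h"
proof (cases s)
  case (Pair j b)
  have "h ! j \<in> carrier G" "j < length h" using assms Pair tuples_nth[of h k] by (auto simp: tuples_def)
  then show ?thesis using assms(3) Pair
    by (simp add: modify_def G.m_assoc) (simp add: G.m_assoc[symmetric])
qed

lemma letter_val_modify:
  assumes "h \<in> tuples k (carrier G)" "s \<in> letters k" "u \<in> carrier G"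
  shows "letter_val G (modify s h u) s = letter_val G h s \<otimes>\<^bsub>G\<^esub> u"
    and "letter_val G (modify s h u) (inv_letter s) = inv\<^bsub>G\<^esub> u \<otimes>\<^bsub>G\<^esub> letter_val G h (inv_letter s)"
    and "t \<noteq> s \<Longrightarrow> t \<noteq> inv_letter s \<Longrightarrow> letter_val G (modify s h u) t = letter_val G h t"
proof -
  obtain j b where s: "s = (j, b)" by (cases s)
  have j: "h ! j \<in> carrier G" "j < length h" using assms s tuples_nth[of h k] by (auto simp: tuples_def)
  show "letter_val G (modify s h u) s = letter_val G h s \<otimes>\<^bsub>G\<^esub> u"
    and "letter_val G (modify s h u) (inv_letter s) = inv\<^bsub>G\<^esub> u \<otimes>\<^bsub>G\<^esub> letter_val G h (inv_letter s)"
    using j assms(3) s by (auto simp: modify_def G.inv_mult_group)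
  show "letter_val G (modify s h u) t = letter_val G h t" if "t \<noteq> s" "t \<noteq> inv_letter s"
    using that s by (cases t) (auto simp: modify_def)
qed

text \<open>
  Each application of the modified letter along the walk meets a point that the modifying element
  fixes, so the walk cannot notice the modification.
\<close>

lemma word_act_modify:
  assumes h: "h \<in> tuples k (carrier G)" and s: "s \<in> letters k" and x: "x \<in> E"
    and w: "set w \<subseteq> letters k" and u: "u \<in> fixer (sources s h x w)" and v: "suffix v w"
  shows "\<phi> (word_val G (modify s h u) v) x = \<phi> (word_val G h v) x"
  using v
proof (induction v)
  case (Cons t v)
  let ?h = "modify s h u"
  have sv: "suffix v w" using Cons.prems by (rule suffix_ConsD)
  have IH: "\<phi> (word_val G ?h v) x = \<phi> (word_val G h v) x" by (rule Cons.IH[OF sv])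
  have tv: "t \<in> letters k" "set v \<subseteq> letters k" using set_mono_suffix[OF Cons.prems] w by auto
  have uc: "u \<in> carrier G" using u by (simp add: fixer_def)
  have h': "?h \<in> tuples k (carrier G)" by (rule modify_closed[OF h s uc])
  note cl = G.letter_val_closed[OF h tv(1)] G.letter_val_closed[OF h' tv(1)]
    G.word_val_closed[OF h tv(2)] G.word_val_closed[OF h' tv(2)]
  let ?y = "\<phi> (word_val G h v) x"
  have y: "?y \<in> E" using cl x act_closed by auto
  have L: "\<phi> (word_val G ?h (t # v)) x = \<phi> (letter_val G ?h t) ?y"
    using cl x IH by (simp add: act_mult)
  have R: "\<phi> (word_val G h (t # v)) x = \<phi> (letter_val G h t) ?y"
    using cl x by (simp add: act_mult)
  consider "t = s" | "t = inv_letter s" | "t \<noteq> s" "t \<noteq> inv_letter s" by blast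
  then have "\<phi> (letter_val G ?h t) ?y = \<phi> (letter_val G h t) ?y"
  proof cases
    case 1
    have "?y \<in> sources s h x w" using Cons.prems unfolding sources_def 1 by blast
    then have "\<phi> u ?y = ?y" using u by (simp add: fixer_def)
    then show ?thesis using 1 letter_val_modify(1)[OF h s uc] cl y uc by (simp add: act_mult)
  next
    case 2
    have "\<phi> (letter_val G h t) ?y \<in> sources s h x w"
      using Cons.prems unfolding sources_def 2 R[unfolded 2, symmetric] by blast
    then have "\<phi> u (\<phi> (letter_val G h t) ?y) = \<phi> (letter_val G h t) ?y" using u by (simp add: fixer_def)
    then have "\<phi> (inv\<^bsub>G\<^esub> u) (\<phi> (letter_val G h t) ?y) = \<phi> (letter_val G h t) ?y"
      using act_inv[OF uc act_closed[OF cl(1) y]] by simp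
    then show ?thesis using 2 letter_val_modify(2)[OF h s uc] cl y uc by (simp add: act_mult)
  next
    case 3
    then show ?thesis using letter_val_modify(3)[OF h s uc] by simp
  qed
  then show ?case using L R by simp
qed simp

lemma visited_eq: "visited h x w = (\<lambda>u. \<phi> (word_val G h u) x) ` set (suffixes w)"
  by (auto simp: visited_def)

lemma finite_visited: "finite (visited h x w)"
  by (simp add: visited_eq)

lemma card_visited_le: "card (visited h x w) \<le> Suc (length w)"
proof -
  have "card (visited h x w) \<le> card (set (suffixes w))" unfolding visited_eq by (rule card_image_le) simp
  also have "\<dots> \<le> length (suffixes w)" by (rule card_length)
  finally show ?thesis by simp
qed

lemma visited_subset:
  assumes "h \<in> tuples k (carrier G)" "x \<in> E" "set w \<subseteq> letters k"
  shows "visited h x w \<subseteq> E"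
  unfolding visited_def using G.word_val_closed[OF assms(1)] assms(2,3) act_closed set_mono_suffix
  by blast

text \<open>
  The walk ends at the image under \<open>t # w\<close>, and this point could only be a source of \<open>s\<close> if
  it had arisen by applying the inverse of \<open>s\<close>, which reducedness excludes.
\<close>

lemma sources_subset_visited_tail:
  assumes "reduced (s # t # w)"
  shows "sources s h x (t # w) \<subseteq> visited h x w"
proof -
  have t: "t \<noteq> inv_letter s" using assms by simp
  have 1: "suffix u w" if "suffix (s # u) (t # w)" for u
    using that by (auto simp: suffix_Cons dest: suffix_ConsD)
  have 2: "suffix (inv_letter s # u) w" if "suffix (inv_letter s # u) (t # w)" for u
    using that t by (auto simp: suffix_Cons)
  show ?thesis unfolding sources_def visited_def using 1 2 by blast
qed

lemma sources_Nil [simp]: "sources s h x [] = {}"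
  by (simp add: sources_def)

lemma escaping_modify:
  assumes h: "h \<in> tuples k (carrier G)" and s: "s \<in> letters k" and x: "x \<in> E"
    and w: "set w \<subseteq> letters k" and u: "u \<in> fixer (sources s h x w)"
  shows "sources s (modify s h u) x w = sources s h x w"
    and "escaping cl (modify s h u) x w = escaping cl h x w"
    and "visited (modify s h u) x w = visited h x w"
proof -
  have *: "\<phi> (word_val G (modify s h u) v) x = \<phi> (word_val G h v) x" if "suffix v w" for v
    using word_act_modify[OF h s x w u that] .
  have setcomp: "{f v | v. P v} = {g v | v. P v}" if "\<And>v. P v \<Longrightarrow> f v = g v"
    for f g :: "letter list \<Rightarrow> 'c" and P using that by force
  show "sources s (modify s h u) x w = sources s h x w"
 
  proof -
    have 1: "{\<phi> (word_val G (modify s h u) v) x | v. suffix (t # v) w} =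
        {\<phi> (word_val G h v) x | v. suffix (t # v) w}" for t
      by (rule setcomp, rule *, erule suffix_ConsD)
    have 2: "{\<phi> (word_val G (modify s h u) (t # v)) x | v. suffix (t # v) w} =
        {\<phi> (word_val G h (t # v)) x | v. suffix (t # v) w}" for t
      by (rule setcomp, rule *)
    show ?thesis unfolding sources_def 1 2 ..
  qed
  show "visited (modify s h u) x w = visited h x w"
    unfolding visited_def by (intro setcomp *)
  have "suffix v w \<Longrightarrow> escaping cl (modify s h u) x v = escaping cl h x v" for v
  proof (induction v)
    case (Cons t v)
    have sv: "suffix v w" using Cons.prems by (rule suffix_ConsD)
    have "visited (modify s h u) x v = visited h x v"
      unfolding visited_def using sv suffix_order.trans by (intro setcomp *) blast
    then show ?case using Cons.IH[OF sv] *[OF Cons.prems] by simp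
  qed simp
  then show "escaping cl (modify s h u) x w = escaping cl h x w" by simp
qed

text \<open>
  One step of the walk. For fixed earlier points, multiplying the entry of the tuple that is used next
  by an element fixing all sources resamples this entry. As the present point is outside the closure of
  the sources, it has a large orbit under these elements, and its next image is unlikely to fall into the
  closure of the visited points.
\<close>

lemma card_newly_trapped_le:
  fixes R :: real
  assumes fin: "finite (carrier G)" and x: "x \<in> E"
    and cl_fin: "\<And>A. A \<subseteq> E \<Longrightarrow> finite A \<Longrightarrow> finite (cl A) \<and> card (cl A) \<le> Q ^ card A"
    and cl_mono: "\<And>A A'. A \<subseteq> A' \<Longrightarrow> A' \<subseteq> E \<Longrightarrow> cl A \<subseteq> cl A'"
    and cl_E: "\<And>A. A \<subseteq> E \<Longrightarrow> cl A \<subseteq> E"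
    and Q: "Q \<ge> 1" and R: "R > 0"
    and orb: "\<And>A y. A \<subseteq> E \<Longrightarrow> finite A \<Longrightarrow> card A \<le> L \<Longrightarrow> y \<in> E - cl A \<Longrightarrow> R \<le> card {\<phi> u y | u. u \<in> fixer A}"
    and red: "reduced (s # w)" and len: "length w \<le> L" and lets: "set (s # w) \<subseteq> letters k"
  shows "real (card {h \<in> tuples k (carrier G). escaping cl h x w \<and> \<not> escaping cl h x (s # w)})
    \<le> Q ^ Suc (length w) / R * card (tuples k (carrier G))"
proof -
  let ?X = "tuples k (carrier G)" let ?A = "{h \<in> ?X. escaping cl h x w}"
  let ?bad = "\<lambda>h. \<phi> (word_val G h (s # w)) x \<in> cl (visited h x w)"
  let ?K = "\<lambda>h. fixer (sources s h x w)"
  have s: "s \<in> letters k" and w: "set w \<subseteq> letters k" using lets by auto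
  have finX: "finite ?X" by (rule finite_tuples[OF fin])
  have src: "sources s h x w \<subseteq> E \<and> finite (sources s h x w) \<and> card (sources s h x w) \<le> L \<and>
      \<phi> (word_val G h w) x \<in> E - cl (sources s h x w)" if h: "h \<in> ?A" for h
  proof (cases w)
    case Nil
    then show ?thesis using h x act_one by simp
  next
    case (Cons t w')
    have h': "h \<in> ?X" using h by simp
    have sub: "sources s h x w \<subseteq> visited h x w'"
      using sources_subset_visited_tail red Cons by simp
    have w': "set w' \<subseteq> letters k" using w Cons by auto
    have visE: "visited h x w' \<subseteq> E" by (rule visited_subset[OF h' x w'])
    have "card (sources s h x w) \<le> card (visited h x w')"
      by (rule card_mono[OF finite_visited sub])
    also have "\<dots> \<le> Suc (length w')" by (rule card_visited_le)
    also have "\<dots> \<le> L" using len Cons by simp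
    finally have card: "card (sources s h x w) \<le> L" .
    have "\<phi> (word_val G h w) x \<notin> cl (visited h x w')" using h Cons by simp
    then have "\<phi> (word_val G h w) x \<notin> cl (sources s h x w)" using cl_mono[OF sub visE] by blast
    moreover have "\<phi> (word_val G h w) x \<in> E" using G.word_val_closed[OF h' w] x act_closed by blast
    ultimately show ?thesis using sub visE card finite_subset[OF sub finite_visited] by blast
  qed
  have "real (card {h \<in> ?A. ?bad h}) \<le> Q ^ Suc (length w) / R * card ?A"
  proof (rule card_bad_le_of_involution[where m = "modify s" and K = ?K and i = "\<lambda>u. inv\<^bsub>G\<^esub> u"])
    show "finite ?A" using finX by simp
  next
    fix h assume h: "h \<in> ?A"
    interpret K: subgroup "?K h" G using src[OF h] subgroup_fixer by blast
    show "finite (?K h) \<and> ?K h \<noteq> {}" using finite_subset[OF K.subset fin] K.one_closed by blast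
  next
    fix h u assume h: "h \<in> ?A" and u: "u \<in> ?K h"
    interpret K: subgroup "?K h" G using src[OF h] subgroup_fixer by blast
    have uc: "u \<in> carrier G" using u K.subset by blast
    have h': "h \<in> ?X" using h by simp
    show "modify s h u \<in> ?A \<and> ?K (modify s h u) = ?K h \<and> inv\<^bsub>G\<^esub> u \<in> ?K h \<and>
        modify s (modify s h u) (inv\<^bsub>G\<^esub> u) = h \<and> inv\<^bsub>G\<^esub> (inv\<^bsub>G\<^esub> u) = u"
      using escaping_modify(1,2)[OF h' s x w u] modify_closed[OF h' s uc] modify_modify_inv[OF h' s uc]
        h u uc by simp
  next
    fix h assume h: "h \<in> ?A"
    have h': "h \<in> ?X" using h by simp
    let ?y = "\<phi> (word_val G h w) x" let ?g = "letter_val G h s"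
    have g: "?g \<in> carrier G" by (rule G.letter_val_closed[OF h' s])
    have wc: "word_val G h w \<in> carrier G" by (rule G.word_val_closed[OF h' w])
    have vis: "visited h x w \<subseteq> E" "finite (visited h x w)"
      using visited_subset[OF h' x w] finite_visited by auto
    define C where "C = \<phi> (inv\<^bsub>G\<^esub> ?g) ` cl (visited h x w)"
    have clv: "finite (cl (visited h x w))" "card (cl (visited h x w)) \<le> Q ^ card (visited h x w)"
      using cl_fin[OF vis] by auto
    have finC: "finite C" unfolding C_def using clv by simp
    have "card C \<le> Q ^ card (visited h x w)" unfolding C_def using card_image_le[OF clv(1)] clv(2) le_trans by blast
    also have "\<dots> \<le> Q ^ Suc (length w)" using Q card_visited_le power_increasing by blast
    finally have cC: "card C \<le> Q ^ Suc (length w)" .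
    have sub: "{u \<in> ?K h. ?bad (modify s h u)} \<subseteq> {u \<in> ?K h. \<phi> u ?y \<in> C}"
    proof clarify
      fix u assume u: "u \<in> ?K h" and bad: "?bad (modify s h u)"
      have uc: "u \<in> carrier G" using u by (simp add: fixer_def)
      have yE: "?y \<in> E" using src[OF h] by blast
      have hm: "modify s h u \<in> ?X" by (rule modify_closed[OF h' s uc])
      have "\<phi> (word_val G (modify s h u) (s # w)) x = \<phi> ?g (\<phi> u ?y)"
        using word_act_modify[OF h' s x w u, of w] letter_val_modify(1)[OF h' s uc] g uc yE
          G.word_val_closed[OF hm w] x by (simp add: act_mult)
      then have "\<phi> ?g (\<phi> u ?y) \<in> cl (visited h x w)"
        using bad escaping_modify(3)[OF h' s x w u] by simp
      then show "\<phi> u ?y \<in> C" unfolding C_def using act_inv[OF g act_closed[OF uc yE]] by (metis image_eqI)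
    qed
    have finK: "finite (?K h)" using fin by (auto simp: fixer_def)
    let ?O = "card {\<phi> u ?y | u. u \<in> ?K h}"
    have "real (card {u \<in> ?K h. ?bad (modify s h u)}) * R \<le> card {u \<in> ?K h. \<phi> u ?y \<in> C} * real ?O"
    proof (rule mult_mono)
      show "real (card {u \<in> ?K h. ?bad (modify s h u)}) \<le> card {u \<in> ?K h. \<phi> u ?y \<in> C}"
        using card_mono[OF _ sub] finK by simp
      show "R \<le> ?O" using orb src[OF h] by blast
    qed (use R in auto)
    also have "\<dots> \<le> card C * real (card (?K h))"
      using card_fixer_into_le[OF fin, of "sources s h x w" ?y C] src[OF h] finC
      by (metis (no_types, lifting) DiffD1 of_nat_le_iff of_nat_mult)
    also have "\<dots> \<le> Q ^ Suc (length w) * real (card (?K h))"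
      using cC of_nat_mono[OF cC, where ?'a = real] by (intro mult_right_mono) auto
    finally show "real (card {u \<in> ?K h. ?bad (modify s h u)}) \<le> Q ^ Suc (length w) / R * card (?K h)"
      using R by (simp add: field_simps)
  qed
  moreover have "{h \<in> ?X. escaping cl h x w \<and> \<not> escaping cl h x (s # w)} = {h \<in> ?A. ?bad h}" by auto
  moreover have "Q ^ Suc (length w) / R * card ?A \<le> Q ^ Suc (length w) / R * card ?X"
    using R card_mono[OF finX, of ?A] by (intro mult_left_mono) auto
  ultimately show ?thesis by simp
qed

text \<open>
  A word with value 1 brings \<open>x\<close> back to itself, so the walk does not escape; sum the previous estimate
  over the steps of the walk.
\<close>

theorem card_trapped_le:
  fixes R :: real
  assumes fin: "finite (carrier G)" and x: "x \<in> E"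
    and cl_fin: "\<And>A. A \<subseteq> E \<Longrightarrow> finite A \<Longrightarrow> finite (cl A) \<and> card (cl A) \<le> Q ^ card A"
    and cl_mono: "\<And>A A'. A \<subseteq> A' \<Longrightarrow> A' \<subseteq> E \<Longrightarrow> cl A \<subseteq> cl A'"
    and cl_E: "\<And>A. A \<subseteq> E \<Longrightarrow> cl A \<subseteq> E"
    and cl_ext: "\<And>A. A \<subseteq> E \<Longrightarrow> A \<subseteq> cl A"
    and Q: "Q \<ge> 1" and R: "R > 0"
    and orb: "\<And>A y. A \<subseteq> E \<Longrightarrow> finite A \<Longrightarrow> card A \<le> L \<Longrightarrow> y \<in> E - cl A \<Longrightarrow> R \<le> card {\<phi> u y | u. u \<in> fixer A}"
    and x0: "x \<notin> cl {}"
    and red: "reduced w" and len: "length w \<le> L" and lets: "set w \<subseteq> letters k" and ne: "w \<noteq> []"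
  shows "real (card {h \<in> tuples k (carrier G). word_val G h w = \<one>\<^bsub>G\<^esub>})
    \<le> L * Q ^ L / R * card (tuples k (carrier G))"
proof -
  let ?X = "tuples k (carrier G)"
  have finX: "finite ?X" by (rule finite_tuples[OF fin])
  have "real (card {h \<in> ?X. \<not> escaping cl h x w}) \<le> length w * (Q ^ L / R * card ?X)"
    using red len lets
  proof (induction w)
    case Nil
    then show ?case using x0 by simp
  next
    case (Cons s w)
    have red': "reduced w" using Cons.prems(1) by (auto simp: successively_Cons)
    have "{h \<in> ?X. \<not> escaping cl h x (s # w)} \<subseteq>
        {h \<in> ?X. \<not> escaping cl h x w} \<union> {h \<in> ?X. escaping cl h x w \<and> \<not> escaping cl h x (s # w)}" by auto
    then have "card {h \<in> ?X. \<not> escaping cl h x (s # w)} \<le>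
        card {h \<in> ?X. \<not> escaping cl h x w} + card {h \<in> ?X. escaping cl h x w \<and> \<not> escaping cl h x (s # w)}"
      by (intro order.trans[OF card_mono card_Un_le]) (use finX in auto)
    moreover have "real (card {h \<in> ?X. escaping cl h x w \<and> \<not> escaping cl h x (s # w)}) \<le> Q ^ L / R * card ?X"
    proof -
      have "real (card {h \<in> ?X. escaping cl h x w \<and> \<not> escaping cl h x (s # w)})
          \<le> Q ^ Suc (length w) / R * card ?X"
        using card_newly_trapped_le[OF fin x cl_fin cl_mono cl_E Q R orb Cons.prems(1) _ Cons.prems(3)] Cons.prems(2)
        by simp
      also have "\<dots> \<le> Q ^ L / R * card ?X"
        using Cons.prems(2) Q R
        by (intro mult_right_mono divide_right_mono) (auto intro!: power_increasing simp del: power_Suc)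
      finally show ?thesis .
    qed
    moreover have "real (card {h \<in> ?X. \<not> escaping cl h x w}) \<le> length w * (Q ^ L / R * card ?X)"
      using Cons.IH red' Cons.prems by simp
    ultimately have "real (card {h \<in> ?X. \<not> escaping cl h x (s # w)}) \<le>
        length w * (Q ^ L / R * card ?X) + Q ^ L / R * card ?X" by linarith
    then show ?case by (simp only: length_Cons of_nat_Suc distrib_right mult_1 add.commute)
  qed
  also have "\<dots> \<le> L * (Q ^ L / R * card ?X)" using len R by (intro mult_right_mono) auto
  finally have 1: "real (card {h \<in> ?X. \<not> escaping cl h x w}) \<le> L * (Q ^ L / R * card ?X)" .
  have "{h \<in> ?X. word_val G h w = \<one>\<^bsub>G\<^esub>} \<subseteq> {h \<in> ?X. \<not> escaping cl h x w}"
  proof clarify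
    fix h assume h: "h \<in> ?X" and eq: "word_val G h w = \<one>\<^bsub>G\<^esub>" and esc: "escaping cl h x w"
    obtain s v where w: "w = s # v" using ne by (cases w) auto
    have v: "set v \<subseteq> letters k" using lets w by auto
    have "\<phi> (word_val G h w) x = x" using eq act_one[OF x] by simp
    moreover have "x \<in> visited h x v" unfolding visited_def using act_one[OF x]
      by (intro CollectI exI[of _ "[]"]) simp
    moreover have "visited h x v \<subseteq> cl (visited h x v)" by (rule cl_ext[OF visited_subset[OF h x v]])
    ultimately show False using esc w by auto
  qed
  then have "card {h \<in> ?X. word_val G h w = \<one>\<^bsub>G\<^esub>} \<le> card {h \<in> ?X. \<not> escaping cl h x w}"
    using finX by (intro card_mono) auto
  then show ?thesis using 1 by (simp add: mult.assoc)
qed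

end

section \<open>Forms over finite fields\<close>

text \<open>
  In the second argument only additivity is required, so that hermitian forms are included; reflexivity
  makes orthogonality symmetric.
\<close>

locale form_space = module R M + R?: field R for R (structure) and M (structure) +
  fixes B :: "'c \<Rightarrow> 'c \<Rightarrow> 'a"
  assumes finite_scalars: "finite (carrier R)" and finite_vectors: "finite (carrier M)"
    and B_closed [simp]: "x \<in> carrier M \<Longrightarrow> y \<in> carrier M \<Longrightarrow> B x y \<in> carrier R"
    and B_add_left: "x \<in> carrier M \<Longrightarrow> y \<in> carrier M \<Longrightarrow> z \<in> carrier M \<Longrightarrow>
      B (x \<oplus>\<^bsub>M\<^esub> y) z = B x z \<oplus> B y z"
    and B_smult_left: "a \<in> carrier R \<Longrightarrow> x \<in> carrier M \<Longrightarrow> y \<in> carrier M \<Longrightarrow>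
      B (a \<odot>\<^bsub>M\<^esub> x) y = a \<otimes> B x y"
    and B_add_right: "x \<in> carrier M \<Longrightarrow> y \<in> carrier M \<Longrightarrow> z \<in> carrier M \<Longrightarrow>
      B x (y \<oplus>\<^bsub>M\<^esub> z) = B x y \<oplus> B x z"
    and B_reflexive: "x \<in> carrier M \<Longrightarrow> y \<in> carrier M \<Longrightarrow> B x y = \<zero> \<Longrightarrow> B y x = \<zero>"
    and B_nondegenerate: "x \<in> carrier M \<Longrightarrow> (\<And>y. y \<in> carrier M \<Longrightarrow> B x y = \<zero>) \<Longrightarrow> x = \<zero>\<^bsub>M\<^esub>"
begin

definition additive_on :: "'c set \<Rightarrow> ('c \<Rightarrow> 'a) \<Rightarrow> bool" where
  "additive_on T f \<longleftrightarrow> (\<forall>x\<in>T. f x \<in> carrier R \<and> (\<forall>y\<in>T. f (x \<oplus>\<^bsub>M\<^esub> y) = f x \<oplus> f y))"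

definition perp :: "'c set \<Rightarrow> 'c set" where
  "perp A = {x \<in> carrier M. \<forall>a\<in>A. B x a = \<zero>}"

text \<open>
  The double orthogonal, which for a nondegenerate form is the linear span.
\<close>

definition cl :: "'c set \<Rightarrow> 'c set" where
  "cl A = perp (perp A)"

lemma order_gt_1: "order R > 1"
proof -
  have "card {\<zero>, \<one>} \<le> order R" unfolding order_def using finite_scalars by (intro card_mono) auto
  then show ?thesis by simp
qed

lemma B_zero_left [simp]: "y \<in> carrier M \<Longrightarrow> B \<zero>\<^bsub>M\<^esub> y = \<zero>"
  using B_smult_left[of \<zero> "\<zero>\<^bsub>M\<^esub>" y] by simp

lemma B_zero_right [simp]: "y \<in> carrier M \<Longrightarrow> B y \<zero>\<^bsub>M\<^esub> = \<zero>"
  using B_reflexive[of "\<zero>\<^bsub>M\<^esub>" y] by simp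

lemma B_neg_left [simp]: "x \<in> carrier M \<Longrightarrow> y \<in> carrier M \<Longrightarrow> B (\<ominus>\<^bsub>M\<^esub> x) y = \<ominus> B x y"
  using B_add_left[of "\<ominus>\<^bsub>M\<^esub> x" x y] by (simp add: R.minus_equality M.l_neg)

lemma B_neg_right [simp]: "x \<in> carrier M \<Longrightarrow> y \<in> carrier M \<Longrightarrow> B y (\<ominus>\<^bsub>M\<^esub> x) = \<ominus> B y x"
  using B_add_right[of y "\<ominus>\<^bsub>M\<^esub> x" x] by (simp add: R.minus_equality M.l_neg)

lemma B_smult_right_zero:
  assumes "x \<in> carrier M" "y \<in> carrier M" "c \<in> carrier R" "B x y = \<zero>"
  shows "B x (c \<odot>\<^bsub>M\<^esub> y) = \<zero>"
  using assms B_reflexive B_smult_left by (metis R.r_null smult_closed)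

lemma subgroup_perp: "A \<subseteq> carrier M \<Longrightarrow> additive_subgroup (perp A) M"
  by (intro additive_subgroup.intro subgroup.intro)
    (auto simp: perp_def B_add_left subset_iff a_inv_def[symmetric])

lemma perp_subset: "perp A \<subseteq> carrier M"
  by (auto simp: perp_def)

lemma perp_antimono: "A \<subseteq> A' \<Longrightarrow> perp A' \<subseteq> perp A"
  by (auto simp: perp_def)

lemma cl_mono: "A \<subseteq> A' \<Longrightarrow> cl A \<subseteq> cl A'"
  unfolding cl_def by (intro perp_antimono)

lemma cl_extensive: "A \<subseteq> carrier M \<Longrightarrow> A \<subseteq> cl A"
  unfolding cl_def perp_def using B_reflexive by blast

text \<open>
  Outside the closure of \<open>A\<close> there is a witness orthogonal to \<open>A\<close>: the starting point of all
  constructions of group elements that fix \<open>A\<close> and move \<open>v\<close>.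
\<close>

lemma not_in_clE:
  assumes "v \<in> carrier M - cl A"
  obtains x where "x \<in> perp A" "B v x \<noteq> \<zero>"
  using assms by (auto simp: cl_def perp_def)

lemma cl_empty: "cl {} = {\<zero>\<^bsub>M\<^esub>}"
  using B_nondegenerate by (auto simp: cl_def perp_def)

lemma additive_on_left: "T \<subseteq> carrier M \<Longrightarrow> a \<in> carrier M \<Longrightarrow> additive_on T (\<lambda>x. B x a)"
  by (auto simp: additive_on_def B_add_left subset_iff)

lemma additive_on_right: "T \<subseteq> carrier M \<Longrightarrow> a \<in> carrier M \<Longrightarrow> additive_on T (B a)"
  by (auto simp: additive_on_def B_add_right subset_iff)

lemma additive_on_diff:
  assumes T: "additive_subgroup T M" and f: "additive_on T f" and "x \<in> T" "y \<in> T"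
  shows "x \<ominus>\<^bsub>M\<^esub> y \<in> T" "f (x \<ominus>\<^bsub>M\<^esub> y) = f x \<ominus> f y"
proof -
  interpret T: additive_subgroup T M by (rule T)
  have sub: "T \<subseteq> carrier M" by (rule T.a_subset)
  have ny: "\<ominus>\<^bsub>M\<^esub> y \<in> T" using T.a_inv_closed assms(4) by (simp add: M.abelian_group_axioms)
  then show d: "x \<ominus>\<^bsub>M\<^esub> y \<in> T" using assms(3) unfolding a_minus_def by simp
  have fc: "f x \<in> carrier R" "f y \<in> carrier R" "f (x \<ominus>\<^bsub>M\<^esub> y) \<in> carrier R"
    using f d assms by (auto simp: additive_on_def)
  have "(x \<ominus>\<^bsub>M\<^esub> y) \<oplus>\<^bsub>M\<^esub> y = x" using sub assms by (simp add: a_minus_def M.a_assoc M.l_neg subset_iff)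
  then have "f x = f (x \<ominus>\<^bsub>M\<^esub> y) \<oplus> f y" using f d assms(4) by (metis additive_on_def)
  then show "f (x \<ominus>\<^bsub>M\<^esub> y) = f x \<ominus> f y" using fc by (simp add: a_minus_def R.a_assoc R.r_neg)
qed

text \<open>
  The fibres of an additive map are translates of its kernel, and there are at most \<open>order R\<close> of them.
\<close>

lemma card_le_card_kernel:
  assumes T: "additive_subgroup T M" and f: "additive_on T f"
  shows "card T \<le> order R * card {t \<in> T. f t = \<zero>}"
proof -
  interpret T: additive_subgroup T M by (rule T)
  have sub: "T \<subseteq> carrier M" by (rule T.a_subset)
  have finT: "finite T" using finite_subset[OF sub finite_vectors] .
  have fibre: "card {t \<in> T. f t = c} \<le> card {t \<in> T. f t = \<zero>}" for c
  proof (cases "{t \<in> T. f t = c} = {}")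
    case False
    then obtain s where s: "s \<in> T" "f s = c" by auto
    have "c \<in> carrier R" using f s by (auto simp: additive_on_def)
    then show ?thesis
    proof (intro card_inj_on_le[where f = "\<lambda>t. t \<ominus>\<^bsub>M\<^esub> s"])
      show "inj_on (\<lambda>t. t \<ominus>\<^bsub>M\<^esub> s) {t \<in> T. f t = c}"
        using sub s(1) by (intro inj_onI) (simp add: a_minus_def subset_iff)
      show "(\<lambda>t. t \<ominus>\<^bsub>M\<^esub> s) ` {t \<in> T. f t = c} \<subseteq> {t \<in> T. f t = \<zero>}"
      proof clarify
        fix t assume t: "t \<in> T" "c = f t"
        show "t \<ominus>\<^bsub>M\<^esub> s \<in> T \<and> f (t \<ominus>\<^bsub>M\<^esub> s) = \<zero>"
          using additive_on_diff[OF T f t(1) s(1)] s(2) t(2) \<open>c \<in> carrier R\<close>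
          by (simp add: R.r_neg a_minus_def[of R])
      qed
    qed (use finT in auto)
  next
    case True
    then show ?thesis by (simp only: card.empty le0)
  qed
  have "T = (\<Union>c\<in>carrier R. {t \<in> T. f t = c})" using f by (auto simp: additive_on_def)
  then have "card T \<le> (\<Sum>c\<in>carrier R. card {t \<in> T. f t = c})"
    using card_UN_le[OF finite_scalars, of "\<lambda>c. {t \<in> T. f t = c}"] by simp
  also have "\<dots> \<le> (\<Sum>c\<in>carrier R. card {t \<in> T. f t = \<zero>})" by (intro sum_mono fibre)
  finally show ?thesis by (simp add: order_def)
qed

text \<open>
  An affine function with a nonzero value is nonzero on at least half of \<open>T\<close>: translation by a suitable
  vector maps its zeros to nonzeros.
\<close>

lemma card_le_twice_nonzero:
  assumes T: "additive_subgroup T M" and f: "additive_on T f" and c: "c \<in> carrier R"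
    and s: "s \<in> T" "c \<oplus> f s \<noteq> \<zero>"
  shows "card T \<le> 2 * card {t \<in> T. c \<oplus> f t \<noteq> \<zero>}"
proof -
  interpret T: additive_subgroup T M by (rule T)
  have sub: "T \<subseteq> carrier M" by (rule T.a_subset)
  have finT: "finite T" using finite_subset[OF sub finite_vectors] .
  let ?Z = "{t \<in> T. c \<oplus> f t = \<zero>}" let ?N = "{t \<in> T. c \<oplus> f t \<noteq> \<zero>}"
  have "card ?Z \<le> card ?N"
  proof (cases "?Z = {}")
    case False
    then obtain z where z: "z \<in> T" "c \<oplus> f z = \<zero>" by auto
    let ?d = "s \<ominus>\<^bsub>M\<^esub> z"
    have d: "?d \<in> T" "f ?d = f s \<ominus> f z" using additive_on_diff[OF T f s(1) z(1)] by auto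
    have fc: "f t \<in> carrier R" if "t \<in> T" for t using f that by (auto simp: additive_on_def)
    show ?thesis
    proof (rule card_inj_on_le[where f = "\<lambda>t. t \<oplus>\<^bsub>M\<^esub> ?d"])
      show "inj_on (\<lambda>t. t \<oplus>\<^bsub>M\<^esub> ?d) ?Z" using sub d(1) by (auto intro!: inj_onI simp: subset_iff)
      show "(\<lambda>t. t \<oplus>\<^bsub>M\<^esub> ?d) ` ?Z \<subseteq> ?N"
      proof clarify
        fix t assume t: "t \<in> T" "c \<oplus> f t = \<zero>"
        have "f t = f z" using t z c fc by (metis R.add.l_cancel)
        then have "f (t \<oplus>\<^bsub>M\<^esub> ?d) = f s"
          using f t(1) d fc[OF s(1)] fc[OF z(1)] by (auto simp: additive_on_def a_minus_def R.a_lcomm R.r_neg)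
        then show "t \<oplus>\<^bsub>M\<^esub> ?d \<in> T \<and> c \<oplus> f (t \<oplus>\<^bsub>M\<^esub> ?d) \<noteq> \<zero>" using t(1) d s by simp
      qed
    qed (use finT in simp)
  next
    case True
    then show ?thesis by (simp only: card.empty le0)
  qed
  moreover have "card T = card ?Z + card ?N"
    using finT by (subst card_Un_disjoint[symmetric]) (auto intro: arg_cong[where f = card])
  ultimately show ?thesis by simp
qed

lemma perp_insert: "perp (insert a A) = {x \<in> perp A. B x a = \<zero>}"
  by (auto simp: perp_def)

lemma card_le_card_inter_perp:
  assumes T: "additive_subgroup T M" and "finite A" "A \<subseteq> carrier M"
  shows "additive_subgroup (T \<inter> perp A) M \<and> card T \<le> order R ^ card A * card (T \<inter> perp A)"
proof
  have sub: "T \<subseteq> carrier M" using T by (rule additive_subgroup.a_subset)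
  have inter: "additive_subgroup (T \<inter> perp A) M" if "A \<subseteq> carrier M" for A
    using M.add.subgroups_Inter_pair T subgroup_perp[OF that] by (simp add: additive_subgroup_def)
  then show "additive_subgroup (T \<inter> perp A) M" using assms by simp
  show "card T \<le> order R ^ card A * card (T \<inter> perp A)"
    using assms(2,3)
  proof (induction A rule: finite_induct)
    case empty
    have "T \<inter> perp {} = T" using sub by (auto simp: perp_def)
    then show ?case by simp
  next
    case (insert a A)
    have "card (T \<inter> perp A) \<le> order R * card {t \<in> T \<inter> perp A. B t a = \<zero>}"
      by (rule card_le_card_kernel[OF inter additive_on_left]) (use insert perp_subset in auto)
    moreover have "{t \<in> T \<inter> perp A. B t a = \<zero>} = T \<inter> perp (insert a A)" by (auto simp: perp_insert)
    moreover have "card T \<le> order R ^ card A * card (T \<inter> perp A)" using insert by simp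
    ultimately have "card T \<le> order R ^ card A * (order R * card (T \<inter> perp (insert a A)))"
      by (metis le_trans mult_le_mono2)
    then show ?case using insert by (simp add: mult.assoc mult.left_commute)
  qed
qed

text \<open>
  Adding one vector \<open>a\<close> to \<open>A\<close> either leaves the orthogonal unchanged or cuts it by one condition. In
  the second case, let \<open>w\<close> be orthogonal to \<open>A\<close> but not to \<open>a\<close>; the orthogonal of \<open>A\<close> is then
  generated by \<open>w\<close> and the orthogonal of \<open>insert a A\<close>, so the kernel of \<open>y \<mapsto> B y w\<close> on the new closure
  lies in the old one.
\<close>

lemma card_cl_le:
  assumes "finite A" "A \<subseteq> carrier M"
  shows "card (cl A) \<le> order R ^ card A"
  using assms
proof (induction A rule: finite_induct)
  case empty
  then show ?case by (simp add: cl_empty)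
next
  case (insert a A)
  have A: "A \<subseteq> carrier M" "a \<in> carrier M" using insert by auto
  have IH: "card (cl A) \<le> order R ^ card A" using insert by simp
  let ?W = "perp A" let ?W' = "perp (insert a A)"
  show ?case
  proof (cases "?W' = ?W")
    case True
    then have "card (cl (insert a A)) \<le> order R ^ card A" using IH by (simp add: cl_def)
    also have "\<dots> \<le> order R ^ card (insert a A)" using insert order_gt_1 by simp
    finally show ?thesis .
  next
    case False
    then obtain w where w: "w \<in> ?W" "B w a \<noteq> \<zero>" by (auto simp: perp_insert)
    have wM: "w \<in> carrier M" using w perp_subset by auto
    have clsub: "additive_subgroup (cl (insert a A)) M"
      unfolding cl_def by (rule subgroup_perp[OF perp_subset])
    have "{y \<in> cl (insert a A). B y w = \<zero>} \<subseteq> cl A"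
    proof clarify
      fix y assume y: "y \<in> cl (insert a A)" "B y w = \<zero>"
      have yM: "y \<in> carrier M" using y by (auto simp: cl_def perp_def)
      have "B y x = \<zero>" if x: "x \<in> ?W" for x
      proof -
        have xM: "x \<in> carrier M" using x perp_subset by auto
        \<comment> \<open>subtract the multiple of \<open>w\<close> that makes \<open>x\<close> orthogonal to \<open>a\<close>\<close>
        define c where "c = \<ominus> (B x a \<otimes> inv (B w a))"
        have wa: "B w a \<in> Units R" using w wM A by (simp add: field_Units)
        have c: "c \<in> carrier R" using xM wM A wa by (simp add: c_def)
        let ?x = "x \<oplus>\<^bsub>M\<^esub> c \<odot>\<^bsub>M\<^esub> w"
        have "B ?x a = B x a \<oplus> c \<otimes> B w a" using xM wM A c by (simp add: B_add_left B_smult_left)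
        also have "c \<otimes> B w a = \<ominus> B x a"
          unfolding c_def using wa xM wM A by (simp add: R.l_minus R.m_assoc)
        finally have "B ?x a = \<zero>" using xM A by (simp add: R.r_neg)
        moreover have "?x \<in> ?W"
          using x w c A xM wM unfolding perp_def by (auto simp: B_add_left B_smult_left subset_iff)
        ultimately have "B y ?x = \<zero>" using y unfolding cl_def perp_insert by (auto simp: perp_def)
        moreover have "B y (c \<odot>\<^bsub>M\<^esub> w) = \<zero>" by (rule B_smult_right_zero[OF yM wM c y(2)])
        ultimately show ?thesis using xM wM c yM by (simp add: B_add_right)
      qed
      then show "y \<in> cl A" using yM by (simp add: cl_def perp_def)
    qed
    then have "card {y \<in> cl (insert a A). B y w = \<zero>} \<le> card (cl A)"
      by (intro card_mono finite_subset[OF _ finite_vectors]) (auto simp: cl_def perp_def)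
    moreover have "card (cl (insert a A)) \<le> order R * card {y \<in> cl (insert a A). B y w = \<zero>}"
      by (rule card_le_card_kernel[OF clsub additive_on_left])
        (use wM in \<open>auto simp: cl_def perp_def\<close>)
    ultimately have "card (cl (insert a A)) \<le> order R * card (cl A)" by (meson le_trans mult_le_mono2)
    also have "\<dots> \<le> order R * order R ^ card A" using IH by simp
    finally show ?thesis using insert by simp
  qed
qed

text \<open>
  A group is not the union of two proper subgroups, here the kernels of \<open>f\<close> and \<open>g\<close>.
\<close>

lemma two_functionals:
  assumes T: "additive_subgroup T M" and f: "additive_on T f" and g: "additive_on T g"
    and x: "x \<in> T" "f x \<noteq> \<zero>" and y: "y \<in> T" "g y \<noteq> \<zero>"
  shows "\<exists>z\<in>T. f z \<noteq> \<zero> \<and> g z \<noteq> \<zero>"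
proof (cases "g x = \<zero> \<and> f y = \<zero>")
  case True
  interpret T: additive_subgroup T M by (rule T)
  have "f (x \<oplus>\<^bsub>M\<^esub> y) = f x" "g (x \<oplus>\<^bsub>M\<^esub> y) = g y"
    using f g x y True by (auto simp: additive_on_def)
  then show ?thesis using x y by (intro bexI[of _ "x \<oplus>\<^bsub>M\<^esub> y"]) auto
qed (use x y in auto)

end

section \<open>Transvections\<close>

lemma card_le_mult_card_image:
  assumes "finite S" and "\<And>s. s \<in> S \<Longrightarrow> card {t \<in> S. f t = f s} \<le> q"
  shows "card S \<le> q * card (f ` S)"
proof -
  have "S = (\<Union>y\<in>f ` S. {t \<in> S. f t = y})" by auto
  then have "card S \<le> (\<Sum>y\<in>f ` S. card {t \<in> S. f t = y})"
    using card_UN_le[of "f ` S" "\<lambda>y. {t \<in> S. f t = y}"] assms(1) by simp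
  also have "\<dots> \<le> (\<Sum>y\<in>f ` S. q)" using assms(2) by (intro sum_mono) auto
  finally show ?thesis by (simp add: mult.commute)
qed

lemma Bij_if_inverse:
  assumes "f \<in> extensional S" "f \<in> S \<rightarrow> S" "g \<in> S \<rightarrow> S"
    "\<And>x. x \<in> S \<Longrightarrow> f (g x) = x" "\<And>x. x \<in> S \<Longrightarrow> g (f x) = x"
  shows "f \<in> Bij S"
  using assms unfolding Bij_def by (auto intro!: bij_betwI[where g = g])

definition stab :: "('v \<Rightarrow> 'v) set \<Rightarrow> 'v set \<Rightarrow> ('v \<Rightarrow> 'v) set" where
  "stab H A = {u \<in> H. \<forall>a\<in>A. u a = a}"

definition linear_bijections where
  "linear_bijections R M = {f \<in> Bij (carrier M).
     (\<forall>v\<in>carrier M. \<forall>w\<in>carrier M. f (v \<oplus>\<^bsub>M\<^esub> w) = f v \<oplus>\<^bsub>M\<^esub> f w) \<and>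
     (\<forall>a\<in>carrier R. \<forall>v\<in>carrier M. f (a \<odot>\<^bsub>M\<^esub> v) = a \<odot>\<^bsub>M\<^esub> f v)}"

context form_space
begin

lemma smult_cancel:
  assumes "c \<in> carrier R" "c \<noteq> \<zero>" "x \<in> carrier M" "y \<in> carrier M" "c \<odot>\<^bsub>M\<^esub> x = c \<odot>\<^bsub>M\<^esub> y"
  shows "x = y"
proof -
  have c: "c \<in> Units R" using assms by (simp add: field_Units)
  have "inv c \<odot>\<^bsub>M\<^esub> (c \<odot>\<^bsub>M\<^esub> z) = z" if "z \<in> carrier M" for z
    using that assms(1) c by (simp add: smult_assoc1[symmetric])
  then show ?thesis using assms(3-5) by metis
qed

definition transvection :: "'c \<Rightarrow> 'c \<Rightarrow> 'c \<Rightarrow> 'c" where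
  "transvection a x = (\<lambda>y\<in>carrier M. y \<oplus>\<^bsub>M\<^esub> B y x \<odot>\<^bsub>M\<^esub> a)"

lemma transvection_closed: "a \<in> carrier M \<Longrightarrow> x \<in> carrier M \<Longrightarrow> y \<in> carrier M \<Longrightarrow> transvection a x y \<in> carrier M"
  by (simp add: transvection_def)

lemma transvection_transvection:
  assumes "a \<in> carrier M" "b \<in> carrier M" "x \<in> carrier M" "y \<in> carrier M" "B b x = \<zero>"
  shows "transvection a x (transvection b x y) = transvection (b \<oplus>\<^bsub>M\<^esub> a) x y"
proof -
  have "B (y \<oplus>\<^bsub>M\<^esub> B y x \<odot>\<^bsub>M\<^esub> b) x = B y x" using assms by (simp add: B_add_left B_smult_left)
  then show ?thesis using assms by (simp add: transvection_def smult_r_distr M.a_assoc)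
qed

lemma transvection_zero: "x \<in> carrier M \<Longrightarrow> y \<in> carrier M \<Longrightarrow> transvection \<zero>\<^bsub>M\<^esub> x y = y"
  by (simp add: transvection_def)

lemma transvection_linear:
  assumes "a \<in> carrier M" "x \<in> carrier M" "B a x = \<zero>"
  shows "transvection a x \<in> linear_bijections R M"
proof -
  have "transvection a x \<in> Bij (carrier M)"
  proof (rule Bij_if_inverse[where g = "transvection (\<ominus>\<^bsub>M\<^esub> a) x"])
    fix y assume y: "y \<in> carrier M"
    show "transvection a x (transvection (\<ominus>\<^bsub>M\<^esub> a) x y) = y" "transvection (\<ominus>\<^bsub>M\<^esub> a) x (transvection a x y) = y"
      using assms y by (simp_all add: transvection_transvection transvection_zero M.l_neg M.r_neg)
  qed (use assms transvection_closed in \<open>auto simp: transvection_def\<close>)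
  then show ?thesis unfolding linear_bijections_def
    using assms by (auto simp: transvection_def B_add_left B_smult_left smult_l_distr smult_r_distr
        smult_assoc1 M.a_ac)
qed

lemma add_pow_order: "add_pow R (order R) \<one> = \<zero>"
  using R.add.pow_order_eq_1[of \<one>] by (simp add: order_def add_pow_def)

lemma transvection_pow:
  assumes "a \<in> carrier M" "x \<in> carrier M" "B a x = \<zero>"
  shows "transvection a x [^]\<^bsub>BijGroup (carrier M)\<^esub> (m :: nat) = transvection (add_pow R m \<one> \<odot>\<^bsub>M\<^esub> a) x"
proof (induction m)
  case 0
  show ?case using assms by (auto simp: BijGroup_def transvection_def fun_eq_iff)
next
  case (Suc m)
  have am: "add_pow R m \<one> \<odot>\<^bsub>M\<^esub> a \<in> carrier M" using assms by simp
  have Bij: "transvection b x \<in> Bij (carrier M)" if "b \<in> carrier M" "B b x = \<zero>" for b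
    using transvection_linear[OF that(1) assms(2) that(2)] by (simp add: linear_bijections_def)
  have z: "B (add_pow R m \<one> \<odot>\<^bsub>M\<^esub> a) x = \<zero>" using assms by (simp add: B_smult_left)
  have "add_pow R (Suc m) \<one> \<odot>\<^bsub>M\<^esub> a = a \<oplus>\<^bsub>M\<^esub> add_pow R m \<one> \<odot>\<^bsub>M\<^esub> a"
    using assms by (simp add: smult_l_distr M.a_comm)
  then have "transvection (add_pow R (Suc m) \<one> \<odot>\<^bsub>M\<^esub> a) x y =
      transvection (add_pow R m \<one> \<odot>\<^bsub>M\<^esub> a) x (transvection a x y)" if "y \<in> carrier M" for y
    using that assms am by (simp add: transvection_transvection)
  then have "compose (carrier M) (transvection (add_pow R m \<one> \<odot>\<^bsub>M\<^esub> a) x) (transvection a x) =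
      transvection (add_pow R (Suc m) \<one> \<odot>\<^bsub>M\<^esub> a) x"
    unfolding compose_def by (auto simp: fun_eq_iff) (simp add: transvection_def)
  then show ?case using Suc.IH Bij[OF am z] Bij[OF assms(1,3)] by (simp add: BijGroup_def)
qed

text \<open>
  The relation that will force transvections to have determinant 1.
\<close>

lemma transvection_pow_order:
  assumes "a \<in> carrier M" "x \<in> carrier M" "B a x = \<zero>"
  shows "transvection a x [^]\<^bsub>BijGroup (carrier M)\<^esub> order R = \<one>\<^bsub>BijGroup (carrier M)\<^esub>"
  unfolding transvection_pow[OF assms] add_pow_order
  using assms by (auto simp: transvection_def BijGroup_def fun_eq_iff)

lemma transvection_fixes:
  assumes "a \<in> carrier M" "x \<in> perp A" "A \<subseteq> carrier M" "y \<in> A"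
  shows "transvection a x y = y"
proof -
  have "y \<in> carrier M" "x \<in> carrier M" "B x y = \<zero>" using assms by (auto simp: perp_def)
  then show ?thesis using B_reflexive[of x y] assms by (simp add: transvection_def)
qed

text \<open>
  With \<open>x\<close> orthogonal to \<open>A\<close> but not to \<open>v\<close>, the transvections \<open>y \<mapsto> y + B y x a\<close> fix \<open>A\<close> and take
  \<open>v\<close> to pairwise distinct vectors as \<open>a\<close> runs through the orthogonal of \<open>x\<close>.
\<close>

lemma card_orbit_transvections:
  assumes H: "finite H" "\<And>a x. a \<in> carrier M \<Longrightarrow> x \<in> carrier M \<Longrightarrow> B a x = \<zero> \<Longrightarrow> transvection a x \<in> H"
    and A: "A \<subseteq> carrier M" and v: "v \<in> carrier M - cl A"
  shows "card (carrier M) \<le> order R * card {u v | u. u \<in> stab H A}"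
proof -
  obtain x where x: "x \<in> perp A" "B v x \<noteq> \<zero>" using not_in_clE[OF v] .
  have xM: "x \<in> carrier M" and vM: "v \<in> carrier M" using x v by (auto simp: perp_def)
  have "card (carrier M) \<le> order R * card {a \<in> carrier M. B a x = \<zero>}"
    by (rule card_le_card_kernel[OF _ additive_on_left])
      (use xM M.add.subgroup_self in \<open>auto intro: additive_subgroup.intro\<close>)
  also have "card {a \<in> carrier M. B a x = \<zero>} \<le> card {u v | u. u \<in> stab H A}"
  proof (rule card_inj_on_le[where f = "\<lambda>a. transvection a x v"])
    show "inj_on (\<lambda>a. transvection a x v) {a \<in> carrier M. B a x = \<zero>}"
      using vM xM x(2) smult_cancel[of "B v x"] by (auto simp: inj_on_def transvection_def)
    show "(\<lambda>a. transvection a x v) ` {a \<in> carrier M. B a x = \<zero>} \<subseteq> {u v | u. u \<in> stab H A}"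
      using H(2)[OF _ xM] transvection_fixes[OF _ x(1) A] by (auto simp: stab_def)
  qed (use H in \<open>simp add: stab_def\<close>)
  finally show ?thesis by simp
qed

end

text \<open>
  The properties of singular vectors shared by the symplectic, unitary and quadratic settings: \<open>T0\<close> is
  a large totally singular subspace, and a vector that is not orthogonal to it can be made singular by
  adding an element of \<open>T0\<close>. In the symplectic case all vectors are singular and \<open>T0\<close> is the whole space.
\<close>

locale isotropic_family = form_space +
  fixes sing :: "'c \<Rightarrow> bool" and T0 :: "'c set"
  assumes T0_subgroup: "additive_subgroup T0 M"
    and T0_smult: "c \<in> carrier R \<Longrightarrow> t \<in> T0 \<Longrightarrow> c \<odot>\<^bsub>M\<^esub> t \<in> T0"
    and T0_sing: "t \<in> T0 \<Longrightarrow> sing t"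
    and sing_shift: "x \<in> carrier M \<Longrightarrow> t \<in> T0 \<Longrightarrow> B x t \<noteq> \<zero> \<Longrightarrow> \<exists>c\<in>carrier R. sing (x \<oplus>\<^bsub>M\<^esub> c \<odot>\<^bsub>M\<^esub> t)"
    and sing_add: "x \<in> carrier M \<Longrightarrow> s \<in> T0 \<Longrightarrow> t \<in> T0 \<Longrightarrow> sing (x \<oplus>\<^bsub>M\<^esub> s) \<Longrightarrow> B x t = \<zero> \<Longrightarrow>
      sing ((x \<oplus>\<^bsub>M\<^esub> s) \<oplus>\<^bsub>M\<^esub> t)"
begin

lemma T0_subset: "T0 \<subseteq> carrier M"
  using T0_subgroup by (rule additive_subgroup.a_subset)

text \<open>
  The part of \<open>T0\<close> orthogonal to \<open>A\<close> has more elements than the closure of \<open>A\<close>.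
\<close>

lemma T0_not_subset_cl:
  assumes A: "finite A" "A \<subseteq> carrier M" and big: "order R ^ (2 * card A) < card T0"
  obtains t where "t \<in> T0 \<inter> perp A" "t \<notin> cl A"
proof -
  have "card T0 \<le> order R ^ card A * card (T0 \<inter> perp A)"
    using card_le_card_inter_perp[OF T0_subgroup A] by simp
  with big have "order R ^ card A * order R ^ card A < order R ^ card A * card (T0 \<inter> perp A)"
    by (simp add: power_add[symmetric] mult_2)
  then have "card (cl A) < card (T0 \<inter> perp A)"
    using card_cl_le[OF A] by (metis le_less_trans mult_less_cancel1)
  then have "\<not> T0 \<inter> perp A \<subseteq> cl A"
    using card_mono[of "cl A"] finite_subset[OF perp_subset finite_vectors]
    by (metis cl_def not_less)
  then show ?thesis using that by auto
qed

text \<open>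
  If \<open>v\<close> is not orthogonal to \<open>T = T0 \<inter> perp A\<close>, half of \<open>T\<close> will do. Otherwise choose \<open>x\<close> orthogonal to
  \<open>A\<close>, but neither to \<open>v\<close> nor to \<open>T\<close>, make it singular by adding an element of \<open>T\<close>, and then add
  arbitrary elements of \<open>T\<close> that are orthogonal to \<open>x\<close>; none of this changes the product with \<open>v\<close>.
\<close>

lemma many_singular:
  assumes A: "finite A" "A \<subseteq> carrier M" and v: "v \<in> carrier M - cl A"
    and big: "order R ^ (2 * card A) < card T0"
  shows "card T0 \<le> order R ^ Suc (card A) * card {e \<in> perp A. sing e \<and> B v e \<noteq> \<zero>}"
proof -
  let ?T = "T0 \<inter> perp A" let ?E = "{e \<in> perp A. sing e \<and> B v e \<noteq> \<zero>}"
  have T: "additive_subgroup ?T M" and cT: "card T0 \<le> order R ^ card A * card ?T"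
    using card_le_card_inter_perp[OF T0_subgroup A] by auto
  have P: "additive_subgroup (perp A) M" by (rule subgroup_perp[OF A(2)])
  interpret P: additive_subgroup "perp A" M by (rule P)
  have TM: "?T \<subseteq> carrier M" using perp_subset by auto
  have vM: "v \<in> carrier M" using v by simp
  have finE: "finite ?E" using finite_subset[OF perp_subset finite_vectors] by simp
  have "card ?T \<le> order R * card ?E"
  proof (cases "\<exists>t\<in>?T. B v t \<noteq> \<zero>")
    case True
    then obtain s where s: "s \<in> ?T" "B v s \<noteq> \<zero>" by auto
    have "card ?T \<le> 2 * card {t \<in> ?T. \<zero> \<oplus> B v t \<noteq> \<zero>}"
      by (rule card_le_twice_nonzero[OF T additive_on_right, of _ _ s]) (use TM vM s in auto)
    also have "\<dots> \<le> order R * card ?E"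
      using order_gt_1 TM vM T0_sing
      by (intro mult_le_mono card_mono finE) (auto simp: subset_iff)
    finally show ?thesis .
  next
    case False
    obtain x1 where x1: "x1 \<in> perp A" "B v x1 \<noteq> \<zero>" using not_in_clE[OF v] .
    obtain t0 where t0: "t0 \<in> ?T" "t0 \<notin> cl A" using T0_not_subset_cl[OF A big] .
    have t0M: "t0 \<in> carrier M" using t0 TM by auto
    obtain x2 where x2: "x2 \<in> perp A" "B t0 x2 \<noteq> \<zero>" using not_in_clE[of t0 A] t0 t0M by auto
    have "B x2 t0 \<noteq> \<zero>" using x2 B_reflexive[of x2 t0] t0M perp_subset by blast
    then obtain x where x: "x \<in> perp A" "B v x \<noteq> \<zero>" "B x t0 \<noteq> \<zero>"
      using two_functionals[OF P additive_on_right[OF perp_subset vM] additive_on_left[OF perp_subset t0M] x1 x2(1)]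
      by auto
    have xM: "x \<in> carrier M" using x perp_subset by auto
    have "\<exists>c\<in>carrier R. sing (x \<oplus>\<^bsub>M\<^esub> c \<odot>\<^bsub>M\<^esub> t0)"
      by (rule sing_shift[OF xM IntD1[OF t0(1)] x(3)])
    then obtain c where c: "c \<in> carrier R" "sing (x \<oplus>\<^bsub>M\<^esub> c \<odot>\<^bsub>M\<^esub> t0)" by (rule bexE)
    have "B (c \<odot>\<^bsub>M\<^esub> t0) a = \<zero>" if "a \<in> A" for a
    proof -
      have "a \<in> carrier M" "B t0 a = \<zero>" using that A(2) t0(1) unfolding perp_def by blast+
      then show ?thesis by (simp only: B_smult_left[OF c(1) t0M] R.r_null[OF c(1)])
    qed
    then have ct: "c \<odot>\<^bsub>M\<^esub> t0 \<in> ?T"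
      using T0_smult[OF c(1) IntD1[OF t0(1)]] smult_closed[OF c(1) t0M] unfolding perp_def by blast
    have "card ?T \<le> order R * card {t \<in> ?T. B x t = \<zero>}"
      by (rule card_le_card_kernel[OF T additive_on_right[OF TM xM]])
    also have "card {t \<in> ?T. B x t = \<zero>} \<le> card ?E"
    proof (rule card_inj_on_le[where f = "\<lambda>t. (x \<oplus>\<^bsub>M\<^esub> c \<odot>\<^bsub>M\<^esub> t0) \<oplus>\<^bsub>M\<^esub> t"])
      show "inj_on (\<lambda>t. (x \<oplus>\<^bsub>M\<^esub> c \<odot>\<^bsub>M\<^esub> t0) \<oplus>\<^bsub>M\<^esub> t) {t \<in> ?T. B x t = \<zero>}"
        using TM xM c(1) t0M by (intro inj_onI) (simp add: subset_iff)
      show "(\<lambda>t. (x \<oplus>\<^bsub>M\<^esub> c \<odot>\<^bsub>M\<^esub> t0) \<oplus>\<^bsub>M\<^esub> t) ` {t \<in> ?T. B x t = \<zero>} \<subseteq> ?E"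
      proof clarify
        fix t assume t: "t \<in> T0" "t \<in> perp A" "B x t = \<zero>"
        have tM: "t \<in> carrier M" using t T0_subset by auto
        have "B v t = \<zero>" "B v (c \<odot>\<^bsub>M\<^esub> t0) = \<zero>" using False t ct by auto
        then have "B v ((x \<oplus>\<^bsub>M\<^esub> c \<odot>\<^bsub>M\<^esub> t0) \<oplus>\<^bsub>M\<^esub> t) = B v x"
          using vM xM c(1) t0M tM by (simp add: B_add_right)
        moreover have "sing ((x \<oplus>\<^bsub>M\<^esub> c \<odot>\<^bsub>M\<^esub> t0) \<oplus>\<^bsub>M\<^esub> t)" using sing_add[OF xM _ t(1) c(2) t(3)] ct by auto
        moreover have "(x \<oplus>\<^bsub>M\<^esub> c \<odot>\<^bsub>M\<^esub> t0) \<oplus>\<^bsub>M\<^esub> t \<in> perp A" using x(1) ct t by simp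
        ultimately show "(x \<oplus>\<^bsub>M\<^esub> c \<odot>\<^bsub>M\<^esub> t0) \<oplus>\<^bsub>M\<^esub> t \<in> perp A \<and> sing ((x \<oplus>\<^bsub>M\<^esub> c \<odot>\<^bsub>M\<^esub> t0) \<oplus>\<^bsub>M\<^esub> t) \<and>
            B v ((x \<oplus>\<^bsub>M\<^esub> c \<odot>\<^bsub>M\<^esub> t0) \<oplus>\<^bsub>M\<^esub> t) \<noteq> \<zero>" using x(2) by simp
      qed
    qed (rule finE)
    finally show ?thesis by simp
  qed
  then have "order R ^ card A * card ?T \<le> order R ^ card A * (order R * card ?E)" by (rule mult_le_mono2)
  also have "\<dots> = order R ^ Suc (card A) * card ?E" by (simp add: mult.assoc mult.left_commute)
  finally show ?thesis using cT by (rule le_trans[rotated])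
qed

text \<open>
  The image of \<open>v\<close> under the transvection along \<open>e\<close> determines the line through \<open>e\<close>, so at most
  \<open>order R\<close> of the many singular vectors give the same image.
\<close>

lemma card_orbit_singular_transvections:
  assumes H: "finite H" "\<And>e. e \<in> carrier M \<Longrightarrow> sing e \<Longrightarrow> transvection (c \<odot>\<^bsub>M\<^esub> e) e \<in> H"
    and c: "c \<in> carrier R" "c \<noteq> \<zero>"
    and A: "finite A" "A \<subseteq> carrier M" and v: "v \<in> carrier M - cl A"
    and big: "order R ^ (2 * card A) < card T0"
  shows "card T0 \<le> order R ^ (card A + 2) * card {u v | u. u \<in> stab H A}"
proof -
  let ?E = "{e \<in> perp A. sing e \<and> B v e \<noteq> \<zero>}"
  let ?f = "\<lambda>e. transvection (c \<odot>\<^bsub>M\<^esub> e) e v"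
  have vM: "v \<in> carrier M" using v by simp
  have finE: "finite ?E" using finite_subset[OF perp_subset finite_vectors] by simp
  have EM: "e \<in> carrier M" if "e \<in> ?E" for e using that by (simp add: perp_def)
  have "card ?E \<le> order R * card (?f ` ?E)"
  proof (rule card_le_mult_card_image[OF finE])
    fix s assume s: "s \<in> ?E"
    have sM: "s \<in> carrier M" by (rule EM[OF s])
    have "{t \<in> ?E. ?f t = ?f s} \<subseteq> (\<lambda>a. a \<odot>\<^bsub>M\<^esub> s) ` carrier R"
    proof
      fix t assume t: "t \<in> {t \<in> ?E. ?f t = ?f s}"
      have tM: "t \<in> carrier M" using t EM by blast
      let ?a = "B v t \<otimes> c" let ?b = "B v s \<otimes> c"
      have a: "?a \<in> Units R" using t vM tM c by (simp add: field_Units R.integral_iff)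
      have "v \<oplus>\<^bsub>M\<^esub> ?a \<odot>\<^bsub>M\<^esub> t = v \<oplus>\<^bsub>M\<^esub> ?b \<odot>\<^bsub>M\<^esub> s"
        using t vM tM sM c by (simp add: transvection_def smult_assoc1)
      then have "?a \<odot>\<^bsub>M\<^esub> t = ?b \<odot>\<^bsub>M\<^esub> s" using vM tM sM c by simp
      then have "inv ?a \<odot>\<^bsub>M\<^esub> (?a \<odot>\<^bsub>M\<^esub> t) = inv ?a \<odot>\<^bsub>M\<^esub> (?b \<odot>\<^bsub>M\<^esub> s)" by simp
      then have "t = (inv ?a \<otimes> ?b) \<odot>\<^bsub>M\<^esub> s"
        using a vM tM sM c by (simp add: smult_assoc1[of "inv ?a" ?b s])
          (simp add: smult_assoc1[symmetric])
      then show "t \<in> (\<lambda>a. a \<odot>\<^bsub>M\<^esub> s) ` carrier R" using a vM sM c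
        by (intro image_eqI[where x = "inv ?a \<otimes> ?b"]) auto
    qed
    then show "card {t \<in> ?E. ?f t = ?f s} \<le> order R"
      unfolding order_def using surj_card_le[OF finite_scalars] by blast
  qed
  also have "card (?f ` ?E) \<le> card {u v | u. u \<in> stab H A}"
  proof (rule card_mono)
    show "finite {u v | u. u \<in> stab H A}" using H by (simp add: stab_def)
    show "?f ` ?E \<subseteq> {u v | u. u \<in> stab H A}"
    proof clarify
      fix e assume e: "e \<in> perp A" "sing e"
      have eM: "e \<in> carrier M" using e by (simp add: perp_def)
      have "transvection (c \<odot>\<^bsub>M\<^esub> e) e \<in> stab H A"
        using H(2)[OF eM e(2)] transvection_fixes[OF _ e(1) A(2)] eM c by (simp add: stab_def)
      then show "\<exists>u. ?f e = u v \<and> u \<in> stab H A" by blast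
    qed
  qed
  finally have "card ?E \<le> order R * card {u v | u. u \<in> stab H A}" by simp
  then have "order R ^ Suc (card A) * card ?E \<le> order R ^ Suc (card A) * (order R * card {u v | u. u \<in> stab H A})"
    by (rule mult_le_mono2)
  also have "\<dots> = order R ^ (card A + 2) * card {u v | u. u \<in> stab H A}"
    by (simp add: add_2_eq_Suc' mult.assoc mult.left_commute)
  finally show ?thesis using many_singular[OF A v big] by (rule le_trans[rotated])
qed

end

section \<open>Quadratic forms and Eichler transformations\<close>

lemma linear_combination_linear:
  assumes "module R M" and f: "\<phi> \<in> carrier M \<rightarrow> carrier R" "\<psi> \<in> carrier M \<rightarrow> carrier R"
    and add: "\<And>x y. x \<in> carrier M \<Longrightarrow> y \<in> carrier M \<Longrightarrow> \<phi> (x \<oplus>\<^bsub>M\<^esub> y) = \<phi> x \<oplus>\<^bsub>R\<^esub> \<phi> y"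
      "\<And>x y. x \<in> carrier M \<Longrightarrow> y \<in> carrier M \<Longrightarrow> \<psi> (x \<oplus>\<^bsub>M\<^esub> y) = \<psi> x \<oplus>\<^bsub>R\<^esub> \<psi> y"
    and hom: "\<And>a x. a \<in> carrier R \<Longrightarrow> x \<in> carrier M \<Longrightarrow> \<phi> (a \<odot>\<^bsub>M\<^esub> x) = a \<otimes>\<^bsub>R\<^esub> \<phi> x"
      "\<And>a x. a \<in> carrier R \<Longrightarrow> x \<in> carrier M \<Longrightarrow> \<psi> (a \<odot>\<^bsub>M\<^esub> x) = a \<otimes>\<^bsub>R\<^esub> \<psi> x"
    and we: "w \<in> carrier M" "e \<in> carrier M"
    and Bij: "(\<lambda>y\<in>carrier M. y \<oplus>\<^bsub>M\<^esub> (\<phi> y \<odot>\<^bsub>M\<^esub> w \<oplus>\<^bsub>M\<^esub> \<psi> y \<odot>\<^bsub>M\<^esub> e)) \<in> Bij (carrier M)"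
  shows "(\<lambda>y\<in>carrier M. y \<oplus>\<^bsub>M\<^esub> (\<phi> y \<odot>\<^bsub>M\<^esub> w \<oplus>\<^bsub>M\<^esub> \<psi> y \<odot>\<^bsub>M\<^esub> e)) \<in> linear_bijections R M"
proof -
  interpret module R M by fact
  have c: "\<phi> x \<in> carrier R" "\<psi> x \<in> carrier R" if "x \<in> carrier M" for x using f that by auto
  show ?thesis unfolding linear_bijections_def
    using Bij we by (simp add: add hom c smult_l_distr smult_r_distr smult_assoc1 M.a_ac)
qed

text \<open>
  In characteristic 2 a quadratic form is not determined by its polar form \<open>B\<close>, so both are
  parameters.
\<close>

locale quadratic_space = form_space +
  fixes Qf :: "'c \<Rightarrow> 'a" and T0 :: "'c set"
  assumes Qf_closed [simp]: "x \<in> carrier M \<Longrightarrow> Qf x \<in> carrier R"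
    and Qf_add: "x \<in> carrier M \<Longrightarrow> y \<in> carrier M \<Longrightarrow> Qf (x \<oplus>\<^bsub>M\<^esub> y) = Qf x \<oplus> Qf y \<oplus> B x y"
    and Qf_smult: "a \<in> carrier R \<Longrightarrow> x \<in> carrier M \<Longrightarrow> Qf (a \<odot>\<^bsub>M\<^esub> x) = a \<otimes> a \<otimes> Qf x"
    and B_sym: "x \<in> carrier M \<Longrightarrow> y \<in> carrier M \<Longrightarrow> B x y = B y x"
    and T0_sub: "additive_subgroup T0 M"
    and T0_scale: "c \<in> carrier R \<Longrightarrow> t \<in> T0 \<Longrightarrow> c \<odot>\<^bsub>M\<^esub> t \<in> T0"
    and T0_zero: "t \<in> T0 \<Longrightarrow> Qf t = \<zero>"
begin

lemma B_smult_right: "a \<in> carrier R \<Longrightarrow> x \<in> carrier M \<Longrightarrow> y \<in> carrier M \<Longrightarrow> B x (a \<odot>\<^bsub>M\<^esub> y) = a \<otimes> B x y"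
  by (simp add: B_sym[of x] B_smult_left)

lemma B_self: assumes x: "x \<in> carrier M" shows "B x x = Qf x \<oplus> Qf x"
proof -
  have "Qf x \<oplus> Qf x \<oplus> B x x = Qf ((\<one> \<oplus> \<one>) \<odot>\<^bsub>M\<^esub> x)"
    using x by (simp add: smult_l_distr Qf_add)
  also have "\<dots> = (\<one> \<oplus> \<one>) \<otimes> (\<one> \<oplus> \<one>) \<otimes> Qf x" using x by (simp add: Qf_smult)
  also have "\<dots> = Qf x \<oplus> Qf x \<oplus> (Qf x \<oplus> Qf x)" using x by (simp add: R.l_distr R.r_distr R.a_ac)
  finally show ?thesis using x by (simp add: R.add.l_cancel)
qed

lemma B_T0: "s \<in> T0 \<Longrightarrow> t \<in> T0 \<Longrightarrow> B s t = \<zero>"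
proof -
  assume st: "s \<in> T0" "t \<in> T0"
  interpret T: additive_subgroup T0 M by (rule T0_sub)
  have M: "s \<in> carrier M" "t \<in> carrier M" using st T.a_subset by auto
  have "s \<oplus>\<^bsub>M\<^esub> t \<in> T0" using st by simp
  then have "Qf s \<oplus> Qf t \<oplus> B s t = \<zero>" using Qf_add[OF M] T0_zero by metis
  then show ?thesis using st M by (simp add: T0_zero)
qed

sublocale isotropic_family R M B "\<lambda>x. Qf x = \<zero>" T0
proof (intro isotropic_family.intro isotropic_family_axioms.intro, goal_cases)
  case 1 show ?case by (rule form_space_axioms)
next
  case 2 show ?case by (rule T0_sub)
next
  case (3 c t) then show ?case by (rule T0_scale)
next
  case (4 t) then show ?case by (rule T0_zero)
next
  case (5 x t)
  have tM: "t \<in> carrier M" using 5 additive_subgroup.a_subset[OF T0_sub] by auto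
  have u: "B x t \<in> Units R" using 5 tM by (simp add: field_Units)
  let ?c = "\<ominus> (Qf x \<otimes> inv (B x t))"
  have c: "?c \<in> carrier R" using 5 u by simp
  have "Qf (x \<oplus>\<^bsub>M\<^esub> ?c \<odot>\<^bsub>M\<^esub> t) = Qf x \<oplus> ?c \<otimes> B x t"
    using 5 tM c by (simp add: Qf_add Qf_smult B_smult_right T0_zero)
  also have "?c \<otimes> B x t = \<ominus> Qf x" using 5(1) tM u by (simp add: R.l_minus R.m_assoc)
  finally show ?case using c 5(1) by (auto simp: R.r_neg)
next
  case (6 x s t)
  have M: "s \<in> carrier M" "t \<in> carrier M" using 6 additive_subgroup.a_subset[OF T0_sub] by auto
  then show ?case using 6 by (simp add: Qf_add[of "x \<oplus>\<^bsub>M\<^esub> s" t] B_add_left B_T0 T0_zero)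
qed

definition isometries :: "('c \<Rightarrow> 'c) set" where
  "isometries = {f \<in> linear_bijections R M. \<forall>v\<in>carrier M. Qf (f v) = Qf v}"

definition reflection :: "'c \<Rightarrow> 'c \<Rightarrow> 'c" where
  "reflection x = (\<lambda>y\<in>carrier M. y \<oplus>\<^bsub>M\<^esub> (\<ominus> (B y x \<otimes> inv (Qf x))) \<odot>\<^bsub>M\<^esub> x)"

text \<open>
  The coefficient of \<open>e\<close> in the Siegel-Eichler transformation
  \<open>y \<mapsto> y + B y e w - (B y w + Qf w B y e) e\<close>.
\<close>

definition eichler_coeff :: "'c \<Rightarrow> 'c \<Rightarrow> 'c \<Rightarrow> 'a" where
  "eichler_coeff e w y = \<ominus> (B y w \<oplus> Qf w \<otimes> B y e)"

definition eichler :: "'c \<Rightarrow> 'c \<Rightarrow> 'c \<Rightarrow> 'c" where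
  "eichler e w = (\<lambda>y\<in>carrier M. y \<oplus>\<^bsub>M\<^esub> (B y e \<odot>\<^bsub>M\<^esub> w \<oplus>\<^bsub>M\<^esub> eichler_coeff e w y \<odot>\<^bsub>M\<^esub> e))"

lemma eichler_coeff_closed [simp]:
  "e \<in> carrier M \<Longrightarrow> w \<in> carrier M \<Longrightarrow> y \<in> carrier M \<Longrightarrow> eichler_coeff e w y \<in> carrier R"
  by (simp add: eichler_coeff_def)

lemma eichler_closed:
  "e \<in> carrier M \<Longrightarrow> w \<in> carrier M \<Longrightarrow> y \<in> carrier M \<Longrightarrow> eichler e w y \<in> carrier M"
  by (simp add: eichler_def)

lemma isometry_B:
  assumes f: "f \<in> isometries" and M: "x \<in> carrier M" "y \<in> carrier M"
  shows "B (f x) (f y) = B x y"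
proof -
  have fM: "f x \<in> carrier M" "f y \<in> carrier M"
    using f M unfolding isometries_def linear_bijections_def by (auto simp: Bij_def bij_betw_def)
  have "f (x \<oplus>\<^bsub>M\<^esub> y) = f x \<oplus>\<^bsub>M\<^esub> f y" using f M by (simp add: isometries_def linear_bijections_def)
  moreover have "Qf (f (x \<oplus>\<^bsub>M\<^esub> y)) = Qf (x \<oplus>\<^bsub>M\<^esub> y)" using f M by (simp add: isometries_def)
  ultimately have "Qf (f x \<oplus>\<^bsub>M\<^esub> f y) = Qf (x \<oplus>\<^bsub>M\<^esub> y)" by simp
  moreover have "Qf (f x) = Qf x" "Qf (f y) = Qf y" using f M by (auto simp: isometries_def)
  ultimately show ?thesis using M fM by (simp add: Qf_add)
qed

context
  fixes e assumes e: "e \<in> carrier M" "Qf e = \<zero>"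
begin

lemma B_e_e: "B e e = \<zero>"
  using B_self e by simp

text \<open>
  For fixed \<open>e\<close>, these transformations form a group isomorphic to a quotient of the additive group of
  the orthogonal of \<open>e\<close>.
\<close>

lemma eichler_eichler:
  assumes w: "w \<in> carrier M" "B e w = \<zero>" and w': "w' \<in> carrier M" "B e w' = \<zero>" and y: "y \<in> carrier M"
  shows "eichler e w (eichler e w' y) = eichler e (w' \<oplus>\<^bsub>M\<^esub> w) y"
proof -
  define z where "z = eichler e w' y"
  define b p p' q q' r where "b = B y e" and "p = B y w" and "p' = B y w'" and "q = Qf w" and "q' = Qf w'"
    and "r = B w' w"
  note defs = b_def p_def p'_def q_def q'_def r_def
  have c: "b \<in> carrier R" "p \<in> carrier R" "p' \<in> carrier R" "q \<in> carrier R" "q' \<in> carrier R" "r \<in> carrier R"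
    using e w w' y by (simp_all add: defs)
  have we: "B w e = \<zero>" "B w' e = \<zero>" using B_sym e w w' by auto
  have zM: "z \<in> carrier M" unfolding z_def using e w' y by (simp add: eichler_closed)
  have z: "z = y \<oplus>\<^bsub>M\<^esub> (b \<odot>\<^bsub>M\<^esub> w' \<oplus>\<^bsub>M\<^esub> (\<ominus> (p' \<oplus> q' \<otimes> b)) \<odot>\<^bsub>M\<^esub> e)"
    using y by (simp add: z_def eichler_def eichler_coeff_def defs)
  have Bze: "B z e = b" unfolding z using e w w' y c we B_e_e by (simp add: B_add_left B_smult_left) (simp add: defs)
  have Bzw: "B z w = p \<oplus> b \<otimes> r"
    unfolding z using e w w' y c we by (simp add: B_add_left B_smult_left) (simp add: defs)
  have "eichler e w z = z \<oplus>\<^bsub>M\<^esub> (b \<odot>\<^bsub>M\<^esub> w \<oplus>\<^bsub>M\<^esub> (\<ominus> (p \<oplus> b \<otimes> r \<oplus> q \<otimes> b)) \<odot>\<^bsub>M\<^esub> e)"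
    using zM by (simp add: eichler_def eichler_coeff_def Bze Bzw q_def)
  also have "\<dots> = y \<oplus>\<^bsub>M\<^esub> (b \<odot>\<^bsub>M\<^esub> (w' \<oplus>\<^bsub>M\<^esub> w) \<oplus>\<^bsub>M\<^esub>
      (\<ominus> (p' \<oplus> q' \<otimes> b) \<oplus> \<ominus> (p \<oplus> b \<otimes> r \<oplus> q \<otimes> b)) \<odot>\<^bsub>M\<^esub> e)"
    unfolding z using e w w' y c by (simp add: smult_l_distr smult_r_distr M.a_ac)
  also have "\<ominus> (p' \<oplus> q' \<otimes> b) \<oplus> \<ominus> (p \<oplus> b \<otimes> r \<oplus> q \<otimes> b) = \<ominus> ((p' \<oplus> p) \<oplus> (q' \<oplus> q \<oplus> r) \<otimes> b)"
    using c by (simp add: R.l_distr R.r_distr R.minus_add R.a_ac R.m_ac)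
  also have "y \<oplus>\<^bsub>M\<^esub> (b \<odot>\<^bsub>M\<^esub> (w' \<oplus>\<^bsub>M\<^esub> w) \<oplus>\<^bsub>M\<^esub> \<dots> \<odot>\<^bsub>M\<^esub> e) = eichler e (w' \<oplus>\<^bsub>M\<^esub> w) y"
    using e w w' y by (simp add: eichler_def eichler_coeff_def defs B_add_right Qf_add)
  finally show ?thesis by (simp add: z_def)
qed

lemma eichler_zero: "y \<in> carrier M \<Longrightarrow> eichler e \<zero>\<^bsub>M\<^esub> y = y"
  using Qf_smult[of \<zero> "\<zero>\<^bsub>M\<^esub>"] e by (simp add: eichler_def eichler_coeff_def)

lemma eichler_isometry:
  assumes w: "w \<in> carrier M" "B e w = \<zero>"
  shows "eichler e w \<in> isometries"
proof -
  have we: "B w e = \<zero>" using B_sym e w by auto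
  have Bij: "eichler e w \<in> Bij (carrier M)"
  proof (rule Bij_if_inverse[where g = "eichler e (\<ominus>\<^bsub>M\<^esub> w)"])
    fix y assume y: "y \<in> carrier M"
    show "eichler e w (eichler e (\<ominus>\<^bsub>M\<^esub> w) y) = y" "eichler e (\<ominus>\<^bsub>M\<^esub> w) (eichler e w y) = y"
      using w y e by (simp_all add: eichler_eichler eichler_zero M.l_neg M.r_neg)
  qed (use e w eichler_closed in \<open>auto simp: eichler_def\<close>)
  have "eichler e w \<in> linear_bijections R M"
    using Bij unfolding eichler_def
  proof (intro linear_combination_linear)
    show "module R M" ..
  qed (use e w in \<open>auto simp: eichler_coeff_def B_add_left B_smult_left R.l_distr R.r_distr R.minus_add R.a_ac
      R.m_ac R.r_minus\<close>)
  moreover have "Qf (eichler e w y) = Qf y" if y: "y \<in> carrier M" for y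
  proof -
    define b p q where "b = B y e" and "p = B y w" and "q = Qf w"
    note defs = b_def p_def q_def
    define d where "d = \<ominus> (p \<oplus> q \<otimes> b)"
    have c: "b \<in> carrier R" "p \<in> carrier R" "q \<in> carrier R" "d \<in> carrier R"
      using e w y by (simp_all add: defs d_def)
    let ?u = "b \<odot>\<^bsub>M\<^esub> w \<oplus>\<^bsub>M\<^esub> d \<odot>\<^bsub>M\<^esub> e"
    have "Qf ?u = b \<otimes> b \<otimes> q" using e w we c
      by (simp add: Qf_add Qf_smult B_add_left B_smult_left B_smult_right) (simp add: defs)
    moreover have "B y ?u = b \<otimes> p \<oplus> d \<otimes> b"
      using e w y c by (simp add: B_add_right B_smult_right) (simp add: defs)
    ultimately have "Qf (y \<oplus>\<^bsub>M\<^esub> ?u) = Qf y \<oplus> b \<otimes> b \<otimes> q \<oplus> (b \<otimes> p \<oplus> d \<otimes> b)"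
      using e w y c by (simp add: Qf_add[of y ?u])
    also have "\<dots> = Qf y"
    proof -
      define s where "s = b \<otimes> b \<otimes> q"
      define t where "t = b \<otimes> p"
      have st: "s \<in> carrier R" "t \<in> carrier R" using c by (simp_all add: s_def t_def)
      have "d \<otimes> b = \<ominus> (s \<oplus> t)"
        using c unfolding d_def s_def t_def by (simp add: R.l_distr R.r_distr R.l_minus R.r_minus R.minus_add R.a_ac R.m_ac)
      moreover have "s \<oplus> (t \<oplus> \<ominus> (s \<oplus> t)) = \<zero>"
        using st by (subst R.a_assoc[symmetric]) (auto simp: R.r_neg)
      ultimately have "Qf y \<oplus> s \<oplus> (t \<oplus> d \<otimes> b) = Qf y" using st y by (simp add: R.a_assoc)
      then show ?thesis by (simp add: s_def t_def)
    qed
    finally show ?thesis using y by (simp add: eichler_def eichler_coeff_def d_def defs)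
  qed
  ultimately show ?thesis by (simp add: isometries_def)
qed

lemma isometry_eichler:
  assumes f: "f \<in> isometries" "f e = e" and w: "w \<in> carrier M" and y: "y \<in> carrier M"
  shows "f (eichler e w y) = eichler e (f w) (f y)"
proof -
  have fM: "f z \<in> carrier M" if "z \<in> carrier M" for z
    using f that unfolding isometries_def linear_bijections_def by (auto simp: Bij_def bij_betw_def)
  have add: "f (v \<oplus>\<^bsub>M\<^esub> z) = f v \<oplus>\<^bsub>M\<^esub> f z" if "v \<in> carrier M" "z \<in> carrier M" for v z
    using f that by (simp add: isometries_def linear_bijections_def)
  have sc: "f (a \<odot>\<^bsub>M\<^esub> z) = a \<odot>\<^bsub>M\<^esub> f z" if "a \<in> carrier R" "z \<in> carrier M" for a z
    using f that by (simp add: isometries_def linear_bijections_def)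
  have "B (f y) e = B y e" "B (f y) (f w) = B y w" "Qf (f w) = Qf w"
    using isometry_B[OF f(1) y e(1)] isometry_B[OF f(1) y w] f w by (auto simp: isometries_def)
  then show ?thesis using e w y fM f(2) by (simp add: eichler_def eichler_coeff_def add sc)
qed

end

lemma reflection_isometry:
  assumes x: "x \<in> carrier M" "Qf x \<noteq> \<zero>"
  shows "reflection x \<in> isometries"
proof -
  have u: "Qf x \<in> Units R" using x by (simp add: field_Units)
  define i where "i = inv (Qf x)"
  have i: "i \<in> carrier R" "i \<otimes> Qf x = \<one>" "Qf x \<otimes> i = \<one>" using u by (auto simp: i_def)
  have cl: "reflection x y \<in> carrier M" if "y \<in> carrier M" for y using that x i by (simp add: reflection_def flip: i_def)
  have inv: "reflection x (reflection x y) = y" if y: "y \<in> carrier M" for y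
  proof -
    define c where "c = \<ominus> (B y x \<otimes> i)"
    have c: "c \<in> carrier R" using y x i by (simp add: c_def)
    have ry: "reflection x y = y \<oplus>\<^bsub>M\<^esub> c \<odot>\<^bsub>M\<^esub> x" using y by (simp add: reflection_def c_def i_def)
    have "c \<otimes> Qf x = \<ominus> B y x" using x y i by (simp add: c_def R.l_minus R.m_assoc)
    then have "B (y \<oplus>\<^bsub>M\<^esub> c \<odot>\<^bsub>M\<^esub> x) x = B y x \<oplus> (\<ominus> B y x \<oplus> \<ominus> B y x)"
      using x y c by (simp add: B_add_left B_smult_left B_self R.r_distr)
    also have "\<dots> = \<ominus> B y x" using x y by (simp add: R.a_assoc[symmetric] R.r_neg)
    finally have "\<ominus> (B (y \<oplus>\<^bsub>M\<^esub> c \<odot>\<^bsub>M\<^esub> x) x \<otimes> i) = \<ominus> c" using x y i by (simp add: c_def R.l_minus)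
    then have "reflection x (y \<oplus>\<^bsub>M\<^esub> c \<odot>\<^bsub>M\<^esub> x) = (y \<oplus>\<^bsub>M\<^esub> c \<odot>\<^bsub>M\<^esub> x) \<oplus>\<^bsub>M\<^esub> (\<ominus> c) \<odot>\<^bsub>M\<^esub> x"
      using x y c by (simp add: reflection_def i_def)
    also have "\<dots> = y" using x y c by (simp add: M.a_assoc smult_l_minus M.r_neg)
    finally show ?thesis by (simp add: ry)
  qed
  have "reflection x \<in> Bij (carrier M)"
    by (rule Bij_if_inverse[where g = "reflection x"]) (use cl inv in \<open>auto simp: reflection_def\<close>)
  moreover have "reflection x =
      (\<lambda>y\<in>carrier M. y \<oplus>\<^bsub>M\<^esub> ((\<ominus> (B y x \<otimes> i)) \<odot>\<^bsub>M\<^esub> x \<oplus>\<^bsub>M\<^esub> \<zero> \<odot>\<^bsub>M\<^esub> x))"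
    using x i(1) by (auto simp: reflection_def fun_eq_iff simp flip: i_def)
  ultimately have "reflection x \<in> linear_bijections R M"
  proof (elim ssubst, intro linear_combination_linear)
    show "module R M" ..
  qed (use x i(1) in \<open>auto simp: B_add_left B_smult_left R.l_distr R.minus_add R.r_minus R.m_assoc\<close>)
  moreover have "Qf (reflection x y) = Qf y" if y: "y \<in> carrier M" for y
  proof -
    define b where "b = B y x"
    have b: "b \<in> carrier R" using x y by (simp add: b_def)
    let ?c = "\<ominus> (b \<otimes> i)"
    have "Qf (y \<oplus>\<^bsub>M\<^esub> ?c \<odot>\<^bsub>M\<^esub> x) = Qf y \<oplus> (b \<otimes> i) \<otimes> (b \<otimes> (i \<otimes> Qf x)) \<oplus> \<ominus> ((b \<otimes> i) \<otimes> b)"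
      using x y i(1) b by (simp add: Qf_add Qf_smult B_smult_right R.l_minus R.r_minus R.m_assoc) (simp add: b_def)
    also have "\<dots> = Qf y" using y b i by (simp add: R.a_assoc R.r_neg)
    finally show ?thesis using y by (simp add: reflection_def b_def i_def)
  qed
  ultimately show ?thesis by (simp add: isometries_def)
qed

end

context quadratic_space
begin

lemma isometry_Bij: "f \<in> isometries \<Longrightarrow> f \<in> Bij (carrier M)"
  by (simp add: isometries_def linear_bijections_def)

text \<open>
  Conjugation by the reflection in \<open>x\<close> fixes \<open>e\<close> and turns \<open>w\<close> into \<open>w + x\<close>, and Eichler
  transformations with the same \<open>e\<close> multiply by adding their second parameters. A vector \<open>w\<close> with
  \<open>B w x = - Qf x\<close> makes this work in every characteristic.
\<close>

lemma eichler_is_commutator: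
  assumes e: "e \<in> carrier M" "Qf e = \<zero>" and x: "x \<in> carrier M" "B e x = \<zero>" "Qf x \<noteq> \<zero>"
    and w: "w \<in> carrier M" "B e w = \<zero>" "B w x = \<ominus> Qf x"
  defines "P \<equiv> BijGroup (carrier M)"
  shows "reflection x \<otimes>\<^bsub>P\<^esub> eichler e w \<otimes>\<^bsub>P\<^esub> inv\<^bsub>P\<^esub> (reflection x) \<otimes>\<^bsub>P\<^esub> inv\<^bsub>P\<^esub> (eichler e w) = eichler e x"
proof -
  interpret P: group P unfolding P_def by (rule group_BijGroup)
  let ?r = "reflection x"
  have u: "Qf x \<in> Units R" using x by (simp add: field_Units)
  have r: "?r \<in> isometries" by (rule reflection_isometry[OF x(1,3)])
  have E: "eichler e w \<in> isometries" "eichler e x \<in> isometries" using eichler_isometry[OF e] w x by auto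
  have rB: "?r \<in> Bij (carrier M)" and EB: "eichler e w \<in> Bij (carrier M)" "eichler e x \<in> Bij (carrier M)"
    using isometry_Bij r E by auto
  have Pc: "carrier P = Bij (carrier M)" and Pm: "\<And>f g. f \<in> Bij (carrier M) \<Longrightarrow> g \<in> Bij (carrier M) \<Longrightarrow>
      f \<otimes>\<^bsub>P\<^esub> g = compose (carrier M) f g" by (simp_all add: P_def BijGroup_def)
  have re: "?r e = e" using e x u by (simp add: reflection_def)
  have rw: "?r w = w \<oplus>\<^bsub>M\<^esub> x" using w x u by (simp add: reflection_def R.l_minus)
  have "?r (eichler e w y) = eichler e x (eichler e w (?r y))" if y: "y \<in> carrier M" for y
  proof -
    have ry: "?r y \<in> carrier M" using rB y by (auto simp: Bij_def bij_betw_def)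
    have "?r (eichler e w y) = eichler e (w \<oplus>\<^bsub>M\<^esub> x) (?r y)"
      using isometry_eichler[OF e r re w(1) y] by (simp add: rw)
    then show ?thesis using eichler_eichler[OF e x(1,2) w(1,2) ry] by simp
  qed
  then have "compose (carrier M) ?r (eichler e w) =
      compose (carrier M) (compose (carrier M) (eichler e x) (eichler e w)) ?r"
    using rB by (auto simp: compose_def fun_eq_iff Bij_def bij_betw_def)
  then have "?r \<otimes>\<^bsub>P\<^esub> eichler e w = eichler e x \<otimes>\<^bsub>P\<^esub> eichler e w \<otimes>\<^bsub>P\<^esub> ?r"
    using rB EB by (simp add: Pm compose_Bij)
  moreover have "?r \<in> carrier P" "eichler e w \<in> carrier P" "eichler e x \<in> carrier P"
    using rB EB by (simp_all add: Pc)
  ultimately show ?thesis by (simp add: P.m_assoc)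
qed

lemma eichler_fixes:
  assumes "e \<in> perp A" "x \<in> perp A" "A \<subseteq> carrier M" "a \<in> A"
  shows "eichler e x a = a"
proof -
  have M: "e \<in> carrier M" "x \<in> carrier M" "a \<in> carrier M" using assms by (auto simp: perp_def)
  moreover have "B a e = \<zero>" "B a x = \<zero>" using assms M B_sym[of a] by (auto simp: perp_def)
  ultimately show ?thesis by (simp add: eichler_def eichler_coeff_def)
qed

lemma eichler_image_fibre:
  assumes M: "p \<in> carrier M" "p' \<in> carrier M" "e \<in> carrier M"
    and c: "b \<in> carrier R" "b \<noteq> \<zero>" "g \<in> carrier R" "g' \<in> carrier R"
    and eq: "b \<odot>\<^bsub>M\<^esub> p \<oplus>\<^bsub>M\<^esub> g \<odot>\<^bsub>M\<^esub> e = b \<odot>\<^bsub>M\<^esub> p' \<oplus>\<^bsub>M\<^esub> g' \<odot>\<^bsub>M\<^esub> e"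
  shows "p = p' \<oplus>\<^bsub>M\<^esub> (inv b \<otimes> (g' \<oplus> \<ominus> g)) \<odot>\<^bsub>M\<^esub> e"
proof (rule smult_cancel[OF c(1,2)])
  have u: "b \<in> Units R" using c by (simp add: field_Units)
  let ?d = "inv b \<otimes> (g' \<oplus> \<ominus> g)"
  have d: "?d \<in> carrier R" using u c by simp
  have bd: "b \<otimes> ?d = g' \<oplus> \<ominus> g" using u c by (simp add: R.m_assoc[symmetric])
  have "b \<odot>\<^bsub>M\<^esub> p = (b \<odot>\<^bsub>M\<^esub> p \<oplus>\<^bsub>M\<^esub> g \<odot>\<^bsub>M\<^esub> e) \<oplus>\<^bsub>M\<^esub> (\<ominus> g) \<odot>\<^bsub>M\<^esub> e"
    using M c by (simp add: M.a_assoc smult_l_minus M.r_neg)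
  also have "\<dots> = b \<odot>\<^bsub>M\<^esub> p' \<oplus>\<^bsub>M\<^esub> (g' \<oplus> \<ominus> g) \<odot>\<^bsub>M\<^esub> e"
    using M c by (simp add: eq M.a_assoc smult_l_distr)
  also have "\<dots> = b \<odot>\<^bsub>M\<^esub> (p' \<oplus>\<^bsub>M\<^esub> ?d \<odot>\<^bsub>M\<^esub> e)"
    using M c(1) d smult_assoc1[OF c(1) d M(3)] unfolding bd by (simp add: smult_r_distr)
  finally show "b \<odot>\<^bsub>M\<^esub> p = b \<odot>\<^bsub>M\<^esub> (p' \<oplus>\<^bsub>M\<^esub> ?d \<odot>\<^bsub>M\<^esub> e)" .
  show "p' \<oplus>\<^bsub>M\<^esub> ?d \<odot>\<^bsub>M\<^esub> e \<in> carrier M" using M d by simp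
qed (rule M(1))

text \<open>
  Choose a singular \<open>e\<close> orthogonal to \<open>A\<close> but not to \<open>v\<close>. By the same counting as before, applied to
  \<open>insert e A\<close>, there are \<open>x0\<close> orthogonal to \<open>insert e A\<close> and \<open>t0\<close> in the corresponding part \<open>T\<close> of
  \<open>T0\<close> with \<open>B t0 x0 \<noteq> 0\<close>. For at least half of the \<open>t\<close> in \<open>T\<close> the vector \<open>x0 + t\<close> is nonsingular, and
  then the Eichler transformation with parameters \<open>e\<close> and \<open>x0 + t\<close> is a commutator of isometries: a
  multiple of \<open>t0\<close> serves as \<open>w\<close>. It moves \<open>v\<close> by \<open>B v e (x0 + t)\<close> up to a multiple of \<open>e\<close>.
\<close>

lemma card_orbit_commutators:
  assumes H: "finite H" "\<And>f g. f \<in> isometries \<Longrightarrow> g \<in> isometries \<Longrightarrow>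
      f \<otimes>\<^bsub>BijGroup (carrier M)\<^esub> g \<otimes>\<^bsub>BijGroup (carrier M)\<^esub> inv\<^bsub>BijGroup (carrier M)\<^esub> f
        \<otimes>\<^bsub>BijGroup (carrier M)\<^esub> inv\<^bsub>BijGroup (carrier M)\<^esub> g \<in> H"
    and A: "finite A" "A \<subseteq> carrier M" and v: "v \<in> carrier M - cl A"
    and big: "order R ^ (2 * (card A + 1)) < card T0"
  shows "card T0 \<le> order R ^ (card A + 3) * card {u v | u. u \<in> stab H A}"
proof -
  have q: "order R > 1" by (rule order_gt_1)
  have big': "order R ^ (2 * card A) < card T0"
    by (rule le_less_trans[OF power_increasing big]) (use q in auto)
  have vM: "v \<in> carrier M" using v by simp
  have "{e \<in> perp A. Qf e = \<zero> \<and> B v e \<noteq> \<zero>} \<noteq> {}"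
    using many_singular[OF A v big'] big by (metis card.empty le_zero_eq mult_0_right not_less0)
  then obtain e where e: "e \<in> perp A" "Qf e = \<zero>" "B v e \<noteq> \<zero>" by auto
  have eM: "e \<in> carrier M" using e by (simp add: perp_def)
  let ?A = "insert e A"
  have A': "finite ?A" "?A \<subseteq> carrier M" using A eM by auto
  have cA': "card ?A \<le> card A + 1" using card_insert_le_m1[of "card A + 1" A e] by simp
  have big'': "order R ^ (2 * card ?A) < card T0"
    by (rule le_less_trans[OF power_increasing big]) (use q cA' in auto)
  define T where "T = T0 \<inter> perp ?A"
  have T: "additive_subgroup T M" and cT: "card T0 \<le> order R ^ card ?A * card T"
    using card_le_card_inter_perp[OF T0_sub A'] by (auto simp: T_def)
  interpret T: additive_subgroup T M by (rule T)
  have TM: "T \<subseteq> carrier M" by (rule T.a_subset)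
  have finT: "finite T" using finite_subset[OF TM finite_vectors] .
  obtain t0 where t0: "t0 \<in> T" "t0 \<notin> cl ?A" using T0_not_subset_cl[OF A' big''] by (auto simp: T_def)
  have t0M: "t0 \<in> carrier M" using t0 TM by auto
  obtain x0 where x0: "x0 \<in> perp ?A" "B t0 x0 \<noteq> \<zero>" using not_in_clE[of t0 ?A] t0 t0M by auto
  have x0M: "x0 \<in> carrier M" using x0 by (simp add: perp_def)
  define N where "N = {t \<in> T. Qf x0 \<oplus> B x0 t \<noteq> \<zero>}"
  have NM: "t \<in> carrier M" "t \<in> perp ?A" "t \<in> T0" if "t \<in> N" for t
    using that TM by (auto simp: N_def T_def)
  have finN: "finite N" using finT by (simp add: N_def)
  obtain s where s: "s \<in> T" "Qf x0 \<oplus> B x0 s \<noteq> \<zero>"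
  proof (cases "Qf x0 = \<zero>")
    case True
    then show ?thesis using that[of t0] t0(1) x0(2) x0M t0M B_sym[of x0 t0] by simp
  next
    case False
    then show ?thesis using that[of "\<zero>\<^bsub>M\<^esub>"] x0M by simp
  qed
  have "card T \<le> 2 * card N"
    unfolding N_def by (rule card_le_twice_nonzero[OF T additive_on_right[OF TM x0M] _ s]) (use x0M in simp)
  let ?f = "\<lambda>t. eichler e (x0 \<oplus>\<^bsub>M\<^esub> t) v"
  have "card N \<le> order R * card (?f ` N)"
  proof (rule card_le_mult_card_image[OF finN])
    fix t assume t: "t \<in> N"
    have "{t' \<in> N. ?f t' = ?f t} \<subseteq> (\<lambda>a. t \<oplus>\<^bsub>M\<^esub> a \<odot>\<^bsub>M\<^esub> e) ` carrier R"
    proof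
      fix t' assume t': "t' \<in> {t' \<in> N. ?f t' = ?f t}"
      have M: "t \<in> carrier M" "t' \<in> carrier M" using t t' NM by auto
      let ?g = "eichler_coeff e (x0 \<oplus>\<^bsub>M\<^esub> t) v" let ?g' = "eichler_coeff e (x0 \<oplus>\<^bsub>M\<^esub> t') v"
      have g: "?g \<in> carrier R" "?g' \<in> carrier R" using M eM x0M vM by auto
      have b: "B v e \<in> carrier R" using vM eM by simp
      have "B v e \<odot>\<^bsub>M\<^esub> (x0 \<oplus>\<^bsub>M\<^esub> t') \<oplus>\<^bsub>M\<^esub> ?g' \<odot>\<^bsub>M\<^esub> e = B v e \<odot>\<^bsub>M\<^esub> (x0 \<oplus>\<^bsub>M\<^esub> t) \<oplus>\<^bsub>M\<^esub> ?g \<odot>\<^bsub>M\<^esub> e"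
        using t' M eM x0M vM g b by (simp add: eichler_def)
      then have "x0 \<oplus>\<^bsub>M\<^esub> t' = (x0 \<oplus>\<^bsub>M\<^esub> t) \<oplus>\<^bsub>M\<^esub> (inv (B v e) \<otimes> (?g \<oplus> \<ominus> ?g')) \<odot>\<^bsub>M\<^esub> e"
        using M eM x0M b e(3) g by (intro eichler_image_fibre) auto
      moreover have d: "inv (B v e) \<otimes> (?g \<oplus> \<ominus> ?g') \<in> carrier R"
        using b e(3) g by (simp add: field_Units)
      ultimately have "t' = t \<oplus>\<^bsub>M\<^esub> (inv (B v e) \<otimes> (?g \<oplus> \<ominus> ?g')) \<odot>\<^bsub>M\<^esub> e"
        using M eM x0M by (simp add: M.a_assoc)
      then show "t' \<in> (\<lambda>a. t \<oplus>\<^bsub>M\<^esub> a \<odot>\<^bsub>M\<^esub> e) ` carrier R" using d by blast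
    qed
    then show "card {t' \<in> N. ?f t' = ?f t} \<le> order R"
      unfolding order_def using surj_card_le[OF finite_scalars] by blast
  qed
  also have "card (?f ` N) \<le> card {u v | u. u \<in> stab H A}"
  proof (rule card_mono)
    show "finite {u v | u. u \<in> stab H A}" using H by (simp add: stab_def)
    show "?f ` N \<subseteq> {u v | u. u \<in> stab H A}"
    proof clarify
      fix t assume t: "t \<in> N"
      let ?x = "x0 \<oplus>\<^bsub>M\<^esub> t"
      have tM: "t \<in> carrier M" by (rule NM[OF t])
      have xM: "?x \<in> carrier M" using x0M tM by simp
      interpret pA: additive_subgroup "perp ?A" M by (rule subgroup_perp[OF A'(2)])
      have xp: "?x \<in> perp ?A" using x0(1) NM(2)[OF t] by simp
      have "B ?x e = \<zero>" using xp unfolding perp_def by blast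
      then have ex: "B e ?x = \<zero>" unfolding B_sym[OF eM xM] .
      have Qx: "Qf ?x = Qf x0 \<oplus> B x0 t" using x0M tM NM(3)[OF t] by (simp add: Qf_add T0_zero)
      then have Qx0: "Qf ?x \<noteq> \<zero>" using t by (simp add: N_def)
      define c where "c = \<ominus> (Qf ?x \<otimes> inv (B t0 x0))"
      have u: "B t0 x0 \<in> Units R" using x0(2) t0M x0M by (simp add: field_Units)
      have c: "c \<in> carrier R" using xM u by (simp add: c_def)
      have "t0 \<in> T0" "t0 \<in> perp ?A" using t0 by (auto simp: T_def)
      then have "B t0 t = \<zero>" and "B t0 e = \<zero>"
        using B_T0[OF _ NM(3)[OF t]] unfolding perp_def by blast+
      then have et0: "B e t0 = \<zero>" unfolding B_sym[OF eM t0M] by blast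
      have "B (c \<odot>\<^bsub>M\<^esub> t0) ?x = c \<otimes> B t0 x0"
        using c t0M x0M tM xM \<open>B t0 t = \<zero>\<close> by (simp add: B_smult_left B_add_right)
      also have "\<dots> = \<ominus> Qf ?x" using xM t0M x0M u by (simp add: c_def R.l_minus R.m_assoc)
      finally have Bw: "B (c \<odot>\<^bsub>M\<^esub> t0) ?x = \<ominus> Qf ?x" .
      have wM: "c \<odot>\<^bsub>M\<^esub> t0 \<in> carrier M" using c t0M by simp
      have ew: "B e (c \<odot>\<^bsub>M\<^esub> t0) = \<zero>" using et0 c eM t0M by (simp add: B_smult_right)
      have "eichler e ?x \<in> H"
        using H(2)[OF reflection_isometry[OF xM Qx0] eichler_isometry[OF eM e(2) wM ew]]
        unfolding eichler_is_commutator[OF eM e(2) xM ex Qx0 wM ew Bw] .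
      moreover have "?x \<in> perp A" using xp perp_antimono[of A ?A] by auto
      ultimately have "eichler e ?x \<in> stab H A"
        using eichler_fixes[OF e(1) _ A(2)] by (simp add: stab_def)
      then show "\<exists>u. ?f t = u v \<and> u \<in> stab H A" by blast
    qed
  qed
  finally have "card N \<le> order R * card {u v | u. u \<in> stab H A}" by simp
  then have "2 * card N \<le> order R * (order R * card {u v | u. u \<in> stab H A})"
    using q by (intro mult_le_mono) auto
  with \<open>card T \<le> 2 * card N\<close> have "card T \<le> order R * (order R * card {u v | u. u \<in> stab H A})"
    by (rule le_trans)
  moreover have "order R ^ card ?A \<le> order R ^ (card A + 1)" using cA' q by (intro power_increasing) auto
  ultimately have "order R ^ card ?A * card T \<le> order R ^ (card A + 1) * (order R * (order R * card {u v | u. u \<in> stab H A}))"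
    by (rule mult_le_mono[rotated])
  also have "\<dots> = order R ^ (card A + 3) * card {u v | u. u \<in> stab H A}"
    by (simp add: power_add power3_eq_cube)
  finally show ?thesis using cT by (rule le_trans[rotated])
qed

end

section \<open>Multiplicativity of the determinant\<close>

context cring
begin

lemma finsum_swap:
  assumes "finite I" "finite J" "\<And>i j. i \<in> I \<Longrightarrow> j \<in> J \<Longrightarrow> f i j \<in> carrier R"
  shows "(\<Oplus>i\<in>I. \<Oplus>j\<in>J. f i j) = (\<Oplus>j\<in>J. \<Oplus>i\<in>I. f i j)"
  using assms(1,3)
proof (induction I rule: finite_induct)
  case (insert x I)
  have "(\<Oplus>j\<in>J. \<Oplus>i\<in>insert x I. f i j) = (\<Oplus>j\<in>J. f x j \<oplus> (\<Oplus>i\<in>I. f i j))"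
    using insert by (intro finsum_cong') (auto intro!: finsum_closed simp: Pi_def)
  also have "\<dots> = (\<Oplus>j\<in>J. f x j) \<oplus> (\<Oplus>j\<in>J. \<Oplus>i\<in>I. f i j)"
    using insert by (intro finsum_addf) (auto intro!: finsum_closed simp: Pi_def)
  finally show ?case using insert by (simp add: Pi_def)
qed simp

lemma finsum_times:
  assumes "finite I" "finite J" "\<And>i j. i \<in> I \<Longrightarrow> j \<in> J \<Longrightarrow> f i j \<in> carrier R"
  shows "finsum R (\<lambda>(i, j). f i j) (I \<times> J) = (\<Oplus>i\<in>I. \<Oplus>j\<in>J. f i j)"
  using assms(1,3)
proof (induction I rule: finite_induct)
  case (insert x I)
  have split: "insert x I \<times> J = Pair x ` J \<union> I \<times> J" by auto
  have "finsum R (\<lambda>(i, j). f i j) (insert x I \<times> J) = finsum R (\<lambda>(i, j). f i j) (Pair x ` J) \<oplus> finsum R (\<lambda>(i, j). f i j) (I \<times> J)"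
    unfolding split using insert assms(2) by (intro finsum_Un_disjoint) (auto simp: Pi_def)
  also have "finsum R (\<lambda>(i, j). f i j) (Pair x ` J) = (\<Oplus>j\<in>J. f x j)"
    using insert by (subst finsum_reindex) (auto simp: Pi_def inj_on_def)
  finally show ?case using insert by (simp add: Pi_def)
qed simp

text \<open>
  Expanding a product of sums over all choice functions.
\<close>

lemma finprod_finsum_distrib:
  assumes "finite J" "finite K" "\<And>j k. j \<in> J \<Longrightarrow> k \<in> K \<Longrightarrow> g j k \<in> carrier R"
  shows "(\<Otimes>j\<in>J. \<Oplus>k\<in>K. g j k) = (\<Oplus>f\<in>J \<rightarrow>\<^sub>E K. \<Otimes>j\<in>J. g j (f j))"
  using assms(1,3)
proof (induction J rule: finite_induct)
  case (insert x J)
  let ?ext = "\<lambda>(y, h). h(x := y)"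
  have fin: "finite (J \<rightarrow>\<^sub>E K)" using insert assms by (intro finite_PiE) auto
  have prod_cl: "(\<Otimes>j\<in>J. g j (h j)) \<in> carrier R" if "h \<in> J \<rightarrow>\<^sub>E K" for h
    using insert that by (intro finprod_closed) auto
  have upd: "(\<Otimes>j\<in>insert x J. g j ((h(x := y)) j)) = g x y \<otimes> (\<Otimes>j\<in>J. g j (h j))"
    if "h \<in> J \<rightarrow>\<^sub>E K" "y \<in> K" for h y
  proof -
    have "(\<Otimes>j\<in>J. g j ((h(x := y)) j)) = (\<Otimes>j\<in>J. g j (h j))"
      using insert that by (intro finprod_cong') auto
    moreover have "(\<Otimes>j\<in>insert x J. g j ((h(x := y)) j)) =
        g x ((h(x := y)) x) \<otimes> (\<Otimes>j\<in>J. g j ((h(x := y)) j))"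
      using insert that by (intro finprod_insert) (auto simp: Pi_def PiE_mem)
    ultimately show ?thesis by simp
  qed
  have "(\<Oplus>f\<in>insert x J \<rightarrow>\<^sub>E K. \<Otimes>j\<in>insert x J. g j (f j)) =
      (\<Oplus>p\<in>K \<times> (J \<rightarrow>\<^sub>E K). \<Otimes>j\<in>insert x J. g j (?ext p j))"
    unfolding PiE_insert_eq using insert
    by (intro finsum_reindex inj_combinator) (auto intro!: finprod_closed simp: Pi_def dest: PiE_mem)
  also have "\<dots> = finsum R (\<lambda>(y, h). g x y \<otimes> (\<Otimes>j\<in>J. g j (h j))) (K \<times> (J \<rightarrow>\<^sub>E K))"
    using insert.prems prod_cl by (intro finsum_cong') (auto simp: upd intro!: m_closed simp del: fun_upd_apply)
  also have "\<dots> = (\<Oplus>y\<in>K. \<Oplus>h\<in>J \<rightarrow>\<^sub>E K. g x y \<otimes> (\<Otimes>j\<in>J. g j (h j)))"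
    using insert.prems prod_cl assms(2) fin by (intro finsum_times) auto
  also have "\<dots> = (\<Oplus>y\<in>K. g x y \<otimes> (\<Oplus>h\<in>J \<rightarrow>\<^sub>E K. \<Otimes>j\<in>J. g j (h j)))"
    using insert.prems prod_cl fin
    by (intro finsum_cong' finsum_rdistr[symmetric]) (auto intro!: finsum_closed m_closed)
  also have "\<dots> = (\<Oplus>y\<in>K. g x y) \<otimes> (\<Oplus>h\<in>J \<rightarrow>\<^sub>E K. \<Otimes>j\<in>J. g j (h j))"
    using insert.prems prod_cl fin assms(2)
    by (intro finsum_ldistr[symmetric]) (auto intro!: finsum_closed)
  also have "\<dots> = (\<Otimes>j\<in>insert x J. \<Oplus>k\<in>K. g j k)"
    using insert by (subst finprod_insert) (auto intro!: finsum_closed simp: Pi_def)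
  finally show ?case by simp
qed (simp add: finsum_singleton)

definition sgn_perm :: "(nat \<Rightarrow> nat) \<Rightarrow> 'a" where
  "sgn_perm p = (if evenperm p then \<one> else \<ominus> \<one>)"

definition leibniz_det :: "nat \<Rightarrow> (nat \<Rightarrow> nat \<Rightarrow> 'a) \<Rightarrow> 'a" where
  "leibniz_det n a = (\<Oplus>p\<in>{p. p permutes {..<n}}. sgn_perm p \<otimes> (\<Otimes>j\<in>{..<n}. a (p j) j))"

lemma sgn_perm_closed [simp]: "sgn_perm p \<in> carrier R"
  by (simp add: sgn_perm_def)

lemma sgn_perm_comp:
  assumes "p permutes {..<n}" "s permutes {..<n}"
  shows "sgn_perm (p \<circ> s) = sgn_perm p \<otimes> sgn_perm s"
  using evenperm_comp[of p s] assms permutation_permutes by (auto simp: sgn_perm_def l_minus r_minus)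

lemma finprod_permute:
  assumes "s permutes {..<n}" "\<And>j. j < n \<Longrightarrow> f j \<in> carrier R"
  shows "(\<Otimes>j\<in>{..<n}. f (s j)) = (\<Otimes>j\<in>{..<n}. f j)"
  using finprod_reindex[of f s "{..<n}"] permutes_image[OF assms(1)] permutes_inj_on[OF assms(1)] assms(2)
  by auto

lemma finite_perms: "finite {p. p permutes {..<n::nat}}"
  by (rule finite_permutations) simp

lemma permutes_lt: "p permutes {..<n} \<Longrightarrow> j < n \<Longrightarrow> p j < (n :: nat)"
  using permutes_in_image[of p "{..<n}" j] by simp

text \<open>
  Composition with the transposition of \<open>x\<close> and \<open>y\<close> matches even with odd permutations and leaves the
  product unchanged. Pairing the terms instead of comparing the sum with its negative is valid in
  characteristic 2 too.
\<close>

lemma leibniz_repeated_column: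
  assumes a: "\<And>i j. i < n \<Longrightarrow> j < n \<Longrightarrow> a i j \<in> carrier R" and f: "f \<in> {..<n} \<rightarrow> {..<n}"
    and xy: "x < n" "y < n" "x \<noteq> y" "f x = f y"
  shows "(\<Oplus>p\<in>{p. p permutes {..<n}}. sgn_perm p \<otimes> (\<Otimes>j\<in>{..<n}. a (p j) (f j))) = \<zero>"
proof -
  define t where "t p = (\<Otimes>j\<in>{..<n}. a (p j) (f j))" for p
  define s where "s = Transposition.transpose x y"
  let ?P = "{p. p permutes {..<n}}"
  let ?E = "{p \<in> ?P. evenperm p}" let ?O = "{p \<in> ?P. \<not> evenperm p}"
  have s: "s permutes {..<n}" unfolding s_def using xy by (intro permutes_swap_id) auto
  have ss: "s \<circ> s = id" unfolding s_def by simp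
  have odd: "\<not> evenperm s" unfolding s_def using xy by (simp add: evenperm_swap)
  have tc: "t p \<in> carrier R" if "p \<in> ?P" for p
    unfolding t_def using that a f permutes_lt by (intro finprod_closed) (auto simp: Pi_def)
  have ts: "t (p \<circ> s) = t p" if p: "p \<in> ?P" for p
  proof -
    have fs: "f (s j) = f j" for j using xy by (auto simp: s_def Transposition.transpose_def)
    have "t (p \<circ> s) = (\<Otimes>j\<in>{..<n}. a (p (s j)) (f (s j)))" unfolding t_def by (simp add: fs)
    also have "\<dots> = t p" unfolding t_def
      by (rule finprod_permute[OF s]) (use p a f permutes_lt in \<open>auto simp: Pi_def\<close>)
    finally show ?thesis .
  qed
  have even_s: "evenperm (p \<circ> s) \<longleftrightarrow> \<not> evenperm p" if "p \<in> ?P" for p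
    using evenperm_comp[of p s] that s odd permutation_permutes by auto
  have comp: "p \<circ> s \<in> ?P" if "p \<in> ?P" for p using that s permutes_compose by auto
  have O: "?O = (\<lambda>p. p \<circ> s) ` ?E"
  proof
    show "?O \<subseteq> (\<lambda>p. p \<circ> s) ` ?E"
    proof
      fix p assume p: "p \<in> ?O"
      have "p = (p \<circ> s) \<circ> s" by (simp add: comp_assoc ss)
      moreover have "p \<circ> s \<in> ?E" using p comp[of p] even_s[of p] by auto
      ultimately show "p \<in> (\<lambda>p. p \<circ> s) ` ?E" by (rule image_eqI)
    qed
  qed (use comp even_s in auto)
  have inj: "inj_on (\<lambda>p. p \<circ> s) ?E" by (rule inj_onI) (metis comp_assoc comp_id ss)
  have finE: "finite ?E" "finite ?O" using finite_perms by auto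
  have "(\<Oplus>p\<in>?P. sgn_perm p \<otimes> t p) = (\<Oplus>p\<in>?E \<union> ?O. sgn_perm p \<otimes> t p)"
    by (rule arg_cong[where f = "finsum R (\<lambda>p. sgn_perm p \<otimes> t p)"]) auto
  also have "\<dots> = (\<Oplus>p\<in>?E. sgn_perm p \<otimes> t p) \<oplus> (\<Oplus>p\<in>?O. sgn_perm p \<otimes> t p)"
    using finE tc by (intro finsum_Un_disjoint) auto
  also have "(\<Oplus>p\<in>?O. sgn_perm p \<otimes> t p) = (\<Oplus>p\<in>?E. sgn_perm (p \<circ> s) \<otimes> t (p \<circ> s))"
    unfolding O using tc comp by (intro finsum_reindex inj) auto
  also have "\<dots> = (\<Oplus>p\<in>?E. \<ominus> \<one> \<otimes> t p)"
    using even_s ts tc by (intro finsum_cong') (auto simp: sgn_perm_def)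
  also have "\<dots> = \<ominus> \<one> \<otimes> (\<Oplus>p\<in>?E. t p)"
    using finE tc by (intro finsum_rdistr[symmetric]) auto
  also have "(\<Oplus>p\<in>?E. sgn_perm p \<otimes> t p) = (\<Oplus>p\<in>?E. t p)"
    using tc by (intro finsum_cong') (auto simp: sgn_perm_def)
  also have "(\<Oplus>p\<in>?E. t p) \<oplus> \<ominus> \<one> \<otimes> (\<Oplus>p\<in>?E. t p) = \<zero>"
    using finsum_closed[of t ?E] tc by (simp add: l_minus r_neg)
  finally show ?thesis by (simp add: t_def)
qed

lemma leibniz_permuted_columns:
  assumes a: "\<And>i j. i < n \<Longrightarrow> j < n \<Longrightarrow> a i j \<in> carrier R" and s: "s permutes {..<n}"
  shows "(\<Oplus>p\<in>{p. p permutes {..<n}}. sgn_perm p \<otimes> (\<Otimes>j\<in>{..<n}. a (p j) (s j))) = sgn_perm s \<otimes> leibniz_det n a"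
proof -
  let ?P = "{p. p permutes {..<n}}"
  have tc: "(\<Otimes>j\<in>{..<n}. a (p j) (g j)) \<in> carrier R" if "p \<in> ?P" "g \<in> ?P" for p g
    using that a permutes_lt by (intro finprod_closed) (auto simp: Pi_def)
  have id: "id \<in> ?P" by (simp add: permutes_id)
  have s': "inv_into UNIV s permutes {..<n}" by (rule permutes_inv[OF s])
  have P: "?P = (\<lambda>p. p \<circ> s) ` ?P"
  proof
    show "?P \<subseteq> (\<lambda>p. p \<circ> s) ` ?P"
    proof
      fix p assume p: "p \<in> ?P"
      have "p = (p \<circ> inv_into UNIV s) \<circ> s" using s by (simp add: comp_assoc permutes_inv_o)
      moreover have "p \<circ> inv_into UNIV s \<in> ?P" using p s' permutes_compose by auto
      ultimately show "p \<in> (\<lambda>p. p \<circ> s) ` ?P" by (rule image_eqI)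
    qed
  qed (use s permutes_compose in auto)
  have inj: "inj_on (\<lambda>p. p \<circ> s) ?P"
    by (rule inj_onI) (metis comp_assoc comp_id permutes_inv_o(1) s)
  have "(\<Oplus>p\<in>?P. sgn_perm p \<otimes> (\<Otimes>j\<in>{..<n}. a (p j) (s j))) =
      (\<Oplus>p\<in>(\<lambda>p. p \<circ> s) ` ?P. sgn_perm p \<otimes> (\<Otimes>j\<in>{..<n}. a (p j) (s j)))"
    using P by simp
  also have "\<dots> = (\<Oplus>p\<in>?P. sgn_perm (p \<circ> s) \<otimes> (\<Otimes>j\<in>{..<n}. a ((p \<circ> s) j) (s j)))"
    using tc s P by (intro finsum_reindex inj) auto
  also have "\<dots> = (\<Oplus>p\<in>?P. sgn_perm s \<otimes> (sgn_perm p \<otimes> (\<Otimes>j\<in>{..<n}. a (p j) j)))"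
  proof (rule finsum_cong')
    fix p assume p: "p \<in> ?P"
    have "(\<Otimes>j\<in>{..<n}. a (p (s j)) (s j)) = (\<Otimes>j\<in>{..<n}. a (p j) j)"
      by (rule finprod_permute[OF s, of "\<lambda>j. a (p j) j"]) (use p a permutes_lt in auto)
    then show "sgn_perm (p \<circ> s) \<otimes> (\<Otimes>j\<in>{..<n}. a ((p \<circ> s) j) (s j)) =
        sgn_perm s \<otimes> (sgn_perm p \<otimes> (\<Otimes>j\<in>{..<n}. a (p j) j))"
      using p s tc[OF p id] sgn_perm_comp[of p n s] by (simp add: m_ac)
  qed (use tc[OF _ id] in auto)
  also have "\<dots> = sgn_perm s \<otimes> leibniz_det n a"
    unfolding leibniz_det_def using tc[OF _ id] finite_perms by (intro finsum_rdistr[symmetric]) auto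
  finally show ?thesis .
qed

text \<open>
  Expand each column of the product matrix. The choice functions that are not injective contribute
  nothing, as they repeat a column of \<open>a\<close>, and the others are permutations.
\<close>

theorem leibniz_det_mult:
  assumes a: "\<And>i j. i < n \<Longrightarrow> j < n \<Longrightarrow> a i j \<in> carrier R"
    and b: "\<And>i j. i < n \<Longrightarrow> j < n \<Longrightarrow> b i j \<in> carrier R"
  shows "leibniz_det n (\<lambda>i j. \<Oplus>k\<in>{..<n}. a i k \<otimes> b k j) = leibniz_det n a \<otimes> leibniz_det n b"
proof -
  let ?N = "{..<n}" let ?P = "{p. p permutes ?N}" let ?F = "?N \<rightarrow>\<^sub>E ?N"
  define A where "A p f = (\<Otimes>j\<in>?N. a (p j) (f j))" for p f :: "nat \<Rightarrow> nat"
  define C where "C f = (\<Otimes>j\<in>?N. b (f j) j)" for f :: "nat \<Rightarrow> nat"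
  define D where "D f = (\<Oplus>p\<in>?P. sgn_perm p \<otimes> A p f)" for f
  have finF: "finite ?F" by (intro finite_PiE) auto
  have Ac: "A p f \<in> carrier R" if "p \<in> ?P" "f \<in> ?N \<rightarrow> ?N" for p f
    unfolding A_def using that a permutes_lt by (intro finprod_closed) (auto simp: Pi_def)
  have Cc: "C f \<in> carrier R" if "f \<in> ?N \<rightarrow> ?N" for f
    unfolding C_def using that b by (intro finprod_closed) (auto simp: Pi_def)
  have Dc: "D f \<in> carrier R" if "f \<in> ?N \<rightarrow> ?N" for f
    unfolding D_def using that Ac by (intro finsum_closed) auto
  have FP: "f \<in> ?N \<rightarrow> ?N" if "f \<in> ?F" for f using that by auto
  have PN: "p \<in> ?N \<rightarrow> ?N" if "p \<in> ?P" for p using that permutes_lt by auto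
  have expand: "(\<Otimes>j\<in>?N. \<Oplus>k\<in>?N. a (p j) k \<otimes> b k j) = (\<Oplus>f\<in>?F. A p f \<otimes> C f)" if p: "p \<in> ?P" for p
  proof -
    have "(\<Otimes>j\<in>?N. \<Oplus>k\<in>?N. a (p j) k \<otimes> b k j) = (\<Oplus>f\<in>?F. \<Otimes>j\<in>?N. a (p j) (f j) \<otimes> b (f j) j)"
      by (rule finprod_finsum_distrib) (use p a b permutes_lt in auto)
    also have "\<dots> = (\<Oplus>f\<in>?F. A p f \<otimes> C f)"
    proof (rule finsum_cong')
      fix f assume f: "f \<in> ?F"
      show "(\<Otimes>j\<in>?N. a (p j) (f j) \<otimes> b (f j) j) = A p f \<otimes> C f"
        unfolding A_def C_def using FP[OF f] p a b permutes_lt by (intro finprod_multf) (auto simp: Pi_def)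
    qed (use p Ac Cc FP in auto)
    finally show ?thesis .
  qed
  have "leibniz_det n (\<lambda>i j. \<Oplus>k\<in>?N. a i k \<otimes> b k j) = (\<Oplus>p\<in>?P. \<Oplus>f\<in>?F. sgn_perm p \<otimes> A p f \<otimes> C f)"
    unfolding leibniz_det_def
  proof (rule finsum_cong')
    fix p assume p: "p \<in> ?P"
    have "sgn_perm p \<otimes> (\<Oplus>f\<in>?F. A p f \<otimes> C f) = (\<Oplus>f\<in>?F. sgn_perm p \<otimes> (A p f \<otimes> C f))"
      using p Ac Cc FP finF by (intro finsum_rdistr) auto
    also have "\<dots> = (\<Oplus>f\<in>?F. sgn_perm p \<otimes> A p f \<otimes> C f)"
      using p Ac Cc FP by (intro finsum_cong') (auto simp: m_assoc)
    finally show "sgn_perm p \<otimes> (\<Otimes>j\<in>?N. \<Oplus>k\<in>?N. a (p j) k \<otimes> b k j) = (\<Oplus>f\<in>?F. sgn_perm p \<otimes> A p f \<otimes> C f)"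
      using expand[OF p] by simp
  qed (use Ac Cc FP in \<open>auto intro!: finsum_closed m_closed\<close>)
  also have "\<dots> = (\<Oplus>f\<in>?F. \<Oplus>p\<in>?P. sgn_perm p \<otimes> A p f \<otimes> C f)"
    using finite_perms finF Ac Cc FP by (intro finsum_swap) auto
  also have "\<dots> = (\<Oplus>f\<in>?F. D f \<otimes> C f)"
    unfolding D_def using finite_perms Ac Cc FP
    by (intro finsum_cong' finsum_ldistr[symmetric]) (auto intro!: finsum_closed m_closed)
  also have "\<dots> = (\<Oplus>f\<in>(\<lambda>p. restrict p ?N) ` ?P. D f \<otimes> C f)"
  proof (rule add.finprod_mono_neutral_cong_right[OF finF])
    show "(\<lambda>p. restrict p ?N) ` ?P \<subseteq> ?F"
      by (auto simp: permutes_lt PiE_def extensional_def)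
    show "D f \<otimes> C f = \<zero>" if f: "f \<in> ?F - (\<lambda>p. restrict p ?N) ` ?P" for f
    proof -
      have "\<not> inj_on f ?N"
      proof
        assume inj: "inj_on f ?N"
        have "f ` ?N \<subseteq> ?N" using f by auto
        then have "f ` ?N = ?N" using inj by (simp add: endo_inj_surj)
        then have "bij_betw f ?N ?N" using inj by (simp add: bij_betw_def)
        then have "(\<lambda>x. if x \<in> ?N then f x else x) permutes ?N"
          by (intro bij_imp_permutes) (subst bij_betw_cong[where g = f], auto)
        moreover have "f = restrict (\<lambda>x. if x \<in> ?N then f x else x) ?N"
          using f by (auto simp: fun_eq_iff PiE_def extensional_def)
        ultimately show False using f by auto
      qed
      then obtain x y where xy: "x < n" "y < n" "x \<noteq> y" "f x = f y" by (auto simp: inj_on_def)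
      have "D f = \<zero>" unfolding D_def A_def
        by (rule leibniz_repeated_column[OF _ _ xy]) (use a f in auto)
      then show ?thesis using Cc FP f by simp
    qed
  qed (use Dc Cc FP in auto)
  also have "\<dots> = (\<Oplus>s\<in>?P. D (restrict s ?N) \<otimes> C (restrict s ?N))"
  proof (rule finsum_reindex)
    show "inj_on (\<lambda>p. restrict p ?N) ?P"
    proof (rule inj_onI)
      fix p s assume "p \<in> ?P" "s \<in> ?P" and eq: "restrict p ?N = restrict s ?N"
      then show "p = s" by (intro ext) (metis lessThan_iff mem_Collect_eq permutes_not_in restrict_apply')
    qed
  qed (use Dc Cc in \<open>auto intro!: m_closed simp: permutes_lt\<close>)
  also have "\<dots> = (\<Oplus>s\<in>?P. leibniz_det n a \<otimes> (sgn_perm s \<otimes> C s))"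
  proof (rule finsum_cong')
    have detc: "leibniz_det n a \<in> carrier R"
      using Dc[of "\<lambda>x. x"] by (simp add: D_def A_def leibniz_det_def)
    fix s assume s: "s \<in> ?P"
    have "A p (restrict s ?N) = A p s" if "p \<in> ?P" for p unfolding A_def using that s a permutes_lt
      by (intro finprod_cong') (auto simp: Pi_def)
    then have "D (restrict s ?N) = D s" unfolding D_def using Ac[OF _ PN[OF s]]
      by (intro finsum_cong') auto
    also have "D s = sgn_perm s \<otimes> leibniz_det n a"
      unfolding D_def A_def using s a by (intro leibniz_permuted_columns) auto
    finally have "D (restrict s ?N) = sgn_perm s \<otimes> leibniz_det n a" .
    moreover have "C (restrict s ?N) = C s" unfolding C_def using s b permutes_lt
      by (intro finprod_cong') (auto simp: Pi_def)
    ultimately show "D (restrict s ?N) \<otimes> C (restrict s ?N) = leibniz_det n a \<otimes> (sgn_perm s \<otimes> C s)"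
      using detc Cc[OF PN[OF s]] by (simp add: m_ac)
  qed (use Dc[of "\<lambda>x. x"] Cc PN in \<open>auto simp: D_def A_def leibniz_det_def\<close>)
  also have "\<dots> = leibniz_det n a \<otimes> (\<Oplus>s\<in>?P. sgn_perm s \<otimes> C s)"
    using Dc[of "\<lambda>x. x"] Cc PN finite_perms
    by (intro finsum_rdistr[symmetric]) (auto simp: D_def A_def leibniz_det_def)
  finally show ?thesis by (simp add: leibniz_det_def C_def)
qed

end

section \<open>Linear groups in coordinates\<close>

text \<open>
  In a finite group, inverses are powers.
\<close>

lemma (in group) subgroup_if_finite_closed:
  assumes fin: "finite (carrier G)" and H: "H \<subseteq> carrier G" "\<one> \<in> H"
    and mult: "\<And>x y. x \<in> H \<Longrightarrow> y \<in> H \<Longrightarrow> x \<otimes> y \<in> H"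
  shows "subgroup H G"
proof (rule subgroupI)
  fix x assume x: "x \<in> H"
  then have xG: "x \<in> carrier G" using H by auto
  have pow: "x [^] m \<in> H" for m :: nat by (induction m) (use x H mult in auto)
  have "order G > 0" using fin xG by (auto simp: order_def card_gt_0_iff)
  then obtain m where m: "order G = Suc m" by (cases "order G") auto
  have "x [^] Suc m = \<one>" using pow_order_eq_1[OF xG] m by simp
  then have "inv x = x [^] m" using xG by (intro inv_equality) auto
  then show "inv x \<in> H" using pow by simp
qed (use H mult in auto)

text \<open>
  Fermat's little theorem for finite fields.
\<close>

lemma (in field) pow_order_eq_self:
  assumes "finite (carrier R)" "x \<in> carrier R"
  shows "x [^] order R = x"
proof -
  have pos: "order R > 0" using assms by (auto simp: order_def card_gt_0_iff)
  then obtain m where m: "order R = Suc m" by (cases "order R") auto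
  show ?thesis
  proof (cases "x = \<zero>")
    case True
    then show ?thesis by (simp add: m)
  next
    case False
    interpret U: group "Multiplicative_Group.mult_of R" by (rule field_mult_group)
    have "x [^]\<^bsub>Multiplicative_Group.mult_of R\<^esub> order (Multiplicative_Group.mult_of R) = \<one>\<^bsub>Multiplicative_Group.mult_of R\<^esub>"
      using False assms by (intro U.pow_order_eq_1) simp
    moreover have "order (Multiplicative_Group.mult_of R) = m" using assms m by (simp add: order_mult_of)
    ultimately have "x [^] m = \<one>" by (simp add: Multiplicative_Group.nat_pow_mult_of)
    then show ?thesis using assms m by simp
  qed
qed

context cring
begin

lemma leibniz_det_identity: "leibniz_det n (\<lambda>i j. if i = j then \<one> else \<zero>) = \<one>"
proof -
  let ?a = "\<lambda>i j :: nat. if i = j then \<one> else \<zero>"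
  let ?P = "{p. p permutes {..<n}}"
  have "(\<Otimes>j\<in>{..<n}. ?a (p j) j) = \<zero>" if p: "p \<in> ?P" "p \<noteq> id" for p
  proof -
    obtain j where j: "p j \<noteq> j" using p(2) by (auto simp: fun_eq_iff)
    then have jn: "j < n" using p(1) permutes_not_in by (metis lessThan_iff mem_Collect_eq)
    have "(\<Otimes>j\<in>insert j ({..<n} - {j}). ?a (p j) j) = ?a (p j) j \<otimes> (\<Otimes>j\<in>{..<n} - {j}. ?a (p j) j)"
      by (intro finprod_insert) auto
    moreover have "insert j ({..<n} - {j}) = {..<n}" using jn by auto
    ultimately show ?thesis using j by (simp add: finprod_closed Pi_def)
  qed
  then have "leibniz_det n ?a = (\<Oplus>p\<in>{id}. sgn_perm p \<otimes> (\<Otimes>j\<in>{..<n}. ?a (p j) j))"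
    unfolding leibniz_det_def using finite_perms
    by (intro add.finprod_mono_neutral_cong_right) (auto simp: permutes_id intro!: finprod_closed)
  also have "\<dots> = \<one>" by (simp add: sgn_perm_def)
  finally show ?thesis .
qed

end

definition vec_module :: "('a, 'b) ring_scheme \<Rightarrow> nat \<Rightarrow> ('a, nat \<Rightarrow> 'a) module" where
  "vec_module F n = \<lparr>carrier = nat_module F n, mult = (\<lambda>_ _. undefined), one = undefined,
     ring.zero = (\<lambda>i\<in>{..<n}. \<zero>\<^bsub>F\<^esub>), ring.add = vadd F n, smult = vsmult F n\<rparr>"

lemma vec_module_simps [simp]:
  "carrier (vec_module F n) = nat_module F n" "ring.add (vec_module F n) = vadd F n"
  "smult (vec_module F n) = vsmult F n" "ring.zero (vec_module F n) = (\<lambda>i\<in>{..<n}. \<zero>\<^bsub>F\<^esub>)"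
  by (simp_all add: vec_module_def)

lemma linear_bijections_vec_module: "linear_bijections F (vec_module F n) = GL F n"
  by (simp add: linear_bijections_def GL_def)

locale coordinate_space = field F for F (structure) + fixes n :: nat
  assumes finite_field: "finite (carrier F)"
begin

lemma vec_in [simp]: "v \<in> nat_module F n \<Longrightarrow> i < n \<Longrightarrow> v i \<in> carrier F"
  by (auto simp: nat_module_def)

lemma vec_eqI: "v \<in> nat_module F n \<Longrightarrow> w \<in> nat_module F n \<Longrightarrow> (\<And>i. i < n \<Longrightarrow> v i = w i) \<Longrightarrow> v = w"
  unfolding nat_module_def by (rule PiE_ext) auto

lemma vec_ops_closed [simp]:
  "v \<in> nat_module F n \<Longrightarrow> w \<in> nat_module F n \<Longrightarrow> vadd F n v w \<in> nat_module F n"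
  "a \<in> carrier F \<Longrightarrow> v \<in> nat_module F n \<Longrightarrow> vsmult F n a v \<in> nat_module F n"
  "(\<lambda>i\<in>{..<n}. \<zero>) \<in> nat_module F n"
  "unit_vec F n j \<in> nat_module F n"
  by (auto simp: nat_module_def vadd_def vsmult_def unit_vec_def)

lemma vec_ops_nth [simp]:
  "i < n \<Longrightarrow> vadd F n v w i = v i \<oplus> w i" "i < n \<Longrightarrow> vsmult F n a v i = a \<otimes> v i"
  "i < n \<Longrightarrow> unit_vec F n j i = (if i = j then \<one> else \<zero>)"
  by (simp_all add: vadd_def vsmult_def unit_vec_def)

lemma module_vec_module: "module F (vec_module F n)"
proof (rule moduleI)
  show "abelian_group (vec_module F n)"
  proof (rule abelian_groupI)
    fix v assume v: "v \<in> carrier (vec_module F n)"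
    have "(\<lambda>i\<in>{..<n}. \<ominus> v i) \<in> carrier (vec_module F n)" using v by (auto simp: nat_module_def)
    moreover have "(\<lambda>i\<in>{..<n}. \<ominus> v i) \<oplus>\<^bsub>vec_module F n\<^esub> v = \<zero>\<^bsub>vec_module F n\<^esub>"
      using v by (auto simp: vadd_def fun_eq_iff l_neg)
    ultimately show "\<exists>w\<in>carrier (vec_module F n). w \<oplus>\<^bsub>vec_module F n\<^esub> v = \<zero>\<^bsub>vec_module F n\<^esub>" by blast
  qed (auto intro!: vec_eqI simp: a_ac)
qed (auto intro!: vec_eqI is_cring simp: l_distr r_distr m_assoc)

lemma finite_nat_module: "finite (nat_module F n)"
  unfolding nat_module_def using finite_field by (intro finite_PiE) auto

lemma card_nat_module: "card (nat_module F n) = order F ^ n"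
  unfolding nat_module_def by (simp add: card_PiE order_def)

lemma finite_Bij_nat_module: "finite (Bij (nat_module F n))"
proof (rule finite_subset)
  show "Bij (nat_module F n) \<subseteq> nat_module F n \<rightarrow>\<^sub>E nat_module F n"
    by (auto simp: Bij_def bij_betw_def PiE_def)
qed (use finite_nat_module in \<open>intro finite_PiE\<close>)

abbreviation Perm where "Perm \<equiv> BijGroup (nat_module F n)"

lemma carrier_Perm: "carrier Perm = Bij (nat_module F n)"
  by (simp add: BijGroup_def)

lemma mult_Perm: "f \<in> Bij (nat_module F n) \<Longrightarrow> g \<in> Bij (nat_module F n) \<Longrightarrow> f \<otimes>\<^bsub>Perm\<^esub> g = compose (nat_module F n) f g"
  by (simp add: BijGroup_def)

lemma one_Perm: "\<one>\<^bsub>Perm\<^esub> = (\<lambda>v\<in>nat_module F n. v)"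
  by (simp add: BijGroup_def)

lemma Bij_closed: "f \<in> Bij (nat_module F n) \<Longrightarrow> v \<in> nat_module F n \<Longrightarrow> f v \<in> nat_module F n"
  by (auto simp: Bij_def bij_betw_def)

lemma GL_closed: "f \<in> GL F n \<Longrightarrow> v \<in> nat_module F n \<Longrightarrow> f v \<in> nat_module F n"
  by (auto simp: GL_def intro: Bij_closed)

lemma subgroup_of_GL:
  assumes "\<And>f g. f \<in> GL F n \<Longrightarrow> g \<in> GL F n \<Longrightarrow> P f \<Longrightarrow> P g \<Longrightarrow> P (compose (nat_module F n) f g)"
    and "P (\<lambda>v\<in>nat_module F n. v)"
  shows "subgroup {f \<in> GL F n. P f} Perm"
proof -
  interpret P: group Perm by (rule group_BijGroup)
  show ?thesis
  proof (rule P.subgroup_if_finite_closed)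
    show "finite (carrier Perm)" using finite_Bij_nat_module by (simp add: carrier_Perm)
    show "{f \<in> GL F n. P f} \<subseteq> carrier Perm" by (auto simp: carrier_Perm GL_def)
    show "\<one>\<^bsub>Perm\<^esub> \<in> {f \<in> GL F n. P f}" using assms(2) id_Bij by (auto simp: one_Perm GL_def)
    fix f g assume fg: "f \<in> {f \<in> GL F n. P f}" "g \<in> {f \<in> GL F n. P f}"
    then have B: "f \<in> Bij (nat_module F n)" "g \<in> Bij (nat_module F n)" by (auto simp: GL_def)
    have "compose (nat_module F n) f g \<in> GL F n"
      using fg compose_Bij[OF B] Bij_closed[OF B(2)] by (auto simp: GL_def compose_def)
    then show "f \<otimes>\<^bsub>Perm\<^esub> g \<in> {f \<in> GL F n. P f}" using fg assms(1) by (simp add: mult_Perm[OF B])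
  qed
qed

text \<open>
  Linear maps are determined by the images of the unit vectors; by induction on the number of coordinates
  that have been taken into account.
\<close>

lemma linear_expansion:
  assumes f: "f \<in> GL F n" and v: "v \<in> nat_module F n" and r: "r < n"
  shows "f v r = (\<Oplus>i\<in>{..<n}. v i \<otimes> f (unit_vec F n i) r)"
proof -
  define c where "c m = (\<lambda>i\<in>{..<n}. if i < m then v i else \<zero>)" for m
  have cV: "c m \<in> nat_module F n" for m using v by (auto simp: c_def nat_module_def)
  have fc: "f w r \<in> carrier F" if "w \<in> nat_module F n" for w using GL_closed[OF f that] r by simp
  have "m \<le> n \<Longrightarrow> f (c m) r = (\<Oplus>i\<in>{..<m}. v i \<otimes> f (unit_vec F n i) r)" for m
  proof (induction m)
    case 0
    have "c 0 = vsmult F n \<zero> (c 0)" by (rule vec_eqI) (use cV in \<open>auto simp: c_def\<close>)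
    moreover have "f (vsmult F n \<zero> (c 0)) = vsmult F n \<zero> (f (c 0))" using f cV by (simp add: GL_def)
    ultimately have "f (c 0) = vsmult F n \<zero> (f (c 0))" by simp
    then have "f (c 0) r = \<zero> \<otimes> f (c 0) r" using r by (metis vec_ops_nth(2))
    then show ?case using fc[OF cV] by simp
  next
    case (Suc m)
    then have m: "m < n" by simp
    have "c (Suc m) = vadd F n (c m) (vsmult F n (v m) (unit_vec F n m))"
      by (rule vec_eqI[OF cV]) (use cV[of m] v m in \<open>auto simp: c_def less_Suc_eq\<close>)
    then have "f (c (Suc m)) = vadd F n (f (c m)) (vsmult F n (v m) (f (unit_vec F n m)))"
      using f cV v m by (simp add: GL_def)
    then have "f (c (Suc m)) r = f (c m) r \<oplus> v m \<otimes> f (unit_vec F n m) r" using r by simp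
    also have "\<dots> = (\<Oplus>i\<in>{..<Suc m}. v i \<otimes> f (unit_vec F n i) r)"
      using Suc v fc m by (subst lessThan_Suc, subst finsum_insert) (auto simp: a_comm Pi_def)
    finally show ?case .
  qed
  moreover have "c n = v" by (rule vec_eqI) (use cV v in \<open>auto simp: c_def\<close>)
  ultimately show ?thesis by auto
qed

lemma card_GL_le: "finite (GL F n) \<and> card (GL F n) \<le> order F ^ (n * n)"
proof
  have sub: "GL F n \<subseteq> Bij (nat_module F n)" by (auto simp: GL_def)
  show "finite (GL F n)" by (rule finite_subset[OF sub finite_Bij_nat_module])
  have "card (GL F n) \<le> card ({..<n} \<rightarrow>\<^sub>E nat_module F n)"
  proof (rule card_inj_on_le[where f = "\<lambda>f. \<lambda>j\<in>{..<n}. f (unit_vec F n j)"])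
    show "inj_on (\<lambda>f. \<lambda>j\<in>{..<n}. f (unit_vec F n j)) (GL F n)"
    proof (rule inj_onI)
      fix f g assume f: "f \<in> GL F n" and g: "g \<in> GL F n"
        and eq: "(\<lambda>j\<in>{..<n}. f (unit_vec F n j)) = (\<lambda>j\<in>{..<n}. g (unit_vec F n j))"
      have e: "f (unit_vec F n j) = g (unit_vec F n j)" if "j < n" for j
        using fun_cong[OF eq, of j] that by simp
      have "f v = g v" if v: "v \<in> nat_module F n" for v
      proof (rule vec_eqI)
        fix r assume r: "r < n"
        show "f v r = g v r" unfolding linear_expansion[OF f v r] linear_expansion[OF g v r]
          using e v GL_closed[OF g] r by (intro finsum_cong') auto
      qed (use GL_closed f g v in auto)
      moreover have "f \<in> extensional (nat_module F n)" "g \<in> extensional (nat_module F n)"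
        using f g by (auto simp: GL_def Bij_def)
      ultimately show "f = g" by (metis extensionalityI)
    qed
    show "(\<lambda>f. \<lambda>j\<in>{..<n}. f (unit_vec F n j)) ` GL F n \<subseteq> {..<n} \<rightarrow>\<^sub>E nat_module F n"
      using GL_closed by auto
    show "finite ({..<n} \<rightarrow>\<^sub>E nat_module F n)" using finite_nat_module by (intro finite_PiE) auto
  qed
  also have "\<dots> = order F ^ (n * n)" by (simp add: card_PiE card_nat_module power_mult)
  finally show "card (GL F n) \<le> order F ^ (n * n)" .
qed

lemma op_det_eq: "op_det F n f = leibniz_det n (\<lambda>i j. f (unit_vec F n j) i)"
  by (simp add: op_det_def leibniz_det_def sgn_perm_def)

lemma op_det_closed: "f \<in> GL F n \<Longrightarrow> op_det F n f \<in> carrier F"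
  unfolding op_det_eq leibniz_det_def
  using GL_closed permutes_lt by (intro finsum_closed) (auto intro!: m_closed finprod_closed)

lemma leibniz_det_cong:
  assumes "\<And>i j. i < n \<Longrightarrow> j < n \<Longrightarrow> a i j = b i j" "\<And>i j. i < n \<Longrightarrow> j < n \<Longrightarrow> b i j \<in> carrier F"
  shows "leibniz_det n a = leibniz_det n b"
proof -
  have "(\<Otimes>j\<in>{..<n}. a (p j) j) = (\<Otimes>j\<in>{..<n}. b (p j) j)" if "p permutes {..<n}" for p
    using that assms permutes_lt by (intro finprod_cong') auto
  moreover have "(\<Otimes>j\<in>{..<n}. b (p j) j) \<in> carrier F" if "p permutes {..<n}" for p
    using that assms permutes_lt by (intro finprod_closed) auto
  ultimately show ?thesis unfolding leibniz_det_def by (intro finsum_cong') auto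
qed

lemma op_det_one: "op_det F n (\<lambda>v\<in>nat_module F n. v) = \<one>"
proof -
  have "op_det F n (\<lambda>v\<in>nat_module F n. v) = leibniz_det n (\<lambda>i j. if i = j then \<one> else \<zero>)"
    unfolding op_det_eq by (rule leibniz_det_cong) auto
  then show ?thesis by (simp add: leibniz_det_identity)
qed

lemma op_det_compose:
  assumes f: "f \<in> GL F n" and g: "g \<in> GL F n"
  shows "op_det F n (compose (nat_module F n) f g) = op_det F n f \<otimes> op_det F n g"
proof -
  let ?e = "unit_vec F n"
  have fc: "f (?e j) i \<in> carrier F" "g (?e j) i \<in> carrier F" if "i < n" for i j
    using GL_closed f g that by auto
  have "op_det F n (compose (nat_module F n) f g) =
      leibniz_det n (\<lambda>i j. \<Oplus>k\<in>{..<n}. f (?e k) i \<otimes> g (?e j) k)"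
    unfolding op_det_eq
  proof (rule leibniz_det_cong)
    fix i j assume ij: "i < n" "j < n"
    have "compose (nat_module F n) f g (?e j) i = f (g (?e j)) i" by (simp add: compose_def)
    also have "\<dots> = (\<Oplus>k\<in>{..<n}. g (?e j) k \<otimes> f (?e k) i)"
      by (rule linear_expansion[OF f GL_closed[OF g] ij(1)]) simp
    also have "\<dots> = (\<Oplus>k\<in>{..<n}. f (?e k) i \<otimes> g (?e j) k)"
      using fc ij by (intro finsum_cong') (auto simp: m_comm)
    finally show "compose (nat_module F n) f g (?e j) i = (\<Oplus>k\<in>{..<n}. f (?e k) i \<otimes> g (?e j) k)" .
  qed (use fc in \<open>auto intro!: finsum_closed\<close>)
  also have "\<dots> = op_det F n f \<otimes> op_det F n g"
    unfolding op_det_eq by (rule leibniz_det_mult) (use fc in auto)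
  finally show ?thesis .
qed

lemma subgroup_GL: "subgroup (GL F n) Perm"
  using subgroup_of_GL[of "\<lambda>_. True"] by simp

lemma subgroup_SL: "subgroup (SL F n) Perm"
  unfolding SL_def by (rule subgroup_of_GL) (auto simp: op_det_compose op_det_one)

text \<open>
  The determinant is multiplicative, and the elements of a finite field are fixed by the power with
  exponent \<open>order F\<close>, so \<open>det f = det (f ^ order F) = 1\<close>.
\<close>

lemma op_det_eq_one_if_pow_order:
  assumes f: "f \<in> GL F n" and pow: "f [^]\<^bsub>Perm\<^esub> order F = \<one>\<^bsub>Perm\<^esub>"
  shows "op_det F n f = \<one>"
proof -
  interpret P: group Perm by (rule group_BijGroup)
  interpret GL: subgroup "GL F n" Perm by (rule subgroup_GL)
  have "f [^]\<^bsub>Perm\<^esub> m \<in> GL F n \<and> op_det F n (f [^]\<^bsub>Perm\<^esub> m) = op_det F n f [^] m" for m :: nat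
  proof (induction m)
    case 0
    show ?case using GL.one_closed op_det_one unfolding one_Perm[symmetric] by simp
  next
    case (Suc m)
    let ?g = "f [^]\<^bsub>Perm\<^esub> m"
    have "?g \<otimes>\<^bsub>Perm\<^esub> f = compose (nat_module F n) ?g f"
      using Suc f GL.subset by (intro mult_Perm) (auto simp: carrier_Perm)
    then have "op_det F n (?g \<otimes>\<^bsub>Perm\<^esub> f) = op_det F n f [^] Suc m"
      using Suc f by (simp add: op_det_compose)
    then show ?case using Suc f by (simp add: GL.m_closed)
  qed
  then have "op_det F n f [^] order F = op_det F n \<one>\<^bsub>Perm\<^esub>" using pow by metis
  then show ?thesis using pow_order_eq_self[OF finite_field op_det_closed[OF f]] op_det_one
    unfolding one_Perm by simp
qed

end

section \<open>Special linear and symplectic groups\<close>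

context coordinate_space
begin

text \<open>
  Under an interpretation of a module over \<open>F\<close>, the short names denote the laws of the module.
\<close>

lemmas F_a_assoc = a_assoc and F_r_neg = r_neg and F_l_neg = l_neg and F_a_ac = a_ac

lemma additive_subgroup_if_subspace:
  assumes T: "T \<subseteq> nat_module F n" "(\<lambda>i\<in>{..<n}. \<zero>) \<in> T"
    and add: "\<And>s t. s \<in> T \<Longrightarrow> t \<in> T \<Longrightarrow> vadd F n s t \<in> T"
    and smult: "\<And>c t. c \<in> carrier F \<Longrightarrow> t \<in> T \<Longrightarrow> vsmult F n c t \<in> T"
  shows "additive_subgroup T (vec_module F n)"
proof -
  interpret M: module F "vec_module F n" by (rule module_vec_module)
  show ?thesis
  proof (intro additive_subgroup.intro M.add.subgroupI)
    fix t assume t: "t \<in> T"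
    then have tM: "t \<in> carrier (vec_module F n)" using T by auto
    have "\<ominus>\<^bsub>vec_module F n\<^esub> t = (\<ominus> \<one>) \<odot>\<^bsub>vec_module F n\<^esub> t"
      using M.smult_l_minus[OF one_closed tM] M.smult_one[OF tM] by simp
    also have "\<dots> \<in> T" using smult[of "\<ominus> \<one>" t] t by simp
    finally show "\<ominus>\<^bsub>vec_module F n\<^esub> t \<in> T" .
  qed (use T add in auto)
qed

text \<open>
  All forms needed arise from the standard scalar product by an additive operator on the second argument.
\<close>

definition operator_form :: "((nat \<Rightarrow> 'a) \<Rightarrow> nat \<Rightarrow> 'a) \<Rightarrow> (nat \<Rightarrow> 'a) \<Rightarrow> (nat \<Rightarrow> 'a) \<Rightarrow> 'a" where
  "operator_form L v w = (\<Oplus>i\<in>{..<n}. v i \<otimes> L w i)"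

lemma form_space_operator_form:
  assumes L: "\<And>w i. w \<in> nat_module F n \<Longrightarrow> i < n \<Longrightarrow> L w i \<in> carrier F"
    and L_add: "\<And>w w' i. w \<in> nat_module F n \<Longrightarrow> w' \<in> nat_module F n \<Longrightarrow> i < n \<Longrightarrow>
      L (vadd F n w w') i = L w i \<oplus> L w' i"
    and refl: "\<And>v w. v \<in> nat_module F n \<Longrightarrow> w \<in> nat_module F n \<Longrightarrow> operator_form L v w = \<zero> \<Longrightarrow> operator_form L w v = \<zero>"
    and nondeg: "\<And>w i. w \<in> nat_module F n \<Longrightarrow> (\<And>i. i < n \<Longrightarrow> L w i = \<zero>) \<Longrightarrow> i < n \<Longrightarrow> w i = \<zero>"
  shows "form_space F (vec_module F n) (operator_form L)"
proof -
  have cl: "(\<Oplus>i\<in>{..<n}. v i \<otimes> L w i) \<in> carrier F" if "v \<in> nat_module F n" "w \<in> nat_module F n" for v w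
    using that L by (intro finsum_closed) auto
  show ?thesis
  proof (intro form_space.intro form_space_axioms.intro module_vec_module)
    show "field F" ..
  next
    fix x y z assume "x \<in> carrier (vec_module F n)" "y \<in> carrier (vec_module F n)" "z \<in> carrier (vec_module F n)"
    then have M: "x \<in> nat_module F n" "y \<in> nat_module F n" "z \<in> nat_module F n" by auto
    have "(\<Oplus>i\<in>{..<n}. x i \<otimes> L z i) \<oplus> (\<Oplus>i\<in>{..<n}. y i \<otimes> L z i) = (\<Oplus>i\<in>{..<n}. x i \<otimes> L z i \<oplus> y i \<otimes> L z i)"
      using M L by (intro finsum_addf[symmetric]) auto
    also have "\<dots> = (\<Oplus>i\<in>{..<n}. vadd F n x y i \<otimes> L z i)"
      using M L by (intro finsum_cong') (auto simp: l_distr)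
    finally show "operator_form L (x \<oplus>\<^bsub>vec_module F n\<^esub> y) z = operator_form L x z \<oplus> operator_form L y z"
      by (simp add: operator_form_def)
    have "(\<Oplus>i\<in>{..<n}. x i \<otimes> L y i) \<oplus> (\<Oplus>i\<in>{..<n}. x i \<otimes> L z i) = (\<Oplus>i\<in>{..<n}. x i \<otimes> L y i \<oplus> x i \<otimes> L z i)"
      using M L by (intro finsum_addf[symmetric]) auto
    also have "\<dots> = (\<Oplus>i\<in>{..<n}. x i \<otimes> L (vadd F n y z) i)"
      using M L by (intro finsum_cong') (auto simp: r_distr L_add)
    finally show "operator_form L x (y \<oplus>\<^bsub>vec_module F n\<^esub> z) = operator_form L x y \<oplus> operator_form L x z"
      by (simp add: operator_form_def)
  next
    fix a x y assume a: "a \<in> carrier F" and "x \<in> carrier (vec_module F n)" "y \<in> carrier (vec_module F n)"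
    then have M: "x \<in> nat_module F n" "y \<in> nat_module F n" by auto
    have "a \<otimes> (\<Oplus>i\<in>{..<n}. x i \<otimes> L y i) = (\<Oplus>i\<in>{..<n}. a \<otimes> (x i \<otimes> L y i))"
      using a M L by (intro finsum_rdistr) auto
    also have "\<dots> = (\<Oplus>i\<in>{..<n}. vsmult F n a x i \<otimes> L y i)"
      using a M L by (intro finsum_cong') (auto simp: m_assoc)
    finally show "operator_form L (a \<odot>\<^bsub>vec_module F n\<^esub> x) y = a \<otimes> operator_form L x y"
      by (simp add: operator_form_def)
  next
    fix x assume "x \<in> carrier (vec_module F n)"
      and z: "\<And>y. y \<in> carrier (vec_module F n) \<Longrightarrow> operator_form L x y = \<zero>"
    then have x: "x \<in> nat_module F n" by simp
    have "L x i = \<zero>" if i: "i < n" for i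
    proof -
      have "\<zero> = operator_form L (unit_vec F n i) x" using refl[OF x, of "unit_vec F n i"] z by simp
      also have "\<dots> = (\<Oplus>j\<in>{..<n}. if i = j then L x j else \<zero>)"
        unfolding operator_form_def using x L by (intro finsum_cong') auto
      also have "\<dots> = L x i" using i x L by (intro finsum_singleton) auto
      finally show ?thesis by simp
    qed
    then show "x = \<zero>\<^bsub>vec_module F n\<^esub>" using nondeg[OF x] x by (auto intro!: vec_eqI)
  qed (use cl refl finite_field finite_nat_module in \<open>auto simp: operator_form_def\<close>)
qed

lemma finsum_pairs:
  fixes m :: nat
  assumes "\<And>i. i < 2 * m \<Longrightarrow> f i \<in> carrier F"
  shows "(\<Oplus>i\<in>{..<2 * m}. f i) = (\<Oplus>i\<in>{..<m}. f (2 * i) \<oplus> f (2 * i + 1))"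
  using assms
proof (induction m)
  case (Suc m)
  define s t where "s = (\<Oplus>i\<in>{..<2 * m}. f i)" and "t = (\<Oplus>i\<in>{..<m}. f (2 * i) \<oplus> f (2 * i + 1))"
  have "(\<Oplus>i\<in>{..<2 * Suc m}. f i) = f (2 * m + 1) \<oplus> (f (2 * m) \<oplus> s)"
    unfolding s_def using Suc.prems by (simp add: lessThan_Suc Pi_def)
  moreover have "(\<Oplus>i\<in>{..<Suc m}. f (2 * i) \<oplus> f (2 * i + 1)) = (f (2 * m) \<oplus> f (2 * m + 1)) \<oplus> t"
    unfolding t_def lessThan_Suc using Suc.prems by (subst finsum_insert) auto
  moreover have "s = t" using Suc unfolding s_def t_def by simp
  moreover have "s \<in> carrier F" unfolding s_def using Suc.prems by (intro finsum_closed) auto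
  ultimately show ?case using Suc.prems by (simp add: a_ac)
qed simp

text \<open>
  All that the counting uses about a linear group: a closure operator with the growth of the linear span,
  such that points outside the closure of \<open>A\<close> have large orbits under the pointwise stabilizer of \<open>A\<close>.
  The exponent \<open>d\<close> measures the size of the totally singular subspace that produces the orbits.
\<close>

definition spreading_closure ::
    "((nat \<Rightarrow> 'a) \<Rightarrow> (nat \<Rightarrow> 'a)) set \<Rightarrow> nat \<Rightarrow> ((nat \<Rightarrow> 'a) set \<Rightarrow> (nat \<Rightarrow> 'a) set) \<Rightarrow> bool" where
  "spreading_closure H d cl \<longleftrightarrow>
     (\<forall>A A'. A \<subseteq> A' \<longrightarrow> A' \<subseteq> nat_module F n \<longrightarrow> cl A \<subseteq> cl A') \<and>
     (\<forall>A. A \<subseteq> nat_module F n \<longrightarrow> A \<subseteq> cl A) \<and>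
     (\<forall>A. A \<subseteq> nat_module F n \<longrightarrow> cl A \<subseteq> nat_module F n) \<and>
     (\<forall>A. A \<subseteq> nat_module F n \<longrightarrow> card (cl A) \<le> order F ^ card A) \<and>
     cl {} = {\<lambda>i\<in>{..<n}. \<zero>} \<and>
     (\<forall>A v. A \<subseteq> nat_module F n \<longrightarrow> v \<in> nat_module F n - cl A \<longrightarrow> 2 * card A + 2 < d \<longrightarrow>
        order F ^ d \<le> order F ^ (card A + 3) * card {u v | u. u \<in> stab H A})"

definition spreading :: "((nat \<Rightarrow> 'a) \<Rightarrow> (nat \<Rightarrow> 'a)) set \<Rightarrow> nat \<Rightarrow> bool" where
  "spreading H d \<longleftrightarrow> subgroup H Perm \<and> H \<subseteq> GL F n \<and> (\<exists>cl. spreading_closure H d cl)"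

lemma spreading_closureD:
  assumes "spreading_closure H d cl"
  shows "A \<subseteq> A' \<Longrightarrow> A' \<subseteq> nat_module F n \<Longrightarrow> cl A \<subseteq> cl A'"
    and "A \<subseteq> nat_module F n \<Longrightarrow> A \<subseteq> cl A"
    and "A \<subseteq> nat_module F n \<Longrightarrow> cl A \<subseteq> nat_module F n"
    and "A \<subseteq> nat_module F n \<Longrightarrow> card (cl A) \<le> order F ^ card A"
    and "cl {} = {\<lambda>i\<in>{..<n}. \<zero>}"
    and "A \<subseteq> nat_module F n \<Longrightarrow> v \<in> nat_module F n - cl A \<Longrightarrow> 2 * card A + 2 < d \<Longrightarrow>
      order F ^ d \<le> order F ^ (card A + 3) * card {u v | u. u \<in> stab H A}"
  using assms unfolding spreading_closure_def by (elim conjE; simp)+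

lemma spreadingI:
  assumes H: "subgroup H Perm" "H \<subseteq> GL F n" and "form_space F (vec_module F n) B"
    and orb: "\<And>A v. finite A \<Longrightarrow> A \<subseteq> nat_module F n \<Longrightarrow> v \<in> nat_module F n - form_space.cl F (vec_module F n) B A \<Longrightarrow>
        2 * card A + 2 < d \<Longrightarrow> order F ^ d \<le> order F ^ (card A + 3) * card {u v | u. u \<in> stab H A}"
  shows "spreading H d"
proof -
  interpret form_space F "vec_module F n" B by fact
  have fin: "finite A" if "A \<subseteq> nat_module F n" for A using finite_subset[OF that finite_nat_module] .
  show ?thesis unfolding spreading_def spreading_closure_def
  proof (intro conjI exI[of _ cl] allI impI)
    show "cl A \<subseteq> nat_module F n" for A using perp_subset by (simp add: cl_def)
    show "card (cl A) \<le> order F ^ card A" if "A \<subseteq> nat_module F n" for A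
      using card_cl_le[OF fin[OF that]] that by simp
  qed (use H cl_mono cl_extensive cl_empty orb fin in auto)
qed

lemma spreading_SL:
  assumes "d \<le> n" shows "spreading (SL F n) d"
proof -
  let ?B = "operator_form (\<lambda>w. w)"
  have sym: "?B v w = ?B w v" if "v \<in> nat_module F n" "w \<in> nat_module F n" for v w
    unfolding operator_form_def using that by (intro finsum_cong') (auto simp: m_comm)
  have fs: "form_space F (vec_module F n) ?B"
    by (rule form_space_operator_form) (auto simp: sym)
  interpret form_space F "vec_module F n" ?B by (rule fs)
  have SL: "SL F n \<subseteq> GL F n" by (auto simp: SL_def)
  show ?thesis
  proof (rule spreadingI[OF subgroup_SL SL fs])
    fix A v assume A: "A \<subseteq> nat_module F n" and v: "v \<in> nat_module F n - cl A"
    let ?c = "card {u v | u. u \<in> stab (SL F n) A}"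
    have "transvection a x \<in> SL F n" if "a \<in> nat_module F n" "x \<in> nat_module F n" "?B a x = \<zero>" for a x
      using op_det_eq_one_if_pow_order[of "transvection a x"] transvection_linear[of a x]
        transvection_pow_order[of a x] that
      by (simp add: SL_def linear_bijections_vec_module)
    then have "order F ^ n \<le> order F * ?c"
      using card_orbit_transvections[of "SL F n" A v] finite_subset[OF SL] card_GL_le A v
      by (simp add: card_nat_module)
    also have "\<dots> \<le> order F ^ (card A + 3) * ?c"
      using order_gt_1 by (intro mult_right_mono) (auto intro: self_le_power)
    finally have "order F ^ n \<le> order F ^ (card A + 3) * ?c" .
    moreover have "order F ^ d \<le> order F ^ n" using order_gt_1 assms by (intro power_increasing) auto
    ultimately show "order F ^ d \<le> order F ^ (card A + 3) * ?c" by (rule le_trans[rotated])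
  qed
qed

end

lemma (in isotropic_family) big_orbit_of_singular_transvections:
  assumes H: "finite H" "\<And>e. e \<in> carrier M \<Longrightarrow> sing e \<Longrightarrow> transvection (c \<odot>\<^bsub>M\<^esub> e) e \<in> H"
    and c: "c \<in> carrier R" "c \<noteq> \<zero>"
    and A: "finite A" "A \<subseteq> carrier M" and v: "v \<in> carrier M - cl A"
    and T0: "order R ^ d \<le> card T0" and d: "2 * card A + 2 < d"
  shows "order R ^ d \<le> order R ^ (card A + 3) * card {u v | u. u \<in> stab H A}"
proof -
  have "order R ^ (2 * card A) < order R ^ d" using order_gt_1 d by simp
  then have "card T0 \<le> order R ^ (card A + 2) * card {u v | u. u \<in> stab H A}"
    using card_orbit_singular_transvections[OF H c A v] T0 by linarith
  also have "\<dots> \<le> order R ^ (card A + 3) * card {u v | u. u \<in> stab H A}"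
    using order_gt_1 by (intro mult_right_mono power_increasing) auto
  finally show ?thesis using T0 by linarith
qed

context coordinate_space
begin

lemma spreading_Sp:
  assumes n: "even n" and d: "d \<le> n" shows "spreading (Sp F n) d"
proof -
  obtain m where m: "n = 2 * m" using n by (auto elim: evenE)
  define L where "L w i = (if even i then w (i + 1) else \<ominus> w (i - 1))" for w :: "nat \<Rightarrow> 'a" and i :: nat
  let ?B = "operator_form L"
  have lt: "i + 1 < n" if "even i" "i < n" for i using that m by presburger
  have Lc: "L w i \<in> carrier F" if "w \<in> nat_module F n" "i < n" for w i
    using that lt[of i] by (auto simp: L_def)
  have pair: "?B v w = (\<Oplus>i\<in>{..<m}. v (2 * i) \<otimes> w (2 * i + 1) \<ominus> v (2 * i + 1) \<otimes> w (2 * i))"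
    if "v \<in> nat_module F n" "w \<in> nat_module F n" for v w
  proof -
    have "?B v w = (\<Oplus>i\<in>{..<2 * m}. v i \<otimes> L w i)" by (simp add: operator_form_def flip: m)
    also have "\<dots> = (\<Oplus>i\<in>{..<m}. v (2 * i) \<otimes> L w (2 * i) \<oplus> v (2 * i + 1) \<otimes> L w (2 * i + 1))"
      using that Lc m by (intro finsum_pairs) auto
    also have "\<dots> = (\<Oplus>i\<in>{..<m}. v (2 * i) \<otimes> w (2 * i + 1) \<ominus> v (2 * i + 1) \<otimes> w (2 * i))"
      using that m by (intro finsum_cong') (auto simp: L_def a_minus_def r_minus)
    finally show ?thesis .
  qed
  have form: "?B v w = symplectic_form F n v w" if "v \<in> nat_module F n" "w \<in> nat_module F n" for v w
    using pair[OF that] m by (simp add: symplectic_form_def)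
  have anti: "?B v w = \<ominus> ?B w v" if vw: "v \<in> nat_module F n" "w \<in> nat_module F n" for v w
  proof -
    let ?t = "\<lambda>i. w (2 * i) \<otimes> v (2 * i + 1) \<ominus> w (2 * i + 1) \<otimes> v (2 * i)"
    have tc: "?t i \<in> carrier F" if "i < m" for i using that vw m by simp
    have "?B v w = (\<Oplus>i\<in>{..<m}. \<ominus> \<one> \<otimes> ?t i)"
      unfolding pair[OF vw] using vw m
      by (intro finsum_cong') (auto simp: a_minus_def l_minus minus_add r_minus a_comm m_comm)
    also have "\<dots> = \<ominus> \<one> \<otimes> ?B w v"
      unfolding pair[OF vw(2,1)] using tc by (intro finsum_rdistr[symmetric]) auto
    also have "\<dots> = \<ominus> ?B w v"
      unfolding pair[OF vw(2,1)] using tc by (simp add: l_minus finsum_closed Pi_def)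
    finally show ?thesis .
  qed
  have alt: "?B v v = \<zero>" if v: "v \<in> nat_module F n" for v
    unfolding pair[OF v v] using v m
    by (intro add.finprod_one_eqI) (auto simp: a_minus_def m_comm r_neg)
  have fs: "form_space F (vec_module F n) ?B"
  proof (rule form_space_operator_form)
    show "L (vadd F n w w') i = L w i \<oplus> L w' i"
      if "w \<in> nat_module F n" "w' \<in> nat_module F n" "i < n" for w w' i
      using that lt[of i] by (auto simp: L_def minus_add)
    fix w i assume w: "w \<in> nat_module F n" and z: "\<And>i. i < n \<Longrightarrow> L w i = \<zero>" and i: "i < n"
    show "w i = \<zero>"
    proof (cases "even i")
      case True
      then show ?thesis using z[of "i + 1"] lt[of i] i w by (auto simp: L_def)
    next
      case False
      then have "i - 1 < n" "even (i - 1)" "i - 1 + 1 = i" using i by (auto elim: oddE)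
      then show ?thesis using z[of "i - 1"] by (simp add: L_def)
    qed
  next
    show "?B w v = \<zero>" if "v \<in> nat_module F n" "w \<in> nat_module F n" "?B v w = \<zero>" for v w
      using anti[OF that(2,1)] that(3) by simp
  qed (rule Lc)
  interpret form_space F "vec_module F n" ?B by (rule fs)
  interpret isotropic_family F "vec_module F n" ?B "\<lambda>_. True" "nat_module F n"
  proof (intro isotropic_family.intro isotropic_family_axioms.intro fs)
    show "additive_subgroup (nat_module F n) (vec_module F n)"
      by (rule additive_subgroup_if_subspace) auto
  qed auto
  have sub: "Sp F n \<subseteq> GL F n" by (auto simp: Sp_def)
  have grp: "subgroup (Sp F n) Perm"
    unfolding Sp_def by (rule subgroup_of_GL) (auto simp: compose_def GL_closed)
  have tr: "transvection (\<one> \<odot>\<^bsub>vec_module F n\<^esub> e) e \<in> Sp F n" if e: "e \<in> nat_module F n" for e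
  proof -
    let ?t = "transvection e e"
    have eM: "e \<in> carrier (vec_module F n)" using e by simp
    have t: "?t \<in> GL F n" using transvection_linear[of e e] alt e by (simp add: linear_bijections_vec_module)
    have "?B (?t y) (?t z) = ?B y z" if y: "y \<in> nat_module F n" and z: "z \<in> nat_module F n" for y z
    proof -
      let ?M = "vec_module F n"
      have yz: "y \<in> carrier ?M" "z \<in> carrier ?M" using y z by auto
      define b c where "b = ?B y e" and "c = ?B z e"
      have bc: "b \<in> carrier F" "c \<in> carrier F" using yz eM by (auto simp: b_def c_def)
      have cM: "c \<odot>\<^bsub>?M\<^esub> e \<in> carrier ?M" "b \<odot>\<^bsub>?M\<^esub> e \<in> carrier ?M" using bc eM by (auto simp del: vec_module_simps)
      have ez: "?B e z = \<ominus> c" using anti[OF e z] by (simp add: c_def)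
      have "?B y (c \<odot>\<^bsub>?M\<^esub> e) = \<ominus> ?B (c \<odot>\<^bsub>?M\<^esub> e) y" using anti[of y "c \<odot>\<^bsub>?M\<^esub> e"] y cM by simp
      also have "\<dots> = c \<otimes> b" using B_smult_left[OF bc(2) eM yz(1)] anti[OF e y] bc
        by (simp add: b_def[symmetric] r_minus)
      finally have yc: "?B y (c \<odot>\<^bsub>?M\<^esub> e) = c \<otimes> b" .
      have ee: "?B e (c \<odot>\<^bsub>?M\<^esub> e) = \<zero>" using B_smult_right_zero[OF eM eM bc(2)] alt[OF e] by simp
      have right: "?B x (z \<oplus>\<^bsub>?M\<^esub> c \<odot>\<^bsub>?M\<^esub> e) = ?B x z \<oplus> ?B x (c \<odot>\<^bsub>?M\<^esub> e)"
        if "x \<in> carrier ?M" for x by (rule B_add_right[OF that yz(2) cM(1)])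
      have zc: "z \<oplus>\<^bsub>?M\<^esub> c \<odot>\<^bsub>?M\<^esub> e \<in> carrier ?M" using yz(2) cM(1) by (rule M.add.m_closed)
      have "?B (y \<oplus>\<^bsub>?M\<^esub> b \<odot>\<^bsub>?M\<^esub> e) (z \<oplus>\<^bsub>?M\<^esub> c \<odot>\<^bsub>?M\<^esub> e) =
          (?B y z \<oplus> ?B y (c \<odot>\<^bsub>?M\<^esub> e)) \<oplus> b \<otimes> (?B e z \<oplus> ?B e (c \<odot>\<^bsub>?M\<^esub> e))"
        unfolding B_add_left[OF yz(1) cM(2) zc] B_smult_left[OF bc(1) eM zc]
        by (simp only: right[OF yz(1)] right[OF eM])
      also have "\<dots> = ?B y z"
        using bc B_closed[OF yz] unfolding yc ee ez
        by (simp add: r_minus F_a_assoc m_comm[of c b] F_r_neg del: vec_module_simps)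
      finally show ?thesis using yz by (simp add: transvection_def b_def c_def del: vec_module_simps)
    qed
    then have "?t \<in> Sp F n" using t form GL_closed[OF t] by (simp add: Sp_def)
    then show ?thesis using smult_one[OF eM] by simp
  qed
  show ?thesis
  proof (rule spreadingI[OF grp sub fs])
    fix A v assume "finite A" "A \<subseteq> nat_module F n" "v \<in> nat_module F n - cl A" "2 * card A + 2 < d"
    then show "order F ^ d \<le> order F ^ (card A + 3) * card {u v | u. u \<in> stab (Sp F n) A}"
      using order_gt_1 finite_subset[OF sub] card_GL_le tr d
      by (intro big_orbit_of_singular_transvections[where c = \<one>])
        (auto simp: card_nat_module intro!: power_increasing)
  qed
qed

end

section \<open>Orthogonal groups\<close>

context coordinate_space
begin

text \<open>
  The span of the first \<open>m\<close> unit vectors with even index, on which hyperbolic sums vanish.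
\<close>

definition even_span :: "nat \<Rightarrow> (nat \<Rightarrow> 'a) set" where
  "even_span m = {t \<in> nat_module F n. \<forall>i<n. odd i \<or> 2 * m \<le> i \<longrightarrow> t i = \<zero>}"

lemma card_even_span_ge:
  assumes "2 * m \<le> n"
  shows "order F ^ m \<le> card (even_span m)"
proof -
  let ?f = "\<lambda>g. \<lambda>i\<in>{..<n}. if even i \<and> i < 2 * m then g (i div 2) else \<zero>"
  have "card ({..<m} \<rightarrow>\<^sub>E carrier F) \<le> card (even_span m)"
  proof (rule card_inj_on_le)
    show "inj_on ?f ({..<m} \<rightarrow>\<^sub>E carrier F)"
    proof (rule inj_onI)
      fix g h assume gh: "g \<in> {..<m} \<rightarrow>\<^sub>E carrier F" "h \<in> {..<m} \<rightarrow>\<^sub>E carrier F" and eq: "?f g = ?f h"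
      show "g = h"
      proof (rule PiE_ext[OF gh])
        fix i assume "i \<in> {..<m}"
        then show "g i = h i" using fun_cong[OF eq, of "2 * i"] assms by simp
      qed
    qed
    show "?f ` ({..<m} \<rightarrow>\<^sub>E carrier F) \<subseteq> even_span m"
    proof (rule image_subsetI)
      fix g assume g: "g \<in> {..<m} \<rightarrow>\<^sub>E carrier F"
      have "(if even i \<and> i < 2 * m then g (i div 2) else \<zero>) \<in> carrier F" for i
      proof (cases "i < 2 * m")
        case True
        then have "i div 2 < m" by linarith
        then show ?thesis using PiE_mem[OF g, of "i div 2"] by simp
      qed simp
      then have "?f g \<in> nat_module F n" unfolding nat_module_def restrict_PiE_iff by blast
      then show "?f g \<in> even_span m" unfolding even_span_def by simp
    qed
    show "finite (even_span m)" using finite_nat_module by (simp add: even_span_def)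
  qed
  then show ?thesis by (simp add: card_PiE order_def)
qed

lemma subgroup_even_span: "additive_subgroup (even_span m) (vec_module F n)"
  by (rule additive_subgroup_if_subspace) (auto simp: even_span_def)

lemma spreading_Omega:
  assumes L: "\<And>w i. w \<in> nat_module F n \<Longrightarrow> i < n \<Longrightarrow> L w i \<in> carrier F"
    and L_add: "\<And>w w' i. w \<in> nat_module F n \<Longrightarrow> w' \<in> nat_module F n \<Longrightarrow> i < n \<Longrightarrow>
      L (vadd F n w w') i = L w i \<oplus> L w' i"
    and nondeg: "\<And>w i. w \<in> nat_module F n \<Longrightarrow> (\<And>i. i < n \<Longrightarrow> L w i = \<zero>) \<Longrightarrow> i < n \<Longrightarrow> w i = \<zero>"
    and Qf: "\<And>v. v \<in> nat_module F n \<Longrightarrow> Qf v \<in> carrier F"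
    and Qf_add: "\<And>v w. v \<in> nat_module F n \<Longrightarrow> w \<in> nat_module F n \<Longrightarrow>
      Qf (vadd F n v w) = Qf v \<oplus> Qf w \<oplus> operator_form L v w"
    and Qf_smult: "\<And>a v. a \<in> carrier F \<Longrightarrow> v \<in> nat_module F n \<Longrightarrow> Qf (vsmult F n a v) = a \<otimes> a \<otimes> Qf v"
    and Qf_zero: "\<And>t. t \<in> even_span m \<Longrightarrow> Qf t = \<zero>"
    and m: "2 * m \<le> n" and d: "d \<le> m"
  shows "spreading (Omega F n Qf) d"
proof -
  let ?B = "operator_form L"
  have Bc: "?B v w \<in> carrier F" if "v \<in> nat_module F n" "w \<in> nat_module F n" for v w
    unfolding operator_form_def using that L by (intro finsum_closed) auto
  have sym: "?B v w = ?B w v" if vw: "v \<in> nat_module F n" "w \<in> nat_module F n" for v w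
  proof -
    have "vadd F n v w = vadd F n w v" by (rule vec_eqI) (use vw in \<open>auto simp: a_comm\<close>)
    then have "Qf v \<oplus> Qf w \<oplus> ?B v w = Qf w \<oplus> Qf v \<oplus> ?B w v" using Qf_add vw by metis
    then have "(Qf v \<oplus> Qf w) \<oplus> ?B v w = (Qf v \<oplus> Qf w) \<oplus> ?B w v" using vw Qf by (simp add: a_comm)
    then show ?thesis using vw Qf Bc by simp
  qed
  have fs: "form_space F (vec_module F n) ?B"
  proof (rule form_space_operator_form[OF L L_add])
    show "?B w v = \<zero>" if "v \<in> nat_module F n" "w \<in> nat_module F n" "?B v w = \<zero>" for v w
      using sym[OF that(1,2)] that(3) by simp
  qed (use nondeg in auto)
  interpret form_space F "vec_module F n" ?B by (rule fs)
  interpret quadratic_space F "vec_module F n" ?B Qf "even_span m"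
  proof (intro quadratic_space.intro quadratic_space_axioms.intro fs subgroup_even_span)
    show "?B x y = ?B y x" if "x \<in> carrier (vec_module F n)" "y \<in> carrier (vec_module F n)" for x y
      using sym that by simp
    show "c \<odot>\<^bsub>vec_module F n\<^esub> t \<in> even_span m" if "c \<in> carrier F" "t \<in> even_span m" for c t
      using that by (auto simp: even_span_def)
  qed (use Qf Qf_add Qf_smult Qf_zero in auto)
  interpret P: group Perm by (rule group_BijGroup)
  have GO: "isometries = GO F n Qf"
    by (simp add: isometries_def GO_def linear_bijections_vec_module)
  have sGO: "subgroup (GO F n Qf) Perm"
    unfolding GO_def by (rule subgroup_of_GL) (auto simp: compose_def GL_closed)
  have sub: "Omega F n Qf \<subseteq> GL F n"
    using P.derived_incl[OF order_refl sGO] unfolding Omega_def by (auto simp: GO_def)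
  have grp: "subgroup (Omega F n Qf) Perm"
    unfolding Omega_def by (rule P.derived_is_subgroup[OF subgroup.subset[OF sGO]])
  have comm: "f \<otimes>\<^bsub>Perm\<^esub> g \<otimes>\<^bsub>Perm\<^esub> inv\<^bsub>Perm\<^esub> f \<otimes>\<^bsub>Perm\<^esub> inv\<^bsub>Perm\<^esub> g \<in> Omega F n Qf"
    if "f \<in> isometries" "g \<in> isometries" for f g
    unfolding Omega_def derived_def using that GO by (intro generate.incl) blast
  show ?thesis
  proof (rule spreadingI[OF grp sub fs])
    fix A v assume A: "finite A" "A \<subseteq> nat_module F n" and v: "v \<in> nat_module F n - cl A"
      and dA: "2 * card A + 2 < d"
    have Td: "order F ^ d \<le> card (even_span m)"
      
      by (rule le_trans[OF power_increasing[OF d] card_even_span_ge[OF m]]) (use order_gt_1 in auto)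
    have "order F ^ (2 * (card A + 1)) < order F ^ d"
      by (rule power_strict_increasing) (use order_gt_1 dA in auto)
    then have "card (even_span m) \<le> order F ^ (card A + 3) * card {u v | u. u \<in> stab (Omega F n Qf) A}"
      using finite_subset[OF sub] card_GL_le comm A v Td by (intro card_orbit_commutators) auto
    then show "order F ^ d \<le> order F ^ (card A + 3) * card {u v | u. u \<in> stab (Omega F n Qf) A}"
      using Td by (rule le_trans[rotated])
  qed
qed

definition partner :: "nat \<Rightarrow> nat" where
  "partner i = (if even i then i + 1 else i - 1)"

lemma partner_simps [simp]: "partner (2 * i) = 2 * i + 1" "partner (Suc (2 * i)) = 2 * i"
  by (simp_all add: partner_def)

lemma partner_lt: "i < 2 * m \<Longrightarrow> partner i < 2 * m"
  unfolding partner_def by auto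

lemma partner_partner [simp]: "partner (partner i) = i"
  unfolding partner_def by auto

lemma hyperbolic_sum_closed: "2 * m \<le> n \<Longrightarrow> v \<in> nat_module F n \<Longrightarrow> hyperbolic_sum F m v \<in> carrier F"
  unfolding hyperbolic_sum_def by (intro finsum_closed) auto

lemma hyperbolic_sum_add:
  assumes m: "2 * m \<le> n" and vw: "v \<in> nat_module F n" "w \<in> nat_module F n"
  shows "hyperbolic_sum F m (vadd F n v w) =
    hyperbolic_sum F m v \<oplus> hyperbolic_sum F m w \<oplus> (\<Oplus>i\<in>{..<2 * m}. v i \<otimes> w (partner i))"
proof -
  let ?a = "\<lambda>i. v (2 * i) \<otimes> v (2 * i + 1)" and ?b = "\<lambda>i. w (2 * i) \<otimes> w (2 * i + 1)"
    and ?c = "\<lambda>i. v (2 * i) \<otimes> w (2 * i + 1) \<oplus> v (2 * i + 1) \<otimes> w (2 * i)"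
  have cl: "?a i \<in> carrier F" "?b i \<in> carrier F" "?c i \<in> carrier F" if "i < m" for i
    using that vw m by auto
  have "hyperbolic_sum F m (vadd F n v w) = (\<Oplus>i\<in>{..<m}. (?a i \<oplus> ?b i) \<oplus> ?c i)"
    unfolding hyperbolic_sum_def
  proof (rule finsum_cong')
    fix i assume "i \<in> {..<m}"
    then have i: "2 * i < n" "2 * i + 1 < n" using m by auto
    show "vadd F n v w (2 * i) \<otimes> vadd F n v w (2 * i + 1) = (?a i \<oplus> ?b i) \<oplus> ?c i"
      using i vw by (simp add: l_distr r_distr a_ac m_ac)
  qed (use cl in auto)
  also have "\<dots> = (\<Oplus>i\<in>{..<m}. ?a i \<oplus> ?b i) \<oplus> (\<Oplus>i\<in>{..<m}. ?c i)"
    using cl by (intro finsum_addf) auto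
  also have "(\<Oplus>i\<in>{..<m}. ?a i \<oplus> ?b i) = hyperbolic_sum F m v \<oplus> hyperbolic_sum F m w"
    unfolding hyperbolic_sum_def using cl by (intro finsum_addf) auto
  also have "(\<Oplus>i\<in>{..<m}. ?c i) = (\<Oplus>i\<in>{..<2 * m}. v i \<otimes> w (partner i))"
  proof -
    have "v i \<otimes> w (partner i) \<in> carrier F" if "i < 2 * m" for i
      using that vw m partner_lt[OF that] by simp
    from finsum_pairs[OF this] show ?thesis by simp
  qed
  finally show ?thesis .
qed

lemma hyperbolic_sum_smult:
  assumes m: "2 * m \<le> n" and v: "v \<in> nat_module F n" and a: "a \<in> carrier F"
  shows "hyperbolic_sum F m (vsmult F n a v) = a \<otimes> a \<otimes> hyperbolic_sum F m v"
proof -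
  have "hyperbolic_sum F m (vsmult F n a v) = (\<Oplus>i\<in>{..<m}. a \<otimes> a \<otimes> (v (2 * i) \<otimes> v (2 * i + 1)))"
    unfolding hyperbolic_sum_def
  proof (rule finsum_cong')
    fix i assume "i \<in> {..<m}"
    then have "2 * i < n" "2 * i + 1 < n" using m by auto
    then show "vsmult F n a v (2 * i) \<otimes> vsmult F n a v (2 * i + 1) = a \<otimes> a \<otimes> (v (2 * i) \<otimes> v (2 * i + 1))"
      using a v by (simp add: m_ac)
  qed (use a v m in auto)
  also have "\<dots> = a \<otimes> a \<otimes> hyperbolic_sum F m v"
    unfolding hyperbolic_sum_def using a v m by (intro finsum_rdistr[symmetric]) auto
  finally show ?thesis .
qed

lemma hyperbolic_sum_even_span: "2 * m \<le> n \<Longrightarrow> t \<in> even_span m \<Longrightarrow> hyperbolic_sum F m t = \<zero>"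
  unfolding hyperbolic_sum_def by (intro add.finprod_one_eqI) (auto simp: even_span_def)

text \<open>
  The three types of quadratic forms are orthogonal sums of \<open>m\<close> hyperbolic planes and a form \<open>q\<close> in at
  most two variables with polar form \<open>tail\<close>. Nondegeneracy is inherited from \<open>q\<close>.
\<close>

lemma spreading_Omega_hyperbolic_plus:
  assumes m: "2 * m \<le> n" and d: "d \<le> m"
    and Qf: "\<And>v. v \<in> nat_module F n \<Longrightarrow> Qf v = hyperbolic_sum F m v \<oplus> q v"
    and q: "\<And>v. v \<in> nat_module F n \<Longrightarrow> q v \<in> carrier F"
    and tail: "\<And>w i. w \<in> nat_module F n \<Longrightarrow> i \<in> {2 * m..<n} \<Longrightarrow> tail w i \<in> carrier F"
    and tail_add: "\<And>w w' i. w \<in> nat_module F n \<Longrightarrow> w' \<in> nat_module F n \<Longrightarrow> i \<in> {2 * m..<n} \<Longrightarrow>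
      tail (vadd F n w w') i = tail w i \<oplus> tail w' i"
    and q_add: "\<And>v w. v \<in> nat_module F n \<Longrightarrow> w \<in> nat_module F n \<Longrightarrow>
      q (vadd F n v w) = q v \<oplus> q w \<oplus> (\<Oplus>i\<in>{2 * m..<n}. v i \<otimes> tail w i)"
    and q_smult: "\<And>a v. a \<in> carrier F \<Longrightarrow> v \<in> nat_module F n \<Longrightarrow> q (vsmult F n a v) = a \<otimes> a \<otimes> q v"
    and q_zero: "\<And>t. t \<in> nat_module F n \<Longrightarrow> (\<And>i. i \<in> {2 * m..<n} \<Longrightarrow> t i = \<zero>) \<Longrightarrow> q t = \<zero>"
    and nondeg: "\<And>w i. w \<in> nat_module F n \<Longrightarrow> (\<And>i. i \<in> {2 * m..<n} \<Longrightarrow> tail w i = \<zero>) \<Longrightarrow>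
      i \<in> {2 * m..<n} \<Longrightarrow> w i = \<zero>"
  shows "spreading (Omega F n Qf) d"
proof -
  define L where "L w i = (if i < 2 * m then w (partner i) else tail w i)" for w :: "nat \<Rightarrow> 'a" and i
  have pn: "partner i < n" if "i < 2 * m" for i using partner_lt[OF that] m by simp
  have Lc: "L w i \<in> carrier F" if "w \<in> nat_module F n" "i < n" for w i
    using that pn[of i] tail[of w i] by (auto simp: L_def)
  have B: "operator_form L v w = (\<Oplus>i\<in>{..<2 * m}. v i \<otimes> w (partner i)) \<oplus> (\<Oplus>i\<in>{2 * m..<n}. v i \<otimes> tail w i)"
    if vw: "v \<in> nat_module F n" "w \<in> nat_module F n" for v w
  proof -
    have "operator_form L v w = (\<Oplus>i\<in>{..<2 * m} \<union> {2 * m..<n}. v i \<otimes> L w i)"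
      unfolding operator_form_def using m by (simp add: ivl_disj_un_one(2))
    also have "\<dots> = (\<Oplus>i\<in>{..<2 * m}. v i \<otimes> L w i) \<oplus> (\<Oplus>i\<in>{2 * m..<n}. v i \<otimes> L w i)"
      using vw Lc m by (intro finsum_Un_disjoint) auto
    also have "(\<Oplus>i\<in>{..<2 * m}. v i \<otimes> L w i) = (\<Oplus>i\<in>{..<2 * m}. v i \<otimes> w (partner i))"
      using vw pn m by (intro finsum_cong') (auto simp: L_def)
    also have "(\<Oplus>i\<in>{2 * m..<n}. v i \<otimes> L w i) = (\<Oplus>i\<in>{2 * m..<n}. v i \<otimes> tail w i)"
      using vw tail by (intro finsum_cong') (auto simp: L_def)
    finally show ?thesis .
  qed
  show ?thesis
  proof (rule spreading_Omega[where L = L, OF Lc _ _ _ _ _ _ m d])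
    show "L (vadd F n w w') i = L w i \<oplus> L w' i"
      if "w \<in> nat_module F n" "w' \<in> nat_module F n" "i < n" for w w' i
      using that pn[of i] tail_add[of w w' i] by (auto simp: L_def)
  next
    fix w i assume w: "w \<in> nat_module F n" and z: "\<And>i. i < n \<Longrightarrow> L w i = \<zero>" and i: "i < n"
    show "w i = \<zero>"
    proof (cases "i < 2 * m")
      case True
      then show ?thesis using z[OF pn[OF True]] partner_lt[OF True] by (simp add: L_def)
    next
      case False
      have "tail w j = \<zero>" if "j \<in> {2 * m..<n}" for j using z[of j] that by (simp add: L_def)
      then show ?thesis using nondeg[OF w, of i] False i by simp
    qed
  next
    fix v w assume vw: "v \<in> nat_module F n" "w \<in> nat_module F n"
    define a b c a' b' c' where "a = hyperbolic_sum F m v" and "b = hyperbolic_sum F m w"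
      and "c = (\<Oplus>i\<in>{..<2 * m}. v i \<otimes> w (partner i))" and "a' = q v" and "b' = q w"
      and "c' = (\<Oplus>i\<in>{2 * m..<n}. v i \<otimes> tail w i)"
    have cl: "a \<in> carrier F" "b \<in> carrier F" "c \<in> carrier F" "a' \<in> carrier F" "b' \<in> carrier F" "c' \<in> carrier F"
      using vw m q tail pn by (auto simp: a_def b_def c_def a'_def b'_def c'_def hyperbolic_sum_closed intro!: finsum_closed)
    have "Qf (vadd F n v w) = (a \<oplus> b \<oplus> c) \<oplus> (a' \<oplus> b' \<oplus> c')"
      using vw by (simp add: Qf hyperbolic_sum_add[OF m] q_add a_def b_def c_def a'_def b'_def c'_def)
    also have "\<dots> = (a \<oplus> a') \<oplus> (b \<oplus> b') \<oplus> (c \<oplus> c')" using cl by (simp add: a_ac)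
    finally show "Qf (vadd F n v w) = Qf v \<oplus> Qf w \<oplus> operator_form L v w"
      using vw by (simp add: Qf B a_def b_def c_def a'_def b'_def c'_def)
  next
    show "Qf (vsmult F n a v) = a \<otimes> a \<otimes> Qf v" if "a \<in> carrier F" "v \<in> nat_module F n" for a v
      using that m q by (simp add: Qf hyperbolic_sum_smult q_smult hyperbolic_sum_closed r_distr)
    show "Qf t = \<zero>" if t: "t \<in> even_span m" for t
    proof -
      have "t \<in> nat_module F n" "\<And>i. i \<in> {2 * m..<n} \<Longrightarrow> t i = \<zero>" using t by (auto simp: even_span_def)
      then show ?thesis using Qf q_zero hyperbolic_sum_even_span[OF m t] by simp
    qed
  qed (use Qf q m hyperbolic_sum_closed in auto)
qed

lemma spreading_Omega_plus:
  assumes "even n" "d \<le> n div 2"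
  shows "spreading (Omega F n (quad_plus F n)) d"
proof (rule spreading_Omega_hyperbolic_plus[where q = "\<lambda>_. \<zero>" and tail = "\<lambda>_ _. \<zero>" and m = "n div 2"])
  have "n = 2 * (n div 2)" using assms(1) by simp
  then have "{2 * (n div 2)..<n} = {}" by simp
  then show "w i = \<zero>" if "i \<in> {2 * (n div 2)..<n}" for w and i using that by blast
qed (use assms in \<open>auto simp: quad_plus_def hyperbolic_sum_closed\<close>)

text \<open>
  If 2 were zero, an odd multiple of 1 could not vanish, but \<open>order F\<close> times 1 does.
\<close>

lemma two_neq_zero:
  assumes "odd (order F)" shows "\<one> \<oplus> \<one> \<noteq> \<zero>"
proof
  assume two: "\<one> \<oplus> \<one> = \<zero>"
  obtain k where k: "order F = Suc (2 * k)" using assms by (auto elim: oddE)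
  have "add_pow F (2 * j) \<one> = \<zero>" for j :: nat
  proof (induction j)
    case (Suc j)
    have "add_pow F (2 * Suc j) \<one> = add_pow F (2 * j) \<one> \<oplus> (\<one> \<oplus> \<one>)" by (simp add: a_assoc)
    then show ?case using Suc two by simp
  qed simp
  then have "add_pow F (order F) \<one> = \<one>" unfolding k by simp
  moreover have "add_pow F (order F) \<one> = \<zero>"
    using add.pow_order_eq_1[of \<one>] by (simp add: order_def add_pow_def)
  ultimately show False by simp
qed

lemma spreading_Omega_odd:
  assumes n: "odd n" and "d \<le> n div 2" and F: "odd (order F)"
  shows "spreading (Omega F n (quad_odd F n)) d"
proof (rule spreading_Omega_hyperbolic_plus[where q = "\<lambda>v. v (n - 1) \<otimes> v (n - 1)" and tail = "\<lambda>w i. w i \<oplus> w i"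
      and m = "n div 2"])
  have n': "n = Suc (2 * (n div 2))" using n by simp
  then have iv: "{2 * (n div 2)..<n} = {n - 1}" by (metis atLeastLessThan_singleton diff_Suc_1)
  have lt: "n - 1 < n" using n' by simp
  show "vadd F n v w (n - 1) \<otimes> vadd F n v w (n - 1) =
      v (n - 1) \<otimes> v (n - 1) \<oplus> w (n - 1) \<otimes> w (n - 1) \<oplus> (\<Oplus>i\<in>{2 * (n div 2)..<n}. v i \<otimes> (w i \<oplus> w i))"
    if "v \<in> nat_module F n" "w \<in> nat_module F n" for v w
    unfolding iv using that lt by (simp add: l_distr r_distr a_ac m_ac)
  show "vsmult F n a v (n - 1) \<otimes> vsmult F n a v (n - 1) = a \<otimes> a \<otimes> (v (n - 1) \<otimes> v (n - 1))"
    if "a \<in> carrier F" "v \<in> nat_module F n" for a v using that lt by (simp add: m_ac)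
  show "w i = \<zero>" if w: "w \<in> nat_module F n" and z: "\<And>i. i \<in> {2 * (n div 2)..<n} \<Longrightarrow> w i \<oplus> w i = \<zero>"
    and i: "i \<in> {2 * (n div 2)..<n}" for w i
  proof -
    have wi: "w i \<in> carrier F" using w i by auto
    have "(\<one> \<oplus> \<one>) \<otimes> w i = \<zero>" using z[OF i] wi by (simp add: l_distr)
    then show ?thesis using two_neq_zero[OF F] wi by (simp add: integral_iff)
  qed
  show "v (n - 1) \<otimes> v (n - 1) \<in> carrier F" if "v \<in> nat_module F n" for v using that lt by simp
  show "t (n - 1) \<otimes> t (n - 1) = \<zero>"
    if "t \<in> nat_module F n" "\<And>i. i \<in> {2 * (n div 2)..<n} \<Longrightarrow> t i = \<zero>" for t using that iv by simp
qed (use assms in \<open>auto simp: quad_odd_def a_ac\<close>)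

text \<open>
  The two equations say that \<open>(a, b)\<close> lies in the radical of the polar form of \<open>a\<^sup>2 + a b + z b\<^sup>2\<close>. They
  imply \<open>(1 - 4 z) a = 0\<close>, and \<open>4 z - 1\<close> is the value of the quadratic form at \<open>(- 1, 2)\<close>.
\<close>

lemma anisotropic_nondegenerate:
  assumes z: "anisotropic_param F z" and a: "a \<in> carrier F" and b: "b \<in> carrier F"
    and eq: "a \<oplus> a \<oplus> b = \<zero>" "a \<oplus> z \<otimes> (b \<oplus> b) = \<zero>"
  shows "a = \<zero> \<and> b = \<zero>"
proof -
  have zc: "z \<in> carrier F" using z by (simp add: anisotropic_param_def)
  define s where "s = z \<oplus> z \<oplus> (z \<oplus> z)"
  have sc: "s \<in> carrier F" using zc by (simp add: s_def)
  have b': "b = \<ominus> (a \<oplus> a)" using minus_equality[of b "a \<oplus> a"] a b eq(1) by (simp add: a_comm minus_equality)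
  have "z \<otimes> (b \<oplus> b) = \<ominus> (s \<otimes> a)"
    unfolding b' s_def using a zc by (simp add: l_distr r_distr r_minus minus_add a_ac)
  then have "a \<oplus> \<ominus> (s \<otimes> a) = \<zero>" using eq(2) by simp
  then have "(\<one> \<oplus> \<ominus> s) \<otimes> a = \<zero>" using a sc by (simp add: l_distr l_minus)
  then have "\<one> \<oplus> \<ominus> s = \<zero> \<or> a = \<zero>" using a sc by (simp add: integral_iff)
  moreover have "\<one> \<oplus> \<ominus> s \<noteq> \<zero>"
  proof
    assume "\<one> \<oplus> \<ominus> s = \<zero>"
    then have "s = \<one>" using sc by (metis add.inv_closed add.inv_inv add.inv_equality one_closed)
    moreover have "binary_quad F z (\<ominus> \<one>) (\<one> \<oplus> \<one>) = \<ominus> \<one> \<oplus> s"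
      unfolding binary_quad_def s_def using zc
      by (simp add: l_distr r_distr l_minus r_minus minus_add a_assoc r_neg1 r_neg2 l_neg r_neg)
    ultimately have "binary_quad F z (\<ominus> \<one>) (\<one> \<oplus> \<one>) = \<zero>" by (simp add: l_neg)
    then have "\<ominus> \<one> = \<zero>" using z unfolding anisotropic_param_def by blast
    then show False using one_not_zero by (metis add.inv_inv add.inv_one one_closed minus_zero)
  qed
  ultimately have "a = \<zero>" by simp
  then show ?thesis using eq(1) b by simp
qed

lemma spreading_Omega_minus:
  assumes n: "even n" "n \<ge> 2" and d: "d \<le> n div 2 - 1" and z: "anisotropic_param F z"
  shows "spreading (Omega F n (quad_minus F z n)) d"
proof -
  define m where "m = n div 2 - 1"
  have n': "n = Suc (Suc (2 * m))" using n by (auto simp: m_def elim!: evenE)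
  have zc: "z \<in> carrier F" using z by (simp add: anisotropic_param_def)
  have iv: "{2 * m..<n} = {2 * m, Suc (2 * m)}" using n' by auto
  have lt: "2 * m < n" "Suc (2 * m) < n" using n' by auto
  let ?q = "\<lambda>v. binary_quad F z (v (2 * m)) (v (Suc (2 * m)))"
  let ?t = "\<lambda>w i. if i = 2 * m then w (2 * m) \<oplus> w (2 * m) \<oplus> w (Suc (2 * m))
      else w (2 * m) \<oplus> z \<otimes> (w (Suc (2 * m)) \<oplus> w (Suc (2 * m)))"
  show ?thesis
  proof (rule spreading_Omega_hyperbolic_plus[where q = ?q and tail = ?t and m = m])
    show "?q (vadd F n v w) = ?q v \<oplus> ?q w \<oplus> (\<Oplus>i\<in>{2 * m..<n}. v i \<otimes> ?t w i)"
      if vw: "v \<in> nat_module F n" "w \<in> nat_module F n" for v w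
    proof -
      define a b a' b' where "a = v (2 * m)" and "b = v (Suc (2 * m))" and "a' = w (2 * m)" and "b' = w (Suc (2 * m))"
      have c: "a \<in> carrier F" "b \<in> carrier F" "a' \<in> carrier F" "b' \<in> carrier F"
        using vw lt by (auto simp: a_def b_def a'_def b'_def)
      have "(\<Oplus>i\<in>{2 * m..<n}. v i \<otimes> ?t w i) = a \<otimes> (a' \<oplus> a' \<oplus> b') \<oplus> b \<otimes> (a' \<oplus> z \<otimes> (b' \<oplus> b'))"
        unfolding iv using c zc by (simp add: Pi_def flip: a_def b_def a'_def b'_def)
      moreover have "binary_quad F z (a \<oplus> a') (b \<oplus> b') = binary_quad F z a b \<oplus> binary_quad F z a' b' \<oplus>
          (a \<otimes> (a' \<oplus> a' \<oplus> b') \<oplus> b \<otimes> (a' \<oplus> z \<otimes> (b' \<oplus> b')))"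
        using c zc by (simp add: binary_quad_def l_distr r_distr a_ac m_ac)
      ultimately show ?thesis using lt by (simp flip: a_def b_def a'_def b'_def)
    qed
    show "?q (vsmult F n a v) = a \<otimes> a \<otimes> ?q v" if "a \<in> carrier F" "v \<in> nat_module F n" for a v
    proof -
      have "v (2 * m) \<in> carrier F" "v (Suc (2 * m)) \<in> carrier F" using that lt by auto
      then show ?thesis using that(1) zc lt by (simp add: binary_quad_def r_distr m_ac)
    qed
    show "w i = \<zero>" if w: "w \<in> nat_module F n" and zero: "\<And>i. i \<in> {2 * m..<n} \<Longrightarrow> ?t w i = \<zero>"
      and i: "i \<in> {2 * m..<n}" for w i
      using anisotropic_nondegenerate[OF z, of "w (2 * m)" "w (Suc (2 * m))"] w lt zero[of "2 * m"]
        zero[of "Suc (2 * m)"] i iv by auto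
    show "quad_minus F z n v = hyperbolic_sum F m v \<oplus> ?q v" if "v \<in> nat_module F n" for v
    proof -
      have "n - 2 = 2 * m" "n - 1 = Suc (2 * m)" using n' by auto
      then show ?thesis unfolding quad_minus_def m_def[symmetric] by simp
    qed
    show "?t (vadd F n w w') i = ?t w i \<oplus> ?t w' i"
      if "w \<in> nat_module F n" "w' \<in> nat_module F n" "i \<in> {2 * m..<n}" for w w' i
    proof -
      have "w (2 * m) \<in> carrier F" "w (Suc (2 * m)) \<in> carrier F" "w' (2 * m) \<in> carrier F" "w' (Suc (2 * m)) \<in> carrier F"
        using that lt by auto
      then show ?thesis using lt zc by (simp add: r_distr a_ac)
    qed
  qed (use d[folded m_def] zc lt iv in \<open>auto simp: binary_quad_def\<close>)
qed

end

section \<open>Unitary groups\<close>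

context cring
begin

definition binomial_term :: "'a \<Rightarrow> 'a \<Rightarrow> nat \<Rightarrow> nat \<Rightarrow> 'a" where
  "binomial_term x y m i = add_pow R (m choose i) (x [^] i \<otimes> y [^] (m - i))"

lemma binomial_term_closed [simp]:
  "x \<in> carrier R \<Longrightarrow> y \<in> carrier R \<Longrightarrow> binomial_term x y m i \<in> carrier R"
  by (simp add: binomial_term_def)

text \<open>
  Pascal's rule. The term with index \<open>m + 1\<close> in degree \<open>m\<close> is zero by its binomial coefficient, so the
  case \<open>i = m\<close> is no exception.
\<close>

lemma binomial_term_Suc:
  assumes xy: "x \<in> carrier R" "y \<in> carrier R" and i: "i \<le> m"
  shows "binomial_term x y (Suc m) (Suc i) = x \<otimes> binomial_term x y m i \<oplus> y \<otimes> binomial_term x y m (Suc i)"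
proof -
  define t where "t = x [^] Suc i \<otimes> y [^] (m - i)"
  have t: "t \<in> carrier R" using xy by (simp add: t_def)
  have a: "x \<otimes> binomial_term x y m i = add_pow R (m choose i) t"
    using xy by (simp add: binomial_term_def t_def add_pow_rdistr m_ac)
  have b: "y \<otimes> binomial_term x y m (Suc i) = add_pow R (m choose Suc i) t"
  proof (cases "i = m")
    case True
    then show ?thesis using xy by (simp add: binomial_term_def binomial_eq_0)
  next
    case False
    then have "m - i = Suc (m - Suc i)" using i by simp
    then show ?thesis using xy by (simp add: binomial_term_def t_def add_pow_rdistr m_ac)
  qed
  have "binomial_term x y (Suc m) (Suc i) = add_pow R ((m choose i) + (m choose Suc i)) t"
    by (simp add: binomial_term_def t_def)
  also have "\<dots> = add_pow R (m choose i) t \<oplus> add_pow R (m choose Suc i) t"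
    using t by (simp add: add.nat_pow_mult)
  finally show ?thesis using a b by simp
qed

theorem binomial_expansion:
  assumes xy: "x \<in> carrier R" "y \<in> carrier R"
  shows "(x \<oplus> y) [^] m = (\<Oplus>i\<in>{..m}. binomial_term x y m i)"
proof (induction m)
  case 0
  show ?case using xy by (simp add: binomial_term_def)
next
  case (Suc m)
  let ?t = "binomial_term x y"
  define s where "s = (\<Oplus>i\<in>{..m}. ?t m i)"
  have s: "s \<in> carrier R" using xy by (auto simp: s_def intro!: finsum_closed)
  have top: "?t m (Suc m) = \<zero>" by (simp add: binomial_term_def binomial_eq_0)
  have "s = (\<Oplus>i\<in>{..Suc m}. ?t m i)" unfolding s_def using xy top s by (subst finsum_Suc) (auto simp: s_def)
  also have "\<dots> = (\<Oplus>i\<in>{..m}. ?t m (Suc i)) \<oplus> ?t m 0" using xy by (intro finsum_Suc2) auto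
  finally have s2: "s = (\<Oplus>i\<in>{..m}. ?t m (Suc i)) \<oplus> ?t m 0" .
  have sc: "(\<Oplus>i\<in>{..m}. ?t m (Suc i)) \<in> carrier R" using xy by (auto intro!: finsum_closed)
  have "(x \<oplus> y) [^] Suc m = x \<otimes> s \<oplus> y \<otimes> s" using Suc xy s by (simp add: s_def[symmetric] m_comm r_distr)
  also have "x \<otimes> s = (\<Oplus>i\<in>{..m}. x \<otimes> ?t m i)"
    unfolding s_def using xy by (intro finsum_rdistr) auto
  also have "y \<otimes> s = (\<Oplus>i\<in>{..m}. y \<otimes> ?t m (Suc i)) \<oplus> y \<otimes> ?t m 0"
    using xy sc unfolding s2 by (subst finsum_rdistr[symmetric]) (auto simp: r_distr)
  also have "y \<otimes> ?t m 0 = ?t (Suc m) 0" using xy by (simp add: binomial_term_def m_comm)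
  also have "(\<Oplus>i\<in>{..m}. x \<otimes> ?t m i) \<oplus> ((\<Oplus>i\<in>{..m}. y \<otimes> ?t m (Suc i)) \<oplus> ?t (Suc m) 0) =
      (\<Oplus>i\<in>{..m}. x \<otimes> ?t m i \<oplus> y \<otimes> ?t m (Suc i)) \<oplus> ?t (Suc m) 0"
    using xy by (subst finsum_addf) (auto simp: a_assoc intro!: finsum_closed)
  also have "(\<Oplus>i\<in>{..m}. x \<otimes> ?t m i \<oplus> y \<otimes> ?t m (Suc i)) = (\<Oplus>i\<in>{..m}. ?t (Suc m) (Suc i))"
    using xy by (intro finsum_cong') (auto simp: binomial_term_Suc)
  also have "\<dots> \<oplus> ?t (Suc m) 0 = (\<Oplus>i\<in>{..Suc m}. ?t (Suc m) i)"
    using xy by (intro finsum_Suc2[symmetric]) auto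
  finally show ?case .
qed

lemma add_pow_eq_zero_if_dvd:
  fixes p m :: nat
  assumes "add_pow R p \<one> = \<zero>" "p dvd m" "x \<in> carrier R"
  shows "add_pow R m x = \<zero>"
proof -
  obtain k where m: "m = p * k" using assms(2) by (rule dvdE)
  have "add_pow R m x = add_pow R m \<one> \<otimes> x" using assms(3) by (simp add: add_pow_ldistr)
  also have "add_pow R m \<one> = add_pow R k (add_pow R p \<one>)" unfolding m by (simp add: add.nat_pow_pow)
  finally show ?thesis using assms by simp
qed

lemma frobenius_prime:
  fixes p :: nat
  assumes p: "Factorial_Ring.prime p" and char: "add_pow R p \<one> = \<zero>" and xy: "x \<in> carrier R" "y \<in> carrier R"
  shows "(x \<oplus> y) [^] p = x [^] p \<oplus> y [^] p"
proof -
  have p0: "p > 0" using p prime_gt_0_nat by simp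
  have "binomial_term x y p i = \<zero>" if i: "i \<in> {..p} - {0, p}" for i
    unfolding binomial_term_def
  proof (rule add_pow_eq_zero_if_dvd[OF char])
    show "p dvd p choose i" using i p p0 by (intro dvd_choose_prime) auto
  qed (use xy in simp)
  then have "(x \<oplus> y) [^] p = (\<Oplus>i\<in>{0, p}. binomial_term x y p i)"
    unfolding binomial_expansion[OF xy] using xy
    by (intro add.finprod_mono_neutral_cong_right) auto
  also have "\<dots> = x [^] p \<oplus> y [^] p"
    using p0 xy by (simp add: binomial_term_def a_comm)
  finally show ?thesis .
qed

lemma frobenius_prime_power:
  fixes p :: nat
  assumes p: "Factorial_Ring.prime p" and char: "add_pow R p \<one> = \<zero>" and xy: "x \<in> carrier R" "y \<in> carrier R"
  shows "(x \<oplus> y) [^] (p ^ k) = x [^] (p ^ k) \<oplus> y [^] (p ^ k)"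
proof (induction k)
  case (Suc k)
  have "(x \<oplus> y) [^] (p ^ Suc k) = ((x \<oplus> y) [^] (p ^ k)) [^] p" using xy by (simp add: nat_pow_pow mult.commute)
  also have "\<dots> = x [^] (p ^ Suc k) \<oplus> y [^] (p ^ Suc k)"
    using xy Suc frobenius_prime[OF p char] by (simp add: nat_pow_pow mult.commute)
  finally show ?case .
qed (use xy in simp)

end

locale unitary_space = coordinate_space F n for F (structure) and n +
  fixes q :: nat
  assumes q: "primepow q" and order_F: "order F = q ^ 2"
begin

lemma q_ge_2: "q \<ge> 2"
  using primepow_gt_Suc_0[OF q] by simp

text \<open>
  The additive group has order \<open>q\<^sup>2\<close>, so the square of the element \<open>q\<close> of the field is zero.
\<close>

lemma add_pow_q: "add_pow F q \<one> = \<zero>"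
proof -
  have "add_pow F (q * q) \<one> = \<zero>"
    using add.pow_order_eq_1[of \<one>] order_F by (simp add: order_def add_pow_def power2_eq_square)
  then have "add_pow F q \<one> \<otimes> add_pow F q \<one> = \<zero>" by (simp add: add_pow_ldistr add.nat_pow_pow)
  then show ?thesis by (simp add: integral_iff)
qed

definition conj :: "'a \<Rightarrow> 'a" where "conj x = x [^] q"

lemma conj_closed [simp]: "x \<in> carrier F \<Longrightarrow> conj x \<in> carrier F"
  by (simp add: conj_def)

lemma conj_mult: "x \<in> carrier F \<Longrightarrow> y \<in> carrier F \<Longrightarrow> conj (x \<otimes> y) = conj x \<otimes> conj y"
  by (simp add: conj_def nat_pow_distrib)

lemma conj_conj [simp]: "x \<in> carrier F \<Longrightarrow> conj (conj x) = x"
  using pow_order_eq_self[OF finite_field] order_F by (simp add: conj_def nat_pow_pow power2_eq_square)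

lemma conj_zero [simp]: "conj \<zero> = \<zero>"
  using q_ge_2 by (simp add: conj_def nat_pow_zero)

lemma conj_one [simp]: "conj \<one> = \<one>"
  by (simp add: conj_def)

lemma conj_add: "x \<in> carrier F \<Longrightarrow> y \<in> carrier F \<Longrightarrow> conj (x \<oplus> y) = conj x \<oplus> conj y"
proof -
  assume xy: "x \<in> carrier F" "y \<in> carrier F"
  obtain p k where p: "Factorial_Ring.prime p" "q = p ^ k" using q by (auto simp: primepow_def)
  have "add_pow F p \<one> [^] j = add_pow F (p ^ j) \<one>" for j :: nat
    by (induction j) (simp_all add: add_pow_ldistr add_pow_rdistr add.nat_pow_pow mult.commute)
  then have "add_pow F p \<one> [^] k = \<zero>" using add_pow_q p by simp
  then have "add_pow F p \<one> = \<zero>" by (induction k) (auto simp: integral_iff)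
  from frobenius_prime_power[OF p(1) this xy] show ?thesis unfolding conj_def unfolding p(2) .
qed

lemma conj_neg: "x \<in> carrier F \<Longrightarrow> conj (\<ominus> x) = \<ominus> conj x"
  using conj_add[of "\<ominus> x" x] by (simp add: l_neg minus_equality)

lemma conj_eq_zero: "x \<in> carrier F \<Longrightarrow> conj x = \<zero> \<Longrightarrow> x = \<zero>"
  by (metis conj_conj conj_zero)

lemma conj_finsum: "finite I \<Longrightarrow> (\<And>i. i \<in> I \<Longrightarrow> f i \<in> carrier F) \<Longrightarrow> conj (\<Oplus>i\<in>I. f i) = (\<Oplus>i\<in>I. conj (f i))"
  by (induction I rule: finite_induct) (auto simp: conj_add finsum_closed Pi_def)

text \<open>
  Otherwise all \<open>q\<^sup>2 - 1\<close> nonzero elements would be roots of \<open>X\<^bsup>q - 1\<^esup> - 1\<close>.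
\<close>

lemma ex_conj_neq: "\<exists>x\<in>carrier F. conj x \<noteq> x"
proof (rule ccontr)
  assume "\<not> ?thesis"
  then have fixed: "x [^] q = x" if "x \<in> carrier F" for x using that by (auto simp: conj_def)
  have "carrier F - {\<zero>} \<subseteq> {x \<in> carrier F. x [^] (q - 1) = \<one>}"
  proof clarify
    fix x assume x: "x \<in> carrier F" "x \<noteq> \<zero>"
    have "x [^] Suc (q - 1) = x" using fixed[OF x(1)] q_ge_2 by simp
    then have "x [^] (q - 1) \<otimes> x = \<one> \<otimes> x" using x by simp
    then show "x [^] (q - 1) = \<one>" using x m_rcancel[of x "x [^] (q - 1)" \<one>] by simp
  qed
  then have "card (carrier F - {\<zero>}) \<le> card {x \<in> carrier F. x [^] (q - 1) = \<one>}"
    using finite_field by (intro card_mono) auto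
  also have "\<dots> \<le> q - 1" using num_roots_le_deg[OF finite_field, of "q - 1"] q_ge_2 by simp
  finally have "q ^ 2 - 1 \<le> q - 1" using finite_field order_F by (simp add: order_def)
  moreover have "2 * q \<le> q ^ 2" using q_ge_2 by (simp add: power2_eq_square)
  ultimately show False using q_ge_2 by linarith
qed

text \<open>
  A skew element is the factor that makes unitary transvections preserve the form.
\<close>

lemma ex_skew: "\<exists>a\<in>carrier F. a \<noteq> \<zero> \<and> conj a = \<ominus> a"
proof -
  obtain x where x: "x \<in> carrier F" "conj x \<noteq> x" using ex_conj_neq by auto
  have "conj (x \<ominus> conj x) = \<ominus> (x \<ominus> conj x)"
    using x by (simp add: a_minus_def conj_add conj_neg minus_add a_comm)
  moreover have "x \<ominus> conj x \<noteq> \<zero>" using x by simp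
  ultimately show ?thesis using x(1) by (intro bexI[of _ "x \<ominus> conj x"]) auto
qed

text \<open>
  Surjectivity of the trace to the fixed field. An element \<open>x\<close> of nonzero trace \<open>t\<close> exists, as otherwise
  conjugation would be negation, 2 would be zero, and conjugation would be trivial. Then \<open>d x\<close> with
  \<open>d = k / t\<close> has trace \<open>k\<close>.
\<close>

lemma ex_trace:
  assumes k: "k \<in> carrier F" "conj k = k"
  shows "\<exists>c\<in>carrier F. c \<oplus> conj c = k"
proof -
  have "\<exists>x\<in>carrier F. x \<oplus> conj x \<noteq> \<zero>"
  proof (rule ccontr)
    assume "\<not> ?thesis"
    then have neg: "x \<oplus> conj x = \<zero>" if "x \<in> carrier F" for x using that by auto
    have two: "\<one> \<oplus> \<one> = \<zero>" using neg[of \<one>] by simp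
    have "conj x = x" if x: "x \<in> carrier F" for x
    proof -
      have "x \<oplus> x = (\<one> \<oplus> \<one>) \<otimes> x" using x by (simp add: l_distr)
      then have "x \<oplus> conj x = x \<oplus> x" using neg[OF x] two x by simp
      then show ?thesis using x by simp
    qed
    then show False using ex_conj_neq by blast
  qed
  then obtain x where x: "x \<in> carrier F" "x \<oplus> conj x \<noteq> \<zero>" by auto
  define t where "t = x \<oplus> conj x"
  have t: "t \<in> carrier F" "conj t = t" "t \<in> Units F"
    using x by (auto simp: t_def conj_add a_comm field_Units)
  define d where "d = k \<otimes> inv t"
  have d: "d \<in> carrier F" using k t by (simp add: d_def)
  have dt: "d \<otimes> t = k" using k t by (simp add: d_def m_assoc)
  have "conj d \<otimes> t = d \<otimes> t" using conj_mult[OF d t(1)] dt k t by simp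
  then have cd: "conj d = d" using d t m_rcancel[of t "conj d" d] by (auto simp: field_Units)
  have "d \<otimes> x \<oplus> conj (d \<otimes> x) = d \<otimes> t" using d x cd by (simp add: conj_mult r_distr t_def)
  then show ?thesis using dt d x by (intro bexI[of _ "d \<otimes> x"]) auto
qed

abbreviation herm where "herm \<equiv> hermitian_form F q n"

lemma herm_operator_form: "herm = operator_form (\<lambda>w i. conj (w i))"
  by (intro ext) (simp add: hermitian_form_def operator_form_def conj_def)

lemma herm_closed [simp]: "v \<in> nat_module F n \<Longrightarrow> w \<in> nat_module F n \<Longrightarrow> herm v w \<in> carrier F"
  unfolding herm_operator_form operator_form_def by (intro finsum_closed) auto

lemma herm_conj: "v \<in> nat_module F n \<Longrightarrow> w \<in> nat_module F n \<Longrightarrow> herm w v = conj (herm v w)"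
  unfolding herm_operator_form operator_form_def
  by (subst conj_finsum) (auto intro!: finsum_cong' simp: conj_mult m_comm)

lemma form_space_herm: "form_space F (vec_module F n) herm"
  unfolding herm_operator_form
proof (rule form_space_operator_form)
  fix v w assume vw: "v \<in> nat_module F n" "w \<in> nat_module F n"
    and "operator_form (\<lambda>w i. conj (w i)) v w = \<zero>"
  then show "operator_form (\<lambda>w i. conj (w i)) w v = \<zero>"
    using herm_conj[OF vw] by (simp add: herm_operator_form)
qed (auto simp: conj_add intro: conj_eq_zero)

text \<open>
  Vectors that are constant on consecutive blocks of length \<open>q\<close>. As \<open>q = 0\<close> in the field, they are
  pairwise orthogonal, so the standard hermitian form has a totally isotropic subspace of dimension
  \<open>n div q\<close>.
\<close>

definition block_span :: "(nat \<Rightarrow> 'a) set" where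
  "block_span = {t \<in> nat_module F n.
     (\<forall>i<q * (n div q). \<forall>j<q * (n div q). i div q = j div q \<longrightarrow> t i = t j) \<and>
     (\<forall>i<n. q * (n div q) \<le> i \<longrightarrow> t i = \<zero>)}"

lemma blocks_le: "q * (n div q) \<le> n"
  by simp

lemma card_block_span_ge: "order F ^ (n div q) \<le> card block_span"
proof -
  let ?m = "n div q"
  let ?f = "\<lambda>g. \<lambda>i\<in>{..<n}. if i < q * ?m then g (i div q) else \<zero>"
  have div: "i div q < ?m" if "i < q * ?m" for i
    using that by (simp add: less_mult_imp_div_less mult.commute)
  have "card ({..<?m} \<rightarrow>\<^sub>E carrier F) \<le> card block_span"
  proof (rule card_inj_on_le)
    show "inj_on ?f ({..<?m} \<rightarrow>\<^sub>E carrier F)"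
    proof (rule inj_onI)
      fix g h assume gh: "g \<in> {..<?m} \<rightarrow>\<^sub>E carrier F" "h \<in> {..<?m} \<rightarrow>\<^sub>E carrier F" and eq: "?f g = ?f h"
      show "g = h"
      proof (rule PiE_ext[OF gh])
        fix i assume "i \<in> {..<?m}"
        then have i: "q * i < q * ?m" using q_ge_2 by simp
        then have "q * i < n" using blocks_le by linarith
        then show "g i = h i" using fun_cong[OF eq, of "q * i"] i q_ge_2 by simp
      qed
    qed
    show "?f ` ({..<?m} \<rightarrow>\<^sub>E carrier F) \<subseteq> block_span"
    proof (rule image_subsetI)
      fix g assume g: "g \<in> {..<?m} \<rightarrow>\<^sub>E carrier F"
      have "(if i < q * ?m then g (i div q) else \<zero>) \<in> carrier F" for i
        using PiE_mem[OF g, of "i div q"] div[of i] by simp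
      then have "?f g \<in> nat_module F n" unfolding nat_module_def restrict_PiE_iff by blast
      moreover have "i < n" if "i < q * (n div q)" for i using that blocks_le by linarith
      ultimately show "?f g \<in> block_span" unfolding block_span_def by simp
    qed
    show "finite block_span" using finite_nat_module by (simp add: block_span_def)
  qed
  then show ?thesis by (simp add: card_PiE order_def)
qed

lemma finsum_blocks_zero:
  assumes f: "\<And>i. i < q * m \<Longrightarrow> f i \<in> carrier F"
    and const: "\<And>i j. i < q * m \<Longrightarrow> j < q * m \<Longrightarrow> i div q = j div q \<Longrightarrow> f i = f j"
  shows "(\<Oplus>i\<in>{..<q * m}. f i) = \<zero>"
  using f const
proof (induction m)
  case 0
  show ?case by simp
next
  case (Suc m)
  have split: "{..<q * Suc m} = {..<q * m} \<union> {q * m..<q * Suc m}" by auto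
  have c: "f (q * m) \<in> carrier F" using Suc.prems(1)[of "q * m"] q_ge_2 by simp
  have "(\<Oplus>i\<in>{..<q * Suc m}. f i) = (\<Oplus>i\<in>{..<q * m}. f i) \<oplus> (\<Oplus>i\<in>{q * m..<q * Suc m}. f i)"
    unfolding split using Suc.prems(1) by (intro finsum_Un_disjoint) auto
  also have "(\<Oplus>i\<in>{..<q * m}. f i) = \<zero>"
  proof (rule Suc.IH)
    show "f i \<in> carrier F" if "i < q * m" for i using that by (intro Suc.prems(1)) simp
    show "f i = f j" if "i < q * m" "j < q * m" "i div q = j div q" for i j
      using that by (intro Suc.prems(2)) simp_all
  qed
  also have "(\<Oplus>i\<in>{q * m..<q * Suc m}. f i) = (\<Oplus>i\<in>{q * m..<q * Suc m}. f (q * m))"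
  proof (rule finsum_cong')
    fix i assume i: "i \<in> {q * m..<q * Suc m}"
    then have "i div q = m" using q_ge_2 by (intro div_nat_eqI) (auto simp: mult.commute)
    then show "f i = f (q * m)" using i q_ge_2 by (intro Suc.prems(2)) auto
  qed (use c in auto)
  also have "\<dots> = add_pow F (card {q * m..<q * Suc m}) (f (q * m))"
    using add.finprod_const[OF c, of "{q * m..<q * Suc m}"] by simp
  also have "card {q * m..<q * Suc m} = q" by simp
  also have "add_pow F q (f (q * m)) = \<zero>" using add_pow_eq_zero_if_dvd[OF add_pow_q _ c] by simp
  finally show ?case by simp
qed

lemma block_spanD:
  assumes "t \<in> block_span"
  shows "t \<in> nat_module F n"
    and "i < q * (n div q) \<Longrightarrow> j < q * (n div q) \<Longrightarrow> i div q = j div q \<Longrightarrow> t i = t j"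
    and "i < n \<Longrightarrow> q * (n div q) \<le> i \<Longrightarrow> t i = \<zero>"
proof -
  from assms have *: "t \<in> nat_module F n \<and>
      (\<forall>i<q * (n div q). \<forall>j<q * (n div q). i div q = j div q \<longrightarrow> t i = t j) \<and>
      (\<forall>i<n. q * (n div q) \<le> i \<longrightarrow> t i = \<zero>)"
    unfolding block_span_def mem_Collect_eq .
  show "t \<in> nat_module F n" by (rule *[THEN conjunct1])
  show "i < q * (n div q) \<Longrightarrow> j < q * (n div q) \<Longrightarrow> i div q = j div q \<Longrightarrow> t i = t j"
    by (rule *[THEN conjunct2, THEN conjunct1, rule_format])
  show "i < n \<Longrightarrow> q * (n div q) \<le> i \<Longrightarrow> t i = \<zero>"
    by (rule *[THEN conjunct2, THEN conjunct2, rule_format])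
qed

lemma block_spanI:
  assumes "t \<in> nat_module F n"
    and "\<And>i j. i < q * (n div q) \<Longrightarrow> j < q * (n div q) \<Longrightarrow> i div q = j div q \<Longrightarrow> t i = t j"
    and "\<And>i. i < n \<Longrightarrow> q * (n div q) \<le> i \<Longrightarrow> t i = \<zero>"
  shows "t \<in> block_span"
  unfolding block_span_def mem_Collect_eq by (intro conjI allI impI assms)

lemma herm_block_span:
  assumes s: "s \<in> block_span" and t: "t \<in> block_span"
  shows "herm s t = \<zero>"
proof -
  note M = block_spanD(1)[OF s] block_spanD(1)[OF t]
  let ?m = "q * (n div q)"
  have "herm s t = (\<Oplus>i\<in>{..<?m}. s i \<otimes> conj (t i))"
    unfolding herm_operator_form operator_form_def
  proof (rule add.finprod_mono_neutral_cong_right)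
    show "s i \<otimes> conj (t i) = \<zero>" if "i \<in> {..<n} - {..<?m}" for i
      using that block_spanD(3)[OF s, of i] M(2) by simp
  qed (use M blocks_le in auto)
  also have "\<dots> = \<zero>"
  proof (rule finsum_blocks_zero)
    show "s i \<otimes> conj (t i) \<in> carrier F" if "i < ?m" for i
      using order.strict_trans2[OF that blocks_le] M by simp
    show "s i \<otimes> conj (t i) = s j \<otimes> conj (t j)" if "i < ?m" "j < ?m" "i div q = j div q" for i j
      using block_spanD(2)[OF s that] block_spanD(2)[OF t that] by simp
  qed
  finally show ?thesis .
qed

lemma vadd_block_span:
  assumes "s \<in> block_span" "t \<in> block_span"
  shows "vadd F n s t \<in> block_span"
proof (rule block_spanI)
  fix i j assume ij: "i < q * (n div q)" "j < q * (n div q)" "i div q = j div q"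
  show "vadd F n s t i = vadd F n s t j"
    using block_spanD(2)[OF assms(1) ij] block_spanD(2)[OF assms(2) ij]
      order.strict_trans2[OF ij(1) blocks_le] order.strict_trans2[OF ij(2) blocks_le] by simp
next
  fix i assume i: "i < n" "q * (n div q) \<le> i"
  show "vadd F n s t i = \<zero>"
    using block_spanD(3)[OF assms(1) i] block_spanD(3)[OF assms(2) i] i by simp
qed (use block_spanD(1) assms in auto)

lemma vsmult_block_span:
  assumes "c \<in> carrier F" "t \<in> block_span"
  shows "vsmult F n c t \<in> block_span"
proof (rule block_spanI)
  fix i j assume ij: "i < q * (n div q)" "j < q * (n div q)" "i div q = j div q"
  show "vsmult F n c t i = vsmult F n c t j"
    using block_spanD(2)[OF assms(2) ij]
      order.strict_trans2[OF ij(1) blocks_le] order.strict_trans2[OF ij(2) blocks_le] by simp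
next
  fix i assume i: "i < n" "q * (n div q) \<le> i"
  show "vsmult F n c t i = \<zero>" using block_spanD(3)[OF assms(2) i] assms(1) i by simp
qed (use block_spanD(1) assms in auto)

lemma spreading_SU:
  assumes d: "d \<le> n div q"
  shows "spreading (SU F q n) d"
proof -
  let ?M = "vec_module F n"
  interpret form_space F ?M herm by (rule form_space_herm)
  have right: "herm x (c \<odot>\<^bsub>?M\<^esub> y) = conj c \<otimes> herm x y"
    if c: "c \<in> carrier F" and xy: "x \<in> carrier ?M" "y \<in> carrier ?M" for c x y
  proof -
    have M: "x \<in> nat_module F n" "y \<in> nat_module F n" "c \<odot>\<^bsub>?M\<^esub> y \<in> nat_module F n" using c xy by auto
    have "herm x (c \<odot>\<^bsub>?M\<^esub> y) = conj (c \<otimes> herm y x)"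
      unfolding herm_conj[OF M(3,1)] B_smult_left[OF c xy(2,1)] ..
    also have "\<dots> = conj c \<otimes> herm x y" using c M herm_conj[OF M(2,1)] by (simp add: conj_mult)
    finally show ?thesis .
  qed
  have bM: "t \<in> carrier ?M" if "t \<in> block_span" for t using block_spanD(1)[OF that] by simp
  have bsub: "additive_subgroup block_span ?M"
  proof (rule additive_subgroup_if_subspace)
    show "(\<lambda>i\<in>{..<n}. \<zero>) \<in> block_span"
      by (rule block_spanI) (use order.strict_trans2[OF _ blocks_le] in auto)
  qed (use vadd_block_span vsmult_block_span block_spanD(1) in auto)
  interpret isotropic_family F ?M herm "\<lambda>x. herm x x = \<zero>" block_span
  proof (intro isotropic_family.intro isotropic_family_axioms.intro form_space_herm bsub)
    show "c \<odot>\<^bsub>?M\<^esub> t \<in> block_span" if "c \<in> carrier F" "t \<in> block_span" for c t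
      using vsmult_block_span[OF that] by simp
  next
    fix x t assume x: "x \<in> carrier ?M" and t: "t \<in> block_span" and nz: "herm x t \<noteq> \<zero>"
    note tM = bM[OF t]
    have tx: "herm t x \<in> Units F" using nz B_reflexive[OF tM x] B_closed[OF tM x] by (auto simp: field_Units)
    have xx: "herm x x \<in> carrier F" "conj (herm x x) = herm x x"
      using herm_conj[of x x] x by auto
    obtain g where g: "g \<in> carrier F" "g \<oplus> conj g = \<ominus> herm x x"
      using ex_trace[of "\<ominus> herm x x"] xx by (auto simp: conj_neg)
    define c where "c = g \<otimes> inv (herm t x)"
    have c: "c \<in> carrier F" using g tx by (simp add: c_def)
    have cM: "c \<odot>\<^bsub>?M\<^esub> t \<in> carrier ?M" using c tM by (rule smult_closed)
    have ct: "herm (c \<odot>\<^bsub>?M\<^esub> t) x = g"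
      unfolding B_smult_left[OF c tM x] using g tx B_closed[OF tM x] by (simp add: c_def m_assoc)
    have xM: "x \<in> nat_module F n" "c \<odot>\<^bsub>?M\<^esub> t \<in> nat_module F n" using x cM by auto
    have tc: "herm x (c \<odot>\<^bsub>?M\<^esub> t) = conj g" unfolding herm_conj[OF xM(2,1)] ct ..
    have cc: "herm (c \<odot>\<^bsub>?M\<^esub> t) (c \<odot>\<^bsub>?M\<^esub> t) = \<zero>"
      unfolding B_smult_left[OF c tM cM] right[OF c tM tM] herm_block_span[OF t t] using c by simp
    have xc: "x \<oplus>\<^bsub>?M\<^esub> c \<odot>\<^bsub>?M\<^esub> t \<in> carrier ?M" using x cM by (rule M.add.m_closed)
    have "herm (x \<oplus>\<^bsub>?M\<^esub> c \<odot>\<^bsub>?M\<^esub> t) (x \<oplus>\<^bsub>?M\<^esub> c \<odot>\<^bsub>?M\<^esub> t) = (herm x x \<oplus> conj g) \<oplus> (g \<oplus> \<zero>)"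
      unfolding B_add_left[OF x cM xc] B_add_right[OF x x cM] B_add_right[OF cM x cM] ct tc cc ..
    also have "\<dots> = herm x x \<oplus> (g \<oplus> conj g)" using g(1) xx(1) by (simp add: F_a_ac)
    also have "\<dots> = \<zero>" unfolding g(2) using xx(1) by (simp add: F_r_neg)
    finally show "\<exists>c\<in>carrier F. herm (x \<oplus>\<^bsub>?M\<^esub> c \<odot>\<^bsub>?M\<^esub> t) (x \<oplus>\<^bsub>?M\<^esub> c \<odot>\<^bsub>?M\<^esub> t) = \<zero>" using c by blast
  next
    fix x s t assume x: "x \<in> carrier ?M" and s: "s \<in> block_span" and t: "t \<in> block_span"
      and y: "herm (x \<oplus>\<^bsub>?M\<^esub> s) (x \<oplus>\<^bsub>?M\<^esub> s) = \<zero>" and xt: "herm x t = \<zero>"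
    note sM = bM[OF s] and tM = bM[OF t]
    have yM: "x \<oplus>\<^bsub>?M\<^esub> s \<in> carrier ?M" using x sM by (rule M.add.m_closed)
    have yt: "herm (x \<oplus>\<^bsub>?M\<^esub> s) t = \<zero>" unfolding B_add_left[OF x sM tM] xt herm_block_span[OF s t] by simp
    have ytM: "(x \<oplus>\<^bsub>?M\<^esub> s) \<oplus>\<^bsub>?M\<^esub> t \<in> carrier ?M" using yM tM by (rule M.add.m_closed)
    show "herm ((x \<oplus>\<^bsub>?M\<^esub> s) \<oplus>\<^bsub>?M\<^esub> t) ((x \<oplus>\<^bsub>?M\<^esub> s) \<oplus>\<^bsub>?M\<^esub> t) = \<zero>"
      unfolding B_add_left[OF yM tM ytM] B_add_right[OF yM yM tM] B_add_right[OF tM yM tM] y yt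
        B_reflexive[OF yM tM yt] herm_block_span[OF t t] by simp
  qed (rule herm_block_span)
  have sub: "SU F q n \<subseteq> GL F n" by (auto simp: SU_def SL_def)
  have SU: "SU F q n = {f \<in> GL F n. op_det F n f = \<one> \<and> (\<forall>v\<in>nat_module F n. \<forall>w\<in>nat_module F n. herm (f v) (f w) = herm v w)}"
    by (auto simp: SU_def SL_def)
  have grp: "subgroup (SU F q n) Perm"
    unfolding SU by (rule subgroup_of_GL) (auto simp: op_det_compose op_det_one compose_def GL_closed
        cong: op_det_compose[unfolded compose_def])
  obtain a where a: "a \<in> carrier F" "a \<noteq> \<zero>" "conj a = \<ominus> a" using ex_skew by auto
  have tr: "transvection (a \<odot>\<^bsub>?M\<^esub> e) e \<in> SU F q n" if e: "e \<in> carrier ?M" and ee: "herm e e = \<zero>" for e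
  proof -
    let ?t = "transvection (a \<odot>\<^bsub>?M\<^esub> e) e"
    have aM: "a \<odot>\<^bsub>?M\<^esub> e \<in> carrier ?M" using a(1) e by (rule smult_closed)
    have ae: "herm (a \<odot>\<^bsub>?M\<^esub> e) e = \<zero>" unfolding B_smult_left[OF a(1) e e] ee using a by simp
    have t: "?t \<in> GL F n" using transvection_linear[OF aM e ae] by (simp add: linear_bijections_vec_module)
    have det: "op_det F n ?t = \<one>"
      using op_det_eq_one_if_pow_order[OF t] transvection_pow_order[OF aM e ae] by simp
    have "herm (?t y) (?t z) = herm y z" if y: "y \<in> nat_module F n" and z: "z \<in> nat_module F n" for y z
    proof -
      have yz: "y \<in> carrier ?M" "z \<in> carrier ?M" using y z by auto
      define b c where "b = herm y e \<otimes> a" and "c = herm z e \<otimes> a"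
      have bc: "b \<in> carrier F" "c \<in> carrier F" using B_closed[OF yz(1) e] B_closed[OF yz(2) e] a by (auto simp: b_def c_def)
      have cM: "c \<odot>\<^bsub>?M\<^esub> e \<in> carrier ?M" "b \<odot>\<^bsub>?M\<^esub> e \<in> carrier ?M" using bc e smult_closed by blast+
      have zc: "z \<oplus>\<^bsub>?M\<^esub> c \<odot>\<^bsub>?M\<^esub> e \<in> carrier ?M" using yz(2) cM(1) by (rule M.add.m_closed)
      have ty: "?t y = y \<oplus>\<^bsub>?M\<^esub> b \<odot>\<^bsub>?M\<^esub> e" and tz: "?t z = z \<oplus>\<^bsub>?M\<^esub> c \<odot>\<^bsub>?M\<^esub> e"
        using smult_assoc1[OF B_closed[OF yz(1) e] a(1) e] smult_assoc1[OF B_closed[OF yz(2) e] a(1) e] yz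
        unfolding transvection_def b_def c_def by (simp_all del: vec_module_simps)
      have eN: "e \<in> nat_module F n" using e by simp
      define h where "h = herm e z"
      have h: "h \<in> carrier F" using B_closed[OF e yz(2)] by (simp add: h_def)
      have cc: "conj c = \<ominus> (h \<otimes> a)"
        using herm_conj[OF z eN] h a B_closed[OF yz(2) e]
        by (simp add: c_def conj_mult h_def r_minus del: vec_module_simps)
      have yc: "herm y (c \<odot>\<^bsub>?M\<^esub> e) = \<ominus> (h \<otimes> b)"
        unfolding right[OF bc(2) yz(1) e] cc using h a B_closed[OF yz(1) e]
        by (simp add: b_def l_minus r_minus m_ac del: vec_module_simps)
      have ec: "herm e (c \<odot>\<^bsub>?M\<^esub> e) = \<zero>" unfolding right[OF bc(2) e e] ee using bc by simp
      have "herm (?t y) (?t z) = (herm y z \<oplus> \<ominus> (h \<otimes> b)) \<oplus> b \<otimes> (h \<oplus> \<zero>)"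
        unfolding ty tz B_add_left[OF yz(1) cM(2) zc] B_smult_left[OF bc(1) e zc]
          B_add_right[OF yz(1) yz(2) cM(1)] B_add_right[OF e yz(2) cM(1)] yc ec h_def[symmetric] ..
      also have "\<dots> = herm y z" using bc h B_closed[OF yz]
        by (simp add: F_a_assoc m_comm[of h b] F_l_neg del: vec_module_simps)
      finally show ?thesis .
    qed
    then show ?thesis using t det unfolding SU by blast
  qed
  show ?thesis
  proof (rule spreadingI[OF grp sub form_space_herm])
    fix A v assume A: "finite A" "A \<subseteq> nat_module F n" "v \<in> nat_module F n - cl A" "2 * card A + 2 < d"
    have Td: "order F ^ d \<le> card block_span"
      by (rule le_trans[OF power_increasing[OF d] card_block_span_ge]) (use order_gt_1 in auto)
    show "order F ^ d \<le> order F ^ (card A + 3) * card {u v | u. u \<in> stab (SU F q n) A}"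
      using finite_subset[OF sub] card_GL_le tr A
      by (intro big_orbit_of_singular_transvections[OF _ _ a(1,2) _ _ _ Td]) auto
  qed
qed

end

section \<open>Cycles, words and uniform tuples\<close>

lemma (in group) word_val_append:
  assumes h: "h \<in> tuples k (carrier G)" and "set u \<subseteq> letters k" "set w \<subseteq> letters k"
  shows "word_val G h (u @ w) = word_val G h u \<otimes> word_val G h w"
  using assms(2)
  by (induction u)
    (use assms in \<open>auto simp: m_assoc word_val_closed[OF h] letter_val_closed[OF h] simp del: letter_val.simps\<close>)

lemma inv_letter_in_letters: "s \<in> letters k \<Longrightarrow> inv_letter s \<in> letters k"
  by (cases s) auto

definition inv_word :: "letter list \<Rightarrow> letter list" where
  "inv_word w = rev (map inv_letter w)"

lemma set_inv_word: "set w \<subseteq> letters k \<Longrightarrow> set (inv_word w) \<subseteq> letters k"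
  using inv_letter_in_letters unfolding inv_word_def set_rev set_map image_subset_iff by blast

lemma reduced_inv_word: "reduced (inv_word w) \<longleftrightarrow> reduced w"
  unfolding inv_word_def successively_rev successively_map inv_letter_inv_letter
  by (rule successively_cong) auto

lemma (in group) word_val_inv_word:
  assumes h: "h \<in> tuples k (carrier G)" and w: "set w \<subseteq> letters k"
  shows "word_val G h (inv_word w) = inv (word_val G h w)"
  using w
proof (induction w)
  case (Cons s w)
  have s: "s \<in> letters k" and w: "set w \<subseteq> letters k" using Cons.prems by auto
  have "word_val G h (inv_word (s # w)) = word_val G h (inv_word w) \<otimes> word_val G h [inv_letter s]"
    unfolding inv_word_def
    using word_val_append[OF h set_inv_word[OF w], of "[inv_letter s]"] inv_letter_in_letters[OF s]
    by (simp add: inv_word_def)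
  also have "\<dots> = inv (word_val G h w) \<otimes> inv (letter_val G h s)"
    using Cons.IH[OF w] letter_val_inv_letter[OF h s] letter_val_closed[OF h s]
    by (simp del: letter_val.simps)
  also have "\<dots> = inv (word_val G h (s # w))"
    using letter_val_closed[OF h s] word_val_closed[OF h w]
    by (simp add: inv_mult_group del: letter_val.simps)
  finally show ?case .
qed (simp add: inv_word_def)

text \<open>
  Choose a generator different from the one in the last letter of \<open>w\<close>, which excludes cancellation on
  both sides of \<open>y\<close>, and its sign such that nothing cancels at the end either.
\<close>

lemma ex_reduced_commutator:
  assumes k: "k \<ge> 2" and w: "reduced w" "w \<noteq> []" "set w \<subseteq> letters k"
  shows "\<exists>y\<in>letters k. reduced (w @ y # inv_word w @ [inv_letter y])"
proof -
  obtain s t where st: "s = hd w" "t = last w" by blast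
  define j where "j = (if fst t = 0 then 1 else 0 :: nat)"
  define y where "y = (j, snd s \<or> fst s \<noteq> j)"
  have j: "j \<noteq> fst t" "j < k" using k by (auto simp: j_def)
  have y: "y \<in> letters k" using j by (simp add: y_def)
  have 1: "y \<noteq> inv_letter t" using j by (cases t) (auto simp: y_def)
  have 2: "inv_letter t \<noteq> inv_letter y" using j by (cases t) (auto simp: y_def)
  have 3: "inv_letter y \<noteq> inv_letter (inv_letter s)" by (cases s) (auto simp: y_def)
  have ends: "inv_word w \<noteq> []" "hd (inv_word w) = inv_letter t" "last (inv_word w) = inv_letter s"
    using w(2) st by (auto simp: inv_word_def hd_rev last_rev hd_map last_map)
  have "reduced (inv_word w @ [inv_letter y])"
    using 3 ends w(1) reduced_inv_word by (simp add: successively_append_iff del: inv_letter.simps)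
  then have "reduced (y # inv_word w @ [inv_letter y])"
    using 2 ends by (simp add: successively_Cons del: inv_letter.simps)
  then have "reduced (w @ y # inv_word w @ [inv_letter y])"
    using 1 w st by (simp add: successively_append_iff del: inv_letter.simps)
  then show ?thesis using y by blast
qed

text \<open>
  This turns the condition that \<open>w\<close> has a central value into the vanishing of a longer word.
\<close>

lemma (in group) central_commutator_word:
  assumes h: "h \<in> tuples k (carrier G)" and w: "set w \<subseteq> letters k" and y: "y \<in> letters k"
    and central: "word_val G h w \<in> center G"
  shows "word_val G h (w @ y # inv_word w @ [inv_letter y]) = \<one>"
proof -
  let ?W = "word_val G h w" let ?y = "letter_val G h y"
  have c: "?W \<in> carrier G" "?y \<in> carrier G" using word_val_closed[OF h w] letter_val_closed[OF h y] by auto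
  have comm: "?W \<otimes> ?y = ?y \<otimes> ?W" using central c by (auto simp: center_def)
  have "word_val G h (inv_word w @ [inv_letter y]) = inv ?W \<otimes> inv ?y"
    using word_val_append[OF h set_inv_word[OF w], of "[inv_letter y]"] inv_letter_in_letters[OF y]
      word_val_inv_word[OF h w] letter_val_inv_letter[OF h y] c by (simp del: letter_val.simps)
  moreover have "set (y # inv_word w @ [inv_letter y]) \<subseteq> letters k"
    using y set_inv_word[OF w] inv_letter_in_letters[OF y] by auto
  ultimately have "word_val G h (w @ y # inv_word w @ [inv_letter y]) = ?W \<otimes> (?y \<otimes> (inv ?W \<otimes> inv ?y))"
    using word_val_append[OF h w, of "y # inv_word w @ [inv_letter y]"] by simp
  also have "\<dots> = (?W \<otimes> ?y) \<otimes> inv (?y \<otimes> ?W)" using c by (simp add: inv_mult_group m_assoc)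
  also have "\<dots> = \<one>" using comm c by simp
  finally show ?thesis .
qed

lemma (in group_hom) word_val_map:
  assumes h: "x \<in> tuples k (carrier G)" and w: "set w \<subseteq> letters k"
  shows "word_val H (map h x) w = h (word_val G x w)"
  using w
proof (induction w)
  case (Cons s w)
  obtain j b where s: "s = (j, b)" by (cases s)
  have j: "j < k" using Cons.prems s by simp
  have xj: "x ! j \<in> carrier G" "map h x ! j = h (x ! j)"
    using assms(1) j tuples_nth[OF assms(1) j] by (auto simp: tuples_def)
  have "letter_val H (map h x) s = h (letter_val G x s)" using xj by (simp add: s)
  moreover have "word_val G x w \<in> carrier G" "letter_val G x s \<in> carrier G"
    using Cons.prems G.word_val_closed[OF assms(1), of w] G.letter_val_closed[OF assms(1), of s] by auto
  ultimately show ?case using Cons by (simp del: letter_val.simps)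
qed simp

text \<open>
  Read off the labels along the cycle. If a label were followed by its inverse, the cycle would return to
  a vertex after two steps, which is impossible for length at least 3; a cycle of length 1 gives a
  word of one letter.
\<close>

lemma (in group) cycle_gives_word:
  assumes S: "S \<in> tuples k (carrier G)" and c: "is_cycle (cayley_adj G S) c"
  shows "\<exists>w. reduced w \<and> length w = length c \<and> w \<noteq> [] \<and> set w \<subseteq> letters k \<and> word_val G S w = \<one>"
proof -
  define m where "m = length c"
  have m: "m \<noteq> 0" "m \<noteq> 2" "distinct c" using c by (auto simp: is_cycle_def m_def)
  have adj: "cayley_adj G S (c ! i) (c ! (Suc i mod m))" if "i < m" for i
    using c that by (auto simp: is_cycle_def m_def)
  have "\<exists>s\<in>letters k. c ! (Suc i mod m) = c ! i \<otimes> letter_val G S s" if i: "i < m" for i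
  proof -
    obtain g where g: "g \<in> set S" "c ! (Suc i mod m) = c ! i \<otimes> g \<or> c ! (Suc i mod m) = c ! i \<otimes> inv g"
      using adj[OF i] by (auto simp: cayley_adj_def)
    obtain j where j: "j < k" "S ! j = g" using g(1) S by (auto simp: in_set_conv_nth tuples_def)
    show ?thesis
    proof (cases "c ! (Suc i mod m) = c ! i \<otimes> g")
      case True
      then show ?thesis using j by (intro bexI[of _ "(j, True)"]) auto
    next
      case False
      then show ?thesis using j g(2) by (intro bexI[of _ "(j, False)"]) auto
    qed
  qed
  then obtain s where s: "\<And>i. i < m \<Longrightarrow> s i \<in> letters k"
      "\<And>i. i < m \<Longrightarrow> c ! (Suc i mod m) = c ! i \<otimes> letter_val G S (s i)" by metis
  have cG: "c ! i \<in> carrier G" if "i < m" for i using adj[OF that] by (simp add: cayley_adj_def)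
  define w where "w = map s [0..<m]"
  have lets: "set (map s [0..<j]) \<subseteq> letters k" if "j \<le> m" for j
    unfolding set_map set_upt image_subset_iff using s(1) that by simp
  have w: "set w \<subseteq> letters k" using lets[of m] by (simp add: w_def)
  have "j \<le> m \<Longrightarrow> c ! 0 \<otimes> word_val G S (map s [0..<j]) = c ! (j mod m)" for j
  proof (induction j)
    case 0
    show ?case using cG[of 0] m by simp
  next
    case (Suc j)
    have lets: "set (map s [0..<j]) \<subseteq> letters k" "set [s j] \<subseteq> letters k"
      using lets[of j] s(1)[of j] Suc.prems by auto
    have "word_val G S (map s [0..<Suc j]) = word_val G S (map s [0..<j]) \<otimes> letter_val G S (s j)"
      using word_val_append[OF S lets] letter_val_closed[OF S s(1)[of j]] Suc.prems
      by (simp del: letter_val.simps)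
    then have "c ! 0 \<otimes> word_val G S (map s [0..<Suc j]) = c ! j \<otimes> letter_val G S (s j)"
      using Suc cG[of 0] m word_val_closed[OF S lets(1)] letter_val_closed[OF S s(1)[of j]]
      by (simp add: m_assoc[symmetric] del: letter_val.simps)
    also have "\<dots> = c ! (Suc j mod m)" using s(2)[of j] Suc.prems by simp
    finally show ?case .
  qed
  from this[of m] have "c ! 0 \<otimes> word_val G S w = c ! 0" by (simp add: w_def)
  then have one: "word_val G S w = \<one>" using cG[of 0] m word_val_closed[OF S w] by (simp add: l_cancel_one)
  have "reduced w"
    unfolding successively_conv_nth
  proof (intro allI impI notI)
    fix i assume i: "Suc i < length w" and eq: "w ! Suc i = inv_letter (w ! i)"
    have i': "Suc i < m" "i < m" using i by (auto simp: w_def)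
    have wi: "w ! i = s i" "w ! Suc i = s (Suc i)" using i' by (auto simp: w_def simp del: upt_Suc)
    have lc: "letter_val G S (s i) \<in> carrier G" by (rule letter_val_closed[OF S s(1)[OF i'(2)]])
    have "c ! (Suc (Suc i) mod m) = c ! Suc i \<otimes> letter_val G S (s (Suc i))" using s(2)[OF i'(1)] .
    also have "c ! Suc i = c ! i \<otimes> letter_val G S (s i)" using s(2)[OF i'(2)] i'(1) by simp
    also have "letter_val G S (s (Suc i)) = inv (letter_val G S (s i))"
      using eq letter_val_inv_letter[OF S s(1)[OF i'(2)]] unfolding wi by simp
    finally have "c ! (Suc (Suc i) mod m) = c ! i" using lc cG[OF i'(2)] by (simp add: m_assoc)
    then have "Suc (Suc i) mod m = i" using m i' by (simp add: nth_eq_iff_index_eq m_def)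
    moreover have "Suc (Suc i) mod m \<noteq> i"
    proof (cases "Suc (Suc i) < m")
      case False
      then have "Suc (Suc i) = m" using i'(1) by simp
      then show ?thesis using m i' by auto
    qed simp
    ultimately show False by simp
  qed
  then show ?thesis using one w m by (intro exI[of _ w]) (auto simp: w_def m_def)
qed

lemma girth_gt:
  assumes "\<And>c. is_cycle E c \<Longrightarrow> length c > l"
  shows "girth E > enat l"
proof -
  have "enat (Suc l) \<le> girth E" unfolding girth_def by (rule INF_greatest) (use assms in \<open>auto simp: Suc_le_eq\<close>)
  then show ?thesis by (meson enat_ord_simps(2) less_le_trans lessI)
qed

lemma pmf_replicate_pmf:
  "length xs = k \<Longrightarrow> pmf (replicate_pmf k p) xs = prod_list (map (pmf p) xs)"
proof (induction k arbitrary: xs)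
  case (Suc k)
  then obtain y ys where xs: "xs = y # ys" "length ys = k" by (cases xs) auto
  have eq: "replicate_pmf (Suc k) p = map_pmf (\<lambda>(x, zs). x # zs) (pair_pmf p (replicate_pmf k p))"
    by (simp add: pair_pmf_def map_bind_pmf)
  have inj: "inj (\<lambda>(x, zs). x # zs)" by (auto simp: inj_def)
  have "pmf (replicate_pmf (Suc k) p) xs = pmf (pair_pmf p (replicate_pmf k p)) (y, ys)"
    unfolding eq xs(1) using pmf_map_inj'[OF inj, of "pair_pmf p (replicate_pmf k p)" "(y, ys)"] by simp
  then show ?case using Suc.IH[OF xs(2)] xs(1) by (simp add: pmf_pair)
qed simp

lemma replicate_pmf_of_set:
  assumes A: "finite A" "A \<noteq> {}"
  shows "replicate_pmf k (pmf_of_set A) = pmf_of_set (tuples k A)"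
proof (rule pmf_eqI)
  fix xs
  have T: "finite (tuples k A)" by (rule finite_tuples[OF A(1)])
  obtain a where "a \<in> A" using A by auto
  then have ne: "replicate k a \<in> tuples k A" by (auto simp: tuples_def)
  have card: "card (tuples k A) = card A ^ k" unfolding tuples_def by (rule card_lists_length_eq[OF A(1)])
  show "pmf (replicate_pmf k (pmf_of_set A)) xs = pmf (pmf_of_set (tuples k A)) xs"
  proof (cases "xs \<in> tuples k A")
    case True
    then have xs: "length xs = k" "set xs \<subseteq> A" by (auto simp: tuples_def)
    have "prod_list (map (pmf (pmf_of_set A)) xs) = (1 / card A) ^ length xs"
      using xs(2) A by (induction xs) auto
    then show ?thesis using pmf_replicate_pmf[OF xs(1)] xs True T ne card A by (subst pmf_of_set) (auto simp: power_one_over)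
  next
    case False
    then have "xs \<notin> set_pmf (replicate_pmf k (pmf_of_set A))"
      using A by (auto simp: set_replicate_pmf tuples_def)
    then show ?thesis using False T ne by (subst pmf_of_set) (auto simp: set_pmf_iff)
  qed
qed

lemma (in group) normal_center: "center G \<lhd> G"
proof (rule normal_invI)
  show "subgroup (center G) G"
  proof (rule subgroupI)
    fix a assume a: "a \<in> center G"
    then have aG: "a \<in> carrier G" by (simp add: center_def)
    have "inv a \<otimes> g = g \<otimes> inv a" if g: "g \<in> carrier G" for g
    proof -
      have "inv a \<otimes> g = inv a \<otimes> (g \<otimes> a) \<otimes> inv a" using aG g by (simp add: m_assoc)
      also have "g \<otimes> a = a \<otimes> g" using a g by (simp add: center_def)
      also have "inv a \<otimes> (a \<otimes> g) \<otimes> inv a = g \<otimes> inv a" using aG g by (simp add: m_assoc[symmetric])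
      finally show ?thesis .
    qed
    then show "inv a \<in> center G" using aG by (simp add: center_def)
  next
    fix a b assume ab: "a \<in> center G" "b \<in> center G"
    then have c: "a \<in> carrier G" "b \<in> carrier G" by (auto simp: center_def)
    have "a \<otimes> b \<otimes> g = g \<otimes> (a \<otimes> b)" if g: "g \<in> carrier G" for g
    proof -
      have "a \<otimes> g = g \<otimes> a" "b \<otimes> g = g \<otimes> b" using ab g unfolding center_def by blast+
      moreover have "a \<otimes> b \<otimes> g = a \<otimes> (b \<otimes> g)" "a \<otimes> (g \<otimes> b) = a \<otimes> g \<otimes> b"
        "g \<otimes> a \<otimes> b = g \<otimes> (a \<otimes> b)" using c g by (simp_all only: m_assoc)
      ultimately show ?thesis by metis
    qed
    then show "a \<otimes> b \<in> center G" using c by (simp add: center_def)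
  qed (auto simp: center_def)
  fix x h assume x: "x \<in> carrier G" and h: "h \<in> center G"
  have hG: "h \<in> carrier G" using h by (simp add: center_def)
  have "x \<otimes> h = h \<otimes> x" using h x by (simp add: center_def)
  then have "x \<otimes> h \<otimes> inv x = h" using x hG by (simp add: m_assoc)
  then show "x \<otimes> h \<otimes> inv x \<in> center G" using h by simp
qed

text \<open>
  All cosets have the same size, so the image of a uniform element is uniform.
\<close>

lemma (in normal) map_pmf_rcoset:
  assumes fin: "finite (carrier G)"
  shows "map_pmf (\<lambda>x. H #> x) (pmf_of_set (carrier G)) = pmf_of_set (carrier (G Mod H))"
proof (rule pmf_eqI)
  fix C
  have ne: "carrier G \<noteq> {}" by auto
  have carr: "carrier (G Mod H) = (\<lambda>x. H #> x) ` carrier G" by (auto simp: FactGroup_def RCOSETS_def)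
  have finM: "finite (carrier (G Mod H))" "carrier (G Mod H) \<noteq> {}" using fin ne by (auto simp: carr)
  have finH: "finite H" using subset fin finite_subset by blast
  have "\<one> \<in> H" by (rule subgroup.one_closed[OF is_subgroup])
  then have cH: "card H > 0" by (metis card_gt_0_iff empty_iff finH)
  have lag: "card (rcosets H) * card H = card (carrier G)"
    using lagrange[OF is_subgroup] by (simp add: order_def)
  show "pmf (map_pmf (\<lambda>x. H #> x) (pmf_of_set (carrier G))) C = pmf (pmf_of_set (carrier (G Mod H))) C"
  proof (cases "C \<in> carrier (G Mod H)")
    case True
    then obtain x where x: "x \<in> carrier G" "C = H #> x" by (auto simp: carr)
    have "carrier G \<inter> (\<lambda>x. H #> x) -` {C} = C"
    proof (intro Set.set_eqI iffI)
      fix y assume "y \<in> carrier G \<inter> (\<lambda>x. H #> x) -` {C}"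
      then have "y \<in> carrier G" "H #> y = C" by auto
      then show "y \<in> C" using rcos_self is_subgroup by blast
    next
      fix y assume y: "y \<in> C"
      have "y \<in> carrier G" using y x r_coset_subset_G[OF subset x(1)] by auto
      moreover have "H #> x = H #> y" by (rule repr_independence) (use y x is_subgroup in auto)
      ultimately show "y \<in> carrier G \<inter> (\<lambda>x. H #> x) -` {C}" using x(2) by simp
    qed
    moreover have "card C = card H"
      using card_rcosets_equal[OF rcosetsI[OF subset x(1)] subset] x(2) by simp
    ultimately have "pmf (map_pmf (\<lambda>x. H #> x) (pmf_of_set (carrier G))) C = card H / card (carrier G)"
      unfolding pmf_map using fin ne by (simp add: measure_pmf_of_set)
    also have "\<dots> = 1 / card (rcosets H)" using cH lag by (simp flip: lag)
    finally show ?thesis using True finM by (simp add: FactGroup_def)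
  next
    case False
    then have "C \<notin> (\<lambda>x. H #> x) ` set_pmf (pmf_of_set (carrier G))" using fin ne by (simp add: carr)
    then show ?thesis using False finM by (simp add: pmf_map_outside)
  qed
qed

lemma map_replicate_pmf: "map_pmf (map f) (replicate_pmf k p) = replicate_pmf k (map_pmf f p)"
proof (induction k)
  case (Suc k)
  have rep: "replicate_pmf (Suc k) r = r \<bind> (\<lambda>x. map_pmf ((#) x) (replicate_pmf k r))" for r :: "'z pmf"
    by (simp add: map_pmf_def)
  show ?case unfolding rep Suc.IH[symmetric]
    by (simp add: map_bind_pmf bind_map_pmf pmf.map_comp o_def)
qed simp

section \<open>Girth of random Cayley graphs of classical groups\<close>

text \<open>
  The general estimate for walks, with orbits of size at least \<open>|F|\<^bsup>d - L - 3\<^esup>\<close>.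
\<close>

lemma (in coordinate_space) card_vanishing_words_le:
  assumes sp: "spreading H d" and n: "n > 0" and L: "2 * L + 2 < d"
    and w: "reduced w" "w \<noteq> []" "length w \<le> L" "set w \<subseteq> letters k"
  defines "HH \<equiv> Perm\<lparr>carrier := H\<rparr>"
  shows "real (card {h \<in> tuples k H. word_val HH h w = \<one>\<^bsub>HH\<^esub>})
    \<le> real L * real (order F) ^ L * real (order F) ^ (L + 3) / real (order F) ^ d * card (tuples k H)"
proof -
  let ?Q = "order F" let ?V = "nat_module F n"
  interpret P: group Perm by (rule group_BijGroup)
  have H: "subgroup H Perm" "H \<subseteq> GL F n" using sp by (auto simp: spreading_def)
  interpret H: subgroup H Perm by (rule H(1))
  have grpH: "group HH" unfolding HH_def by (rule P.subgroup_imp_group[OF H(1)])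
  have "(\<lambda>u. u) \<in> hom HH Perm"
    unfolding HH_def by (rule homI) (simp_all add: H.mem_carrier)
  then interpret act: group_action HH ?V "\<lambda>u. u"
    by (intro group_action.intro group_hom.intro group_hom_axioms.intro grpH P.group_axioms)
  obtain cl where "spreading_closure H d cl" using sp unfolding spreading_def by (elim conjE exE)
  note cl = spreading_closureD[OF this]
  have "card {\<zero>, \<one>} \<le> ?Q" unfolding order_def using finite_field by (intro card_mono) auto
  then have Q: "?Q \<ge> 2" by simp
  define R where "R = real ?Q ^ d / real ?Q ^ (L + 3)"
  have R: "R > 0" using Q by (simp add: R_def)
  have HG: "carrier HH = H" by (simp add: HH_def)
  have fixer: "act.fixer A = stab H A" for A unfolding act.fixer_def stab_def HG ..
  have "real (card {h \<in> tuples k (carrier HH). word_val HH h w = \<one>\<^bsub>HH\<^esub>})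
      \<le> real L * real ?Q ^ L / R * real (card (tuples k (carrier HH)))"
  proof (rule act.card_trapped_le[where x = "unit_vec F n 0" and cl = cl])
    show "finite (carrier HH)" unfolding HG by (rule finite_subset[OF H(2) conjunct1[OF card_GL_le]])
    show "unit_vec F n 0 \<in> ?V" by simp
    show "unit_vec F n 0 \<notin> cl {}"
    proof
      assume "unit_vec F n 0 \<in> cl {}"
      then have "unit_vec F n 0 0 = \<zero>" using n cl(5) by simp
      then show False using n by simp
    qed
    show "finite (cl A) \<and> card (cl A) \<le> ?Q ^ card A" if "A \<subseteq> ?V" for A
      using cl(3,4)[OF that] finite_nat_module finite_subset by blast
    show "1 \<le> ?Q" using Q by simp
    fix A y assume A: "A \<subseteq> ?V" "card A \<le> L" and y: "y \<in> ?V - cl A"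
    have "?Q ^ d \<le> ?Q ^ (card A + 3) * card {u y | u. u \<in> stab H A}" using cl(6)[OF A(1) y] A(2) L by simp
    also have "\<dots> \<le> ?Q ^ (L + 3) * card {u y | u. u \<in> stab H A}"
      using Q A(2) by (intro mult_right_mono power_increasing) auto
    finally have "real (?Q ^ d) \<le> real (?Q ^ (L + 3) * card {u y | u. u \<in> stab H A})" by (rule of_nat_mono)
    then show "R \<le> real (card {u y | u. u \<in> act.fixer A})"
      unfolding R_def fixer using Q by (simp add: divide_le_eq mult.commute)
  qed (use cl w R in auto)
  also have "real L * real ?Q ^ L / R = real L * real ?Q ^ L * real ?Q ^ (L + 3) / real ?Q ^ d"
    by (simp add: R_def)
  finally show ?thesis by (simp add: HG)
qed

lemma card_words_le: "card {w. set w \<subseteq> letters k \<and> length w \<le> l} \<le> (l + 1) * (2 * k) ^ l" if "k > 0"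
proof -
  have c: "card (letters k) = 2 * k" by (simp add: card_cartesian_product)
  have "card {w. set w \<subseteq> letters k \<and> length w \<le> l} = (\<Sum>i\<le>l. (2 * k) ^ i)"
    using card_lists_length_le[of "letters k" l] c by simp
  also have "\<dots> \<le> (\<Sum>i\<le>l. (2 * k) ^ l)" using that by (intro sum_mono power_increasing) auto
  finally show ?thesis by simp
qed

text \<open>
  A union bound over the reduced words of length at most \<open>l\<close>, each replaced by a commutator word of length
  at most \<open>2 l + 2\<close> that vanishes in the linear group, for uniform tuples lifted to this group.
\<close>

lemma (in coordinate_space) prob_short_cycle_le:
  assumes sp: "spreading H d" and n: "n > 0" and k: "k \<ge> 2" and l: "2 * (2 * l + 2) + 2 < d"
  defines "G \<equiv> proj_group F n H"
  shows "measure_pmf.prob (replicate_pmf k (pmf_of_set (carrier G)))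
      {S. \<exists>c. is_cycle (cayley_adj G S) c \<and> length c \<le> l}
    \<le> real ((l + 1) * (2 * k) ^ l) *
      (real (2 * l + 2) * real (order F) ^ (2 * l + 2) * real (order F) ^ (2 * l + 5) / real (order F) ^ d)"
proof -
  define HH where "HH = Perm\<lparr>carrier := H\<rparr>"
  define C where "C = center HH"
  let ?pi = "\<lambda>x. C #>\<^bsub>HH\<^esub> x"
  let ?c = "real (2 * l + 2) * real (order F) ^ (2 * l + 2) * real (order F) ^ (2 * l + 5) / real (order F) ^ d"
  interpret P: group Perm by (rule group_BijGroup)
  have H: "subgroup H Perm" "H \<subseteq> GL F n" using sp by (auto simp: spreading_def)
  interpret HH: group HH unfolding HH_def by (rule P.subgroup_imp_group[OF H(1)])
  interpret N: normal C HH unfolding C_def by (rule HH.normal_center)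
  have G: "G = HH Mod C" by (simp add: G_def proj_group_def HH_def C_def Let_def)
  interpret GG: group G unfolding G by (rule N.factorgroup_is_group)
  interpret pi: group_hom HH G ?pi
    unfolding G by (intro group_hom.intro group_hom_axioms.intro HH.group_axioms N.factorgroup_is_group N.r_coset_hom_Mod)
  have HG: "carrier HH = H" by (simp add: HH_def)
  have finH: "finite H" "H \<noteq> {}"
    using finite_subset[OF H(2) conjunct1[OF card_GL_le]] HH.one_closed HG by auto
  have T: "finite (tuples k H)" by (rule finite_tuples[OF finH(1)])
  obtain a where "a \<in> H" using finH by auto
  then have "replicate k a \<in> tuples k H" by (auto simp: tuples_def)
  then have Tne: "tuples k H \<noteq> {}" by auto
  let ?bad = "{S. \<exists>c. is_cycle (cayley_adj G S) c \<and> length c \<le> l}"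
  define W where "W = {w. reduced w \<and> w \<noteq> [] \<and> set w \<subseteq> letters k \<and> length w \<le> l}"
  have "\<exists>y. \<forall>w\<in>W. y w \<in> letters k \<and> reduced (w @ y w # inv_word w @ [inv_letter (y w)])"
    using ex_reduced_commutator[OF k] unfolding W_def by (intro bchoice) blast
  then obtain y where y: "\<And>w. w \<in> W \<Longrightarrow> y w \<in> letters k"
      "\<And>w. w \<in> W \<Longrightarrow> reduced (w @ y w # inv_word w @ [inv_letter (y w)])" by blast
  define comm where "comm w = w @ y w # inv_word w @ [inv_letter (y w)]" for w
  have subW: "W \<subseteq> {w. set w \<subseteq> letters k \<and> length w \<le> l}" by (auto simp: W_def)
  have finW': "finite {w. set w \<subseteq> letters k \<and> length w \<le> l}" by (rule finite_lists_length_le) simp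
  have finW: "finite W" by (rule finite_subset[OF subW finW'])
  have cardW: "card W \<le> (l + 1) * (2 * k) ^ l"
    using card_mono[OF finW' subW] card_words_le[of k l] k by linarith
  have sub: "tuples k H \<inter> map ?pi -` ?bad \<subseteq> (\<Union>w\<in>W. {h \<in> tuples k H. word_val HH h (comm w) = \<one>\<^bsub>HH\<^esub>})"
  proof
    fix h assume h: "h \<in> tuples k H \<inter> map ?pi -` ?bad"
    then have hT: "h \<in> tuples k (carrier HH)" by (simp add: HG)
    obtain c where c: "is_cycle (cayley_adj G (map ?pi h)) c" "length c \<le> l" using h by auto
    have "map ?pi h \<in> tuples k (carrier G)" using hT by (auto simp: tuples_def intro!: pi.hom_closed)
    from GG.cycle_gives_word[OF this c(1)] obtain w where w: "reduced w" "length w = length c" "w \<noteq> []"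
        "set w \<subseteq> letters k" "word_val G (map ?pi h) w = \<one>\<^bsub>G\<^esub>" by blast
    have wW: "w \<in> W" using w c(2) by (simp add: W_def)
    have "?pi (word_val HH h w) = C" using pi.word_val_map[OF hT w(4)] w(5) by (simp add: G)
    then have "word_val HH h w \<in> center HH"
      using HH.rcos_self[OF HH.word_val_closed[OF hT w(4)] N.is_subgroup] by (simp add: C_def)
    then have "word_val HH h (comm w) = \<one>\<^bsub>HH\<^esub>"
      unfolding comm_def using HH.central_commutator_word[OF hT w(4) y(1)[OF wW]] by blast
    then show "h \<in> (\<Union>w\<in>W. {h \<in> tuples k H. word_val HH h (comm w) = \<one>\<^bsub>HH\<^esub>})" using wW h by blast
  qed
  have each: "real (card {h \<in> tuples k H. word_val HH h (comm w) = \<one>\<^bsub>HH\<^esub>}) \<le> ?c * card (tuples k H)" if w: "w \<in> W" for w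
  proof -
    have "set w \<subseteq> letters k" using w by (simp add: W_def)
    then have lets: "set (comm w) \<subseteq> letters k"
      using y(1)[OF w] set_inv_word inv_letter_in_letters[OF y(1)[OF w]] by (auto simp: comm_def)
    have len: "length (comm w) \<le> 2 * l + 2" using w by (simp add: comm_def inv_word_def W_def)
    have red: "reduced (comm w)" "comm w \<noteq> []" using y(2)[OF w] by (simp_all add: comm_def)
    have "2 * l + 2 + 3 = 2 * l + 5" by simp
    then show ?thesis
      using card_vanishing_words_le[OF sp n l red len lets] unfolding HH_def by metis
  qed
  define V where "V w = {h \<in> tuples k H. word_val HH h (comm w) = \<one>\<^bsub>HH\<^esub>}" for w
  have finU: "finite (\<Union>w\<in>W. V w)" using finW T by (intro finite_UN_I) (auto simp: V_def)
  have "card (tuples k H \<inter> map ?pi -` ?bad) \<le> card (\<Union>w\<in>W. V w)"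
    by (rule card_mono[OF finU sub[folded V_def]])
  also have "\<dots> \<le> (\<Sum>w\<in>W. card (V w))" by (rule card_UN_le[OF finW])
  finally have "real (card (tuples k H \<inter> map ?pi -` ?bad)) \<le> real (\<Sum>w\<in>W. card (V w))" by (rule of_nat_mono)
  also have "\<dots> \<le> (\<Sum>w\<in>W. ?c * card (tuples k H))" unfolding of_nat_sum by (intro sum_mono each[folded V_def])
  also have "\<dots> = real (card W) * (?c * card (tuples k H))" by simp
  also have "\<dots> \<le> real ((l + 1) * (2 * k) ^ l) * (?c * card (tuples k H))"
    using cardW by (intro mult_right_mono of_nat_mono) auto
  finally have main: "real (card (tuples k H \<inter> map ?pi -` ?bad)) \<le> real ((l + 1) * (2 * k) ^ l) * ?c * card (tuples k H)"
    by (simp only: mult.assoc)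
  have "replicate_pmf k (pmf_of_set (carrier G)) = map_pmf (map ?pi) (pmf_of_set (tuples k H))"
    unfolding G N.map_pmf_rcoset[unfolded HG, OF finH(1), symmetric] replicate_pmf_of_set[OF finH, symmetric]
    by (rule map_replicate_pmf[symmetric])
  then have "measure_pmf.prob (replicate_pmf k (pmf_of_set (carrier G))) ?bad =
      card (tuples k H \<inter> map ?pi -` ?bad) / card (tuples k H)"
    using T Tne by (simp add: measure_pmf_of_set)
  also have "\<dots> \<le> real ((l + 1) * (2 * k) ^ l) * ?c"
    using main T Tne by (simp add: divide_le_eq card_gt_0_iff)
  finally show ?thesis .
qed

lemma (in coordinate_space) order_proj_group_le:
  assumes "spreading H d"
  shows "order (proj_group F n H) \<le> order F ^ (n * n)"
proof -
  have H: "H \<subseteq> GL F n" using assms by (auto simp: spreading_def)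
  have finH: "finite H" by (rule finite_subset[OF H conjunct1[OF card_GL_le]])
  define HH where "HH = Perm\<lparr>carrier := H\<rparr>"
  have "carrier (proj_group F n H) = (\<lambda>x. center HH #>\<^bsub>HH\<^esub> x) ` H"
    by (auto simp: proj_group_def FactGroup_def RCOSETS_def HH_def Let_def)
  then have "order (proj_group F n H) \<le> card H" unfolding order_def using finH by (simp add: card_image_le)
  also have "\<dots> \<le> order F ^ (n * n)" using card_mono[OF _ H] card_GL_le by (meson le_trans)
  finally show ?thesis .
qed

lemma Cl_spreading:
  assumes G: "G \<in> Cl n q" and q: "primepow q" and n: "n \<ge> 2" and d: "d \<le> n div q - 1"
  shows "\<exists>(F :: nat ring) H. coordinate_space F \<and> coordinate_space.spreading F n H d \<and> G = proj_group F n H \<and>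
    (order F = q \<or> order F = q\<^sup>2)"
proof -
  obtain F :: "nat ring" where F: "field F" "finite (carrier F)"
    and cases: "order F = q \<and>
        (G = PSL F n \<or> even n \<and> G = PSp F n \<or> odd n \<and> odd q \<and> G = POmega_odd F n \<or>
         even n \<and> G = POmega_plus F n \<or>
         even n \<and> (\<exists>z. anisotropic_param F z \<and> G = POmega_minus F z n)) \<or>
      order F = q\<^sup>2 \<and> G = PSU F q n"
    using G unfolding Cl_def by blast
  interpret coordinate_space F n
    by (intro coordinate_space.intro coordinate_space_axioms.intro F)
  have q2: "q \<ge> 2" using primepow_gt_Suc_0[OF q] by simp
  have le: "n div q \<le> n div 2" "n div q \<le> n" using q2 by (auto intro: div_le_mono2)
  have dn: "d \<le> n" "d \<le> n div 2 - 1" "d \<le> n div 2" "d \<le> n div q" using d le by linarith+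
  have "\<exists>H. spreading H d \<and> G = proj_group F n H"
    using cases
  proof (elim disjE conjE exE)
    assume "order F = q\<^sup>2" "G = PSU F q n"
    interpret unitary_space F n q by unfold_locales (use q \<open>order F = q\<^sup>2\<close> in auto)
    show ?thesis using spreading_SU[OF dn(4)] \<open>G = PSU F q n\<close> by (auto simp: PSU_def)
  qed (use spreading_SL[OF dn(1)] spreading_Sp[OF _ dn(1)] spreading_Omega_odd[OF _ dn(3)]
      spreading_Omega_plus[OF _ dn(3)] spreading_Omega_minus[OF _ n dn(2)] in
      \<open>auto simp: PSL_def PSp_def POmega_odd_def POmega_plus_def POmega_minus_def\<close>)
  then show ?thesis using cases coordinate_space_axioms by blast
qed

text \<open>
  All factors are compared with powers of \<open>Q\<close>.
\<close>

lemma probability_bound_le: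
  assumes Q: "Q \<ge> (2 :: nat)" and d: "(2 * k + 6) * l + 8 + t \<le> d"
  shows "real ((l + 1) * (2 * k) ^ l) * (real (2 * l + 2) * real Q ^ (2 * l + 2) * real Q ^ (2 * l + 5) / real Q ^ d)
    \<le> (1 / 2) ^ t"
proof -
  have lt: "m + 1 \<le> 2 ^ m" for m :: nat by (induction m) auto
  have pow: "2 ^ m \<le> Q ^ m" for m using Q by (intro power_mono) auto
  have a: "l + 1 \<le> Q ^ l" using lt pow le_trans by blast
  have b: "2 * l + 2 \<le> Q ^ (l + 1)" using lt[of l] pow[of "l + 1"] by simp
  have "2 * k \<le> 2 ^ (2 * k)" using lt[of "2 * k"] by simp
  then have c: "(2 * k) ^ l \<le> Q ^ (2 * k * l)"
    using power_mono[of "2 * k" "2 ^ (2 * k)" l] pow[of "2 * k * l"] by (simp add: power_mult)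
  have "((l + 1) * (2 * k) ^ l) * ((2 * l + 2) * Q ^ (2 * l + 2) * Q ^ (2 * l + 5)) * 2 ^ t
      \<le> (Q ^ l * Q ^ (2 * k * l)) * (Q ^ (l + 1) * Q ^ (2 * l + 2) * Q ^ (2 * l + 5)) * Q ^ t"
    by (intro mult_le_mono a b c pow order_refl)
  also have "\<dots> = Q ^ (l + 2 * k * l + (l + 1 + (2 * l + 2) + (2 * l + 5)) + t)" by (simp only: power_add)
  also have "\<dots> \<le> Q ^ d" using d Q by (intro power_increasing) (auto simp: algebra_simps)
  finally have "real (((l + 1) * (2 * k) ^ l) * ((2 * l + 2) * Q ^ (2 * l + 2) * Q ^ (2 * l + 5)) * 2 ^ t) \<le> real (Q ^ d)"
    by (rule of_nat_mono)
  then have "real ((l + 1) * (2 * k) ^ l) * (real (2 * l + 2) * real Q ^ (2 * l + 2) * real Q ^ (2 * l + 5)) * 2 ^ t \<le> real Q ^ d"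
    by (simp only: of_nat_mult of_nat_power of_nat_numeral)
  then show ?thesis using Q by (simp add: field_simps power_divide)
qed

text \<open>
  With \<open>m = n div q\<close>, the hypotheses give \<open>100 k l \<le> m\<close> and \<open>4 t \<le> m\<close>; the latter since \<open>m + 1 \<le> 4 t\<close> would
  imply \<open>q \<le> 4 t\<close> and thus \<open>n < 16 t\<^sup>2\<close>.
\<close>

lemma dimension_bound:
  fixes k l n q t :: nat
  assumes "50 * k * q\<^sup>2 * l \<le> n" "l \<ge> 1" "k \<ge> 2" "q \<ge> 2" "16 * t\<^sup>2 < n"
  shows "(2 * k + 6) * l + 8 + t \<le> n div q - 1"
proof -
  define m where "m = n div q"
  define x where "x = k * l"
  have nm: "n < q * (m + 1)" using assms(4) dividend_less_times_div[of q n] by (simp add: m_def)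
  have "q * (50 * x * q) < q * (m + 1)" using assms(1) nm by (simp add: x_def power2_eq_square mult_ac)
  then have xm: "50 * x * q < m + 1" by (simp only: mult_less_cancel1)
  have x2: "2 * x \<le> x * q" using mult_le_mono2[OF assms(4), of x] by simp
  have xl: "2 * l \<le> x" "x \<ge> 2" using assms(2,3) mult_le_mono[OF assms(3), of l l] mult_le_mono[OF assms(3,2)]
    by (auto simp: x_def)
  have "q \<le> x * q" using xl by simp
  have t: "4 * t \<le> m"
  proof (rule ccontr)
    assume "\<not> 4 * t \<le> m"
    then have m: "m + 1 \<le> 4 * t" by simp
    have "q \<le> 4 * t" using m xm \<open>q \<le> x * q\<close> by linarith
    then have "q * (m + 1) \<le> (4 * t) * (4 * t)" using m by (intro mult_le_mono)
    then show False using nm assms(5) by (simp add: power2_eq_square)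
  qed
  have "(2 * k + 6) * l = 2 * x + 6 * l" by (simp add: x_def algebra_simps)
  then show ?thesis using t xl xm x2 unfolding m_def[symmetric] by linarith
qed

theorem theorem1:
  shows "\<exists>(N :: nat) (b :: nat \<Rightarrow> nat \<Rightarrow> real).
    (\<forall>k\<ge>2. \<forall>q. primepow q \<longrightarrow> b q k > 0) \<and>
    (\<forall>k\<ge>2. \<forall>\<epsilon>>0. \<exists>M :: nat. \<forall>q n G.
       primepow q \<longrightarrow> n \<ge> N \<longrightarrow> G \<in> Cl n q \<longrightarrow> order G \<ge> M \<longrightarrow>
       measure_pmf.prob (replicate_pmf k (pmf_of_set (carrier G)))
         {S. ereal_of_enat (girth (cayley_adj G S)) > ereal (b q k * sqrt (ln (real (order G))))}
       \<ge> 1 - \<epsilon>)"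
proof (rule exI[of _ 2], rule exI[of _ "\<lambda>q k. 1 / (100 * real k * real q ^ 3)"],
    intro conjI allI impI)
  fix k q :: nat assume "k \<ge> 2" "primepow q"
  then show "1 / (100 * real k * real q ^ 3) > 0" using primepow_gt_Suc_0[of q] by simp
next
  fix k :: nat and \<epsilon> :: real assume k: "k \<ge> 2" and \<epsilon>: "\<epsilon> > 0"
  \<comment> \<open>If the order of \<open>G\<close> exceeds \<open>n0 ^ (n0 * n0)\<close> and the bound is not trivial, then \<open>q\<^sup>2 \<le> n\<close>, so
    \<open>order G \<le> n ^ (n * n)\<close> and \<open>n0 < n\<close>.\<close>
  obtain t where t: "(1 / 2 :: real) ^ t < \<epsilon>" using real_arch_pow_inv[OF \<epsilon>, of "1 / 2"] by auto
  define n0 where "n0 = 16 * t\<^sup>2"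
  show "\<exists>M :: nat. \<forall>q n G. primepow q \<longrightarrow> n \<ge> 2 \<longrightarrow> G \<in> Cl n q \<longrightarrow> order G \<ge> M \<longrightarrow>
       measure_pmf.prob (replicate_pmf k (pmf_of_set (carrier G)))
         {S. ereal_of_enat (girth (cayley_adj G S)) >
             ereal (1 / (100 * real k * real q ^ 3) * sqrt (ln (real (order G))))}
       \<ge> 1 - \<epsilon>"
  proof (intro exI[of _ "Suc (n0 ^ (n0 * n0))"] allI impI)
    fix q n G assume q: "primepow q" and n: "n \<ge> 2" and G: "G \<in> Cl n q" and M: "order G \<ge> Suc (n0 ^ (n0 * n0))"
    have q2: "q \<ge> 2" using primepow_gt_Suc_0[OF q] by simp
    define B where "B = 1 / (100 * real k * real q ^ 3) * sqrt (ln (real (order G)))"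
    define l where "l = nat \<lfloor>B\<rfloor>"
    let ?p = "replicate_pmf k (pmf_of_set (carrier G))"
    let ?good = "{S. ereal_of_enat (girth (cayley_adj G S)) > ereal B}"
    let ?bad = "{S. \<exists>c. is_cycle (cayley_adj G S) c \<and> length c \<le> l}"
    have B0: "B \<ge> 0" using M by (simp add: B_def)
    have Bl: "B < real (Suc l)" "real l \<le> B" using B0 by (simp_all add: l_def) linarith
    have "- ?bad \<subseteq> ?good"
    proof
      fix S assume "S \<in> - ?bad"
      then have "girth (cayley_adj G S) > enat l" by (intro girth_gt) (auto simp: not_le)
      then have "enat (Suc l) \<le> girth (cayley_adj G S)" by (simp add: Suc_ile_eq)
      then have "ereal_of_enat (enat (Suc l)) \<le> ereal_of_enat (girth (cayley_adj G S))" by (simp only: ereal_of_enat_le_iff)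
      then show "S \<in> ?good" using Bl(1) by (auto intro: less_le_trans[of _ "ereal (real (Suc l))"])
    qed
    then have "measure_pmf.prob ?p (- ?bad) \<le> measure_pmf.prob ?p ?good"
      by (intro measure_pmf.finite_measure_mono) auto
    then have good: "1 - measure_pmf.prob ?p ?bad \<le> measure_pmf.prob ?p ?good"
      using measure_pmf.prob_compl[of ?bad ?p] by (simp add: Compl_eq_Diff_UNIV)
    have "measure_pmf.prob ?p ?bad \<le> \<epsilon>"
    proof (cases "l = 0")
      case True
      then have "?bad = {}" by (auto simp: is_cycle_def)
      then have "measure_pmf.prob ?p ?bad = 0" by (simp only: measure_empty)
      then show ?thesis using \<epsilon> by linarith
    next
      case False
      define d where "d = n div q - 1"
      obtain F :: "nat ring" and H where cs: "coordinate_space F" and sp: "coordinate_space.spreading F n H d"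
        and GH: "G = proj_group F n H" and ord: "order F = q \<or> order F = q\<^sup>2"
        using Cl_spreading[OF G q n order_refl] unfolding d_def by blast
      interpret coordinate_space F n by (rule cs)
      have "q \<le> q\<^sup>2" using q2 by (simp add: power2_eq_square)
      then have Q: "order F \<ge> 2" "order F \<le> q\<^sup>2" using ord q2 by linarith+
      have ordG: "order G \<le> order F ^ (n * n)" unfolding GH by (rule order_proj_group_le[OF sp])
      have "order G \<le> (q\<^sup>2) ^ (n * n)" using ordG power_mono[OF Q(2)] by (meson le0 le_trans)
      then have "ln (real (order G)) \<le> ln (real ((q\<^sup>2) ^ (n * n)))" using M q2 by (subst ln_le_cancel_iff) (auto simp flip: of_nat_power)
      also have "\<dots> = 2 * real n ^ 2 * ln (real q)"
      proof -
        have "real ((q\<^sup>2) ^ (n * n)) = real q ^ (2 * (n * n))" by (simp add: power_mult)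
        then have "ln (real ((q\<^sup>2) ^ (n * n))) = real (2 * (n * n)) * ln (real q)"
          using q2 by (simp only: ln_realpow of_nat_0_less_iff)
        then show ?thesis by (simp add: power2_eq_square)
      qed
      also have "\<dots> \<le> 2 * real n ^ 2 * real q" using q2 ln_le_minus_one[of "real q"] by (intro mult_left_mono) auto
      also have "\<dots> \<le> (2 * real n * real q) ^ 2"
      proof -
        have "real q \<le> real q ^ 2" using q2 by (simp add: power2_eq_square)
        then have "2 * real n ^ 2 * real q \<le> 4 * real n ^ 2 * real q ^ 2" by (intro mult_mono) auto
        then show ?thesis by (simp add: power_mult_distrib)
      qed
      finally have "sqrt (ln (real (order G))) \<le> 2 * real n * real q" by (intro real_le_lsqrt) auto
      then have "B \<le> 1 / (100 * real k * real q ^ 3) * (2 * real n * real q)"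
        unfolding B_def by (intro mult_left_mono) auto
      also have "\<dots> = real n / (50 * real k * real q ^ 2)" using q2 by (simp add: power3_eq_cube power2_eq_square)
      finally have "real l \<le> real n / (50 * real k * real q ^ 2)" using Bl(2) by linarith
      then have "real (50 * k * q\<^sup>2 * l) \<le> real n" using q2 k by (simp add: field_simps)
      then have nl: "50 * k * q\<^sup>2 * l \<le> n" by (simp only: of_nat_le_iff)
      have "q\<^sup>2 * 1 \<le> q\<^sup>2 * (50 * k * l)" using False k by (intro mult_le_mono) auto
      moreover have "q\<^sup>2 * (50 * k * l) = 50 * k * q\<^sup>2 * l" by (simp only: mult_ac)
      ultimately have qn: "q\<^sup>2 \<le> n" using nl by linarith
      have n0: "n0 < n"
      proof (rule ccontr)
        assume "\<not> n0 < n"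
        then have nn0: "n \<le> n0" by simp
        have "order G \<le> n ^ (n * n)" using ordG power_mono[of "order F" n "n * n"] Q qn by linarith
        also have "\<dots> \<le> n0 ^ (n * n)" using nn0 by (intro power_mono) auto
        also have "\<dots> \<le> n0 ^ (n0 * n0)" using nn0 n by (intro power_increasing mult_le_mono) auto
        finally show False using M by simp
      qed
      have dim: "(2 * k + 6) * l + 8 + t \<le> d"
        unfolding d_def using dimension_bound[OF nl _ k q2] False n0 by (simp add: n0_def)
      have "2 * (2 * l + 2) + 2 < d" using dim by (simp add: algebra_simps)
      then have "measure_pmf.prob ?p ?bad \<le> real ((l + 1) * (2 * k) ^ l) *
          (real (2 * l + 2) * real (order F) ^ (2 * l + 2) * real (order F) ^ (2 * l + 5) / real (order F) ^ d)"
        unfolding GH using n by (intro prob_short_cycle_le[OF sp _ k]) auto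
      also have "\<dots> \<le> (1 / 2) ^ t" by (rule probability_bound_le[OF Q(1) dim])
      finally show ?thesis using t by linarith
    qed
    then show "1 - \<epsilon> \<le> measure_pmf.prob ?p {S. ereal_of_enat (girth (cayley_adj G S)) >
             ereal (1 / (100 * real k * real q ^ 3) * sqrt (ln (real (order G))))}"
      using good unfolding B_def by linarith
  qed
qed

end
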